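(* (i) Let $p$ be an odd prime and $m$ a positive integer such that either ($p\ge 5$ and $m\ge 2$) or ($p\ge 3$ and $m\ge 3$), and let $q=p^m$. Then there exist at least two $(q-6)$-dimensional orbifold lens spaces $L(q:p_1,\dots,p_n)$ and $L(q:s_1,\dots,s_n)$ (with $n=\frac{q-1}{2}-2$), whose groups have order $p^m$, which are isospectral but not isometric. (ii) Let $p_1\neq p_2$ be odd primes with $q=p_1p_2\ge 33$. Then there exist at least two $(q-6)$-dimensional orbifold lens spaces with groups of order $p_1p_2$ which are isospectral but not isometric. (iii) Let $q=2^m$ with $m\ge 6$. Then there exist at least two $(q-5)$-dimensional orbifold lens spaces (with $n=\frac q2-2$) with groups of order $2^m$ which are isospectral but not isometric. (iv) Let $q=2p$ with $p\ge 7$ an odd prime. Then there exist at least two $(q-5)$-dimensional orbifold lens spaces with groups of order $2p$ which are isospectral but not isometric.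
   Context: Let $R(\theta)=\begin{pmatrix}\cos 2\pi\theta & \sin 2\pi\theta\\ -\sin 2\pi\theta & \cos 2\pi\theta\end{pmatrix}$. For an integer $q\ge 2$ and integers $p_1,\dots,p_n$ with $\gcd(p_1,\dots,p_n,q)=1$, let $g=\mathrm{diag}(R(p_1/q),\dots,R(p_n/q))\in O(2n)$ and $G=\langle g\rangle$, a cyclic group of order $q$ (called the group, or fundamental group, of the lens space). The orbifold lens space $L(q:p_1,\dots,p_n)$ is $S^{2n-1}/G$, where $S^{2n-1}$ is the unit sphere with its round metric of curvature $1$; it is a $(2n-1)$-dimensional Riemannian orbifold with the induced metric. The $p_i$ are NOT required to be coprime to $q$, so $G$ may have fixed points. The spectrum of such a space is the spectrum (with multiplicities) of the Laplacian acting on $G$-invariant smooth functions on the sphere; two spaces are isospectral if their spectra coincide. *)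

theory Defs
  imports "HOL-Analysis.Analysis" "HOL-Library.Extended_Nat"
begin

text \<open>Ambient space R^(2n) is modelled as (real^'n) \<times> (real^'n): the point (x,y) has
  coordinates x_j, y_j, and the j-th rotation block R(p_j/q) acts on (x_j,y_j).\<close>

definition lens_gen :: "nat \<Rightarrow> ('n::finite \<Rightarrow> int) \<Rightarrow> ((real^'n) \<times> (real^'n)) \<Rightarrow> ((real^'n) \<times> (real^'n))" where
  "lens_gen q p = (\<lambda>(x, y).
     ((\<chi> j. cos (2 * pi * real_of_int (p j) / real q) * x $ j + sin (2 * pi * real_of_int (p j) / real q) * y $ j),
      (\<chi> j. - sin (2 * pi * real_of_int (p j) / real q) * x $ j + cos (2 * pi * real_of_int (p j) / real q) * y $ j)))"

definition lens_data :: "nat \<Rightarrow> ('n::finite \<Rightarrow> int) \<Rightarrow> bool" where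
  "lens_data q p \<longleftrightarrow> q \<ge> 2 \<and> Gcd (insert (int q) (range p)) = 1"

definition lens_group :: "nat \<Rightarrow> ('n::finite \<Rightarrow> int) \<Rightarrow> (((real^'n) \<times> (real^'n)) \<Rightarrow> ((real^'n) \<times> (real^'n))) set" where
  "lens_group q p = {lens_gen q p ^^ k | k. True}"

fun Ck_on :: "nat \<Rightarrow> 'a::euclidean_space set \<Rightarrow> ('a \<Rightarrow> real) \<Rightarrow> bool" where
  "Ck_on 0 S f = continuous_on S f"
| "Ck_on (Suc k) S f = (\<exists>f'. (\<forall>x\<in>S. (f has_derivative f' x) (at x)) \<and> (\<forall>v. Ck_on k S (\<lambda>x. f' x v)))"

definition smooth_on :: "'a::euclidean_space set \<Rightarrow> ('a \<Rightarrow> real) \<Rightarrow> bool" where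
  "smooth_on S f \<longleftrightarrow> (\<forall>k. Ck_on k S f)"

definition dirderiv :: "('a::real_normed_vector \<Rightarrow> real) \<Rightarrow> 'a \<Rightarrow> 'a \<Rightarrow> real" where
  "dirderiv F v x = deriv (\<lambda>t. F (x + t *\<^sub>R v)) 0"

definition eucl_laplacian :: "('a::euclidean_space \<Rightarrow> real) \<Rightarrow> 'a \<Rightarrow> real" where
  "eucl_laplacian F x = (\<Sum>b\<in>Basis. dirderiv (dirderiv F b) b x)"

text \<open>A function f on the unit sphere (represented as a function vanishing off the sphere)
  is extended homogeneously of degree 0; the (positive) Laplace--Beltrami operator of the round
  sphere is minus the Euclidean Laplacian of this extension, restricted to the sphere.\<close>
definition radial_ext :: "('a::real_normed_vector \<Rightarrow> real) \<Rightarrow> 'a \<Rightarrow> real" where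
  "radial_ext f x = f ((1 / norm x) *\<^sub>R x)"

definition lens_eigenspace :: "nat \<Rightarrow> ('n::finite \<Rightarrow> int) \<Rightarrow> real \<Rightarrow> ((real^'n) \<times> (real^'n) \<Rightarrow> real) set" where
  "lens_eigenspace q p lam = {f.
     (\<forall>x. x \<notin> sphere 0 1 \<longrightarrow> f x = 0) \<and>
     smooth_on (- {0}) (radial_ext f) \<and>
     (\<forall>h\<in>lens_group q p. \<forall>x\<in>sphere 0 1. f (h x) = f x) \<and>
     (\<forall>x\<in>sphere 0 1. - eucl_laplacian (radial_ext f) x = lam * f x)}"

definition fun_lin_indep :: "('a \<Rightarrow> real) set \<Rightarrow> bool" where
  "fun_lin_indep B \<longleftrightarrow> (\<forall>c. (\<forall>x. (\<Sum>f\<in>B. c f * f x) = 0) \<longrightarrow> (\<forall>f\<in>B. c f = 0))"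

definition fun_dim :: "('a \<Rightarrow> real) set \<Rightarrow> enat" where
  "fun_dim V = Sup {enat (card B) | B. finite B \<and> B \<subseteq> V \<and> fun_lin_indep B}"

definition lens_spectrum :: "nat \<Rightarrow> ('n::finite \<Rightarrow> int) \<Rightarrow> real \<Rightarrow> enat" where
  "lens_spectrum q p = (\<lambda>lam. fun_dim (lens_eigenspace q p lam))"

definition lens_isospectral :: "nat \<Rightarrow> ('n::finite \<Rightarrow> int) \<Rightarrow> ('n \<Rightarrow> int) \<Rightarrow> bool" where
  "lens_isospectral q p s \<longleftrightarrow> lens_spectrum q p = lens_spectrum q s"

definition lens_orbits :: "nat \<Rightarrow> ('n::finite \<Rightarrow> int) \<Rightarrow> ((real^'n) \<times> (real^'n)) set set" where
  "lens_orbits q p = {(\<lambda>h. h x) ` lens_group q p | x. x \<in> sphere 0 1}"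

definition orbit_dist :: "((real^'n::finite) \<times> (real^'n)) set \<Rightarrow> ((real^'n) \<times> (real^'n)) set \<Rightarrow> real" where
  "orbit_dist A B = Inf {arccos (x \<bullet> y) | x y. x \<in> A \<and> y \<in> B}"

definition lens_isometric :: "nat \<Rightarrow> ('n::finite \<Rightarrow> int) \<Rightarrow> ('n \<Rightarrow> int) \<Rightarrow> bool" where
  "lens_isometric q p s \<longleftrightarrow> (\<exists>\<Phi>. bij_betw \<Phi> (lens_orbits q p) (lens_orbits q s) \<and>
      (\<forall>A\<in>lens_orbits q p. \<forall>B\<in>lens_orbits q p. orbit_dist (\<Phi> A) (\<Phi> B) = orbit_dist A B))"

definition iso_not_isom :: "nat \<Rightarrow> ('n::finite \<Rightarrow> int) \<Rightarrow> ('n \<Rightarrow> int) \<Rightarrow> bool" where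
  "iso_not_isom q p s \<longleftrightarrow> lens_data q p \<and> lens_data q s \<and> lens_isospectral q p s \<and> \<not> lens_isometric q p s"

end

theory Submission
  imports Defs
    "HOL-Library.Function_Algebras"
    "HOL-Computational_Algebra.Formal_Power_Series"
    "HOL-Number_Theory.Cong"
begin

text \<open>The two lens spaces have as weights all residues \<open>1, \<dots>, \<lfloor>q/2\<rfloor>\<close> except \<open>1, a\<close>, respectively
  except \<open>1, b\<close>, where \<open>a\<close> is not a unit modulo \<open>q\<close>, \<open>b\<close> is a unit multiple of \<open>a\<close>, and
  \<open>1 \<plusminus> a\<close>, \<open>1 \<plusminus> b\<close> are units.

  Isospectrality. A Laplace eigenspace on the sphere splits under the maximal torus of \<open>O(2n)\<close>
  into weight spaces indexed by \<open>w \<in> \<int>\<^sup>n\<close>, and the functions invariant under the group of the lens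
  space with weights \<open>p\<close> are those with weights in the lattice \<open>\<Sum> p\<^sub>j w\<^sub>j \<equiv> 0\<close> modulo \<open>q\<close>.
  Root vectors of \<open>u(n)\<close> move between weights of equal \<open>1\<close>-norm and are injective on smooth
  functions by an explicit ODE along great circles, so the multiplicity of \<open>w\<close> depends on its \<open>1\<close>-norm
  only. No classification of spherical harmonics is needed. It remains to count lattice points
  of given \<open>1\<close>-norm. In the generating function, a sum over the characters \<open>l\<close> modulo \<open>q\<close>, the
  product over all residues is invariant under units, and the two omitted residues contribute
  Ramanujan-type sums at \<open>1\<close>, \<open>a\<close>, \<open>1 + a\<close> and \<open>1 - a\<close>, which see their arguments up to units only.

  Non-isometry. An isometry of the quotients lifts locally, near points with trivial stabiliser, to
  an orthogonal map. The lifts agree up to deck transformations on a star-shaped slit domain,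
  so the groups are conjugate in \<open>O(2n)\<close>. Comparing eigenvalues of \<open>g + g\<^sup>-\<^sup>1\<close>, the two sets of
  weights agree up to sign and a unit \<open>k\<close>. Among the omitted residues only \<open>1\<close> is a unit, hence
  \<open>k \<equiv> \<plusminus>1\<close> and then \<open>a \<equiv> \<plusminus>b\<close>.\<close>

section \<open>Smooth functions on open sets\<close>

text \<open>Origin of the pairs. For \<open>q = p^m\<close> they are \<open>a = p\<close>,
  \<open>b = 2 p\<close>; for \<open>q = 2^m\<close> they are \<open>2\<close> and \<open>6\<close>;
  for \<open>q = r P\<close> they are \<open>2 e\<close> and \<open>3 e\<close>, where
  \<open>e\<close> is \<open>0\<close> modulo \<open>r\<close> and \<open>1\<close> modulo
  \<open>P\<close>. Divisibility by \<open>p\<close>, \<open>2\<close> or \<open>r\<close> makes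
  \<open>1 \<plusminus> a\<close> and \<open>1 \<plusminus> b\<close> congruent to \<open>1\<close>
  there. The only further condition is at \<open>P\<close>, where \<open>1 \<plusminus> 2\<close>,
  \<open>1 \<plusminus> 3\<close> and \<open>2 \<plusminus> 3\<close> must not vanish; this is the
  source of \<open>P \<ge> 7\<close>. As \<open>r = 2\<close> is allowed, the last choice serves
  both \<open>q = p1 p2\<close> and \<open>q = 2 p\<close>. Why \<open>a\<close> is a non-unit:
  otherwise a factor \<open>k\<close> congruent to \<open>\<plusminus> a\<close> could exchange the
  omitted classes of \<open>1\<close> and \<open>a\<close>. The obstacle in the spectral part is
  that \<open>fun_dim\<close> is a supremum over finite independent families of real functions,
  whereas the torus acts diagonally only on complex ones. Multiplicities are therefore compared by
  injective complex-linear maps applied to finite families, with a return to real and imaginary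
  parts at the end, once in each direction.\<close>

lemma dirderiv_eq:
  assumes "(F has_derivative F') (at x)"
  shows "dirderiv F v x = F' v"
proof -
  have *: "((\<lambda>t. x + t *\<^sub>R v) has_derivative (\<lambda>t. t *\<^sub>R v)) (at 0)"
    by (auto intro!: derivative_eq_intros)
  have "((\<lambda>t. F (x + t *\<^sub>R v)) has_derivative (\<lambda>t. F' (t *\<^sub>R v))) (at 0)"
    using has_derivative_compose[OF *, of F F'] assms by simp
  moreover have "(\<lambda>t. F' (t *\<^sub>R v)) = (\<lambda>t. F' v * t)"
    using linear_scale[OF has_derivative_linear[OF assms]] by (auto simp: fun_eq_iff)
  ultimately have "((\<lambda>t. F (x + t *\<^sub>R v)) has_field_derivative F' v) (at 0)"
    by (simp add: has_field_derivative_def)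
  then show ?thesis unfolding dirderiv_def by (rule DERIV_imp_deriv)
qed

lemma Ck_on_cong:
  assumes "open S" "\<And>x. x \<in> S \<Longrightarrow> f x = g x" "Ck_on k S f"
  shows "Ck_on k S g"
  using assms(2,3)
proof (cases k)
  case 0
  then show ?thesis using assms by (auto cong: continuous_on_cong)
next
  case (Suc l)
  obtain f' where f': "\<forall>x\<in>S. (f has_derivative f' x) (at x)" "\<forall>v. Ck_on l S (\<lambda>x. f' x v)"
    using assms Suc by auto
  have "(g has_derivative f' x) (at x)" if "x \<in> S" for x
    using has_derivative_transform_within_open[OF f'(1)[rule_format, OF that] assms(1) that] assms(2) by blast
  then show ?thesis using Suc f' by auto
qed

text \<open>On an open set the derivative is unique, so the existential witness in
  \<open>Ck_on\<close> is forced to be \<open>dirderiv F\<close>. This makes the recursion usable in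
  inductions.\<close>

lemma Ck_on_Suc_iff:
  assumes "open S"
  shows "Ck_on (Suc k) S F \<longleftrightarrow>
    (\<forall>x\<in>S. (F has_derivative (\<lambda>v. dirderiv F v x)) (at x)) \<and> (\<forall>v. Ck_on k S (dirderiv F v))"
proof
  assume "Ck_on (Suc k) S F"
  then obtain f' where f': "\<forall>x\<in>S. (F has_derivative f' x) (at x)" "\<forall>v. Ck_on k S (\<lambda>x. f' x v)"
    by auto
  have eq: "dirderiv F v x = f' x v" if "x \<in> S" for v x using f'(1) that dirderiv_eq by blast
  have "(F has_derivative (\<lambda>v. dirderiv F v x)) (at x)" if "x \<in> S" for x
    using f'(1) that eq[OF that] by simp
  moreover have "Ck_on k S (dirderiv F v)" for v
    by (rule Ck_on_cong[OF assms _ f'(2)[rule_format, of v]]) (use eq in auto)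
  ultimately show "(\<forall>x\<in>S. (F has_derivative (\<lambda>v. dirderiv F v x)) (at x)) \<and> (\<forall>v. Ck_on k S (dirderiv F v))"
    by blast
next
  assume "(\<forall>x\<in>S. (F has_derivative (\<lambda>v. dirderiv F v x)) (at x)) \<and> (\<forall>v. Ck_on k S (dirderiv F v))"
  then show "Ck_on (Suc k) S F" by auto
qed

lemma Ck_on_SucI:
  assumes "open S" "\<And>x. x \<in> S \<Longrightarrow> (F has_derivative F' x) (at x)" "\<And>v. Ck_on k S (\<lambda>x. F' x v)"
  shows "Ck_on (Suc k) S F"
  using assms by auto

lemma Ck_on_Suc_D: "open S \<Longrightarrow> Ck_on (Suc k) S F \<Longrightarrow> Ck_on k S F"
proof (induction k arbitrary: F)
  case 0
  then have "\<forall>x\<in>S. (F has_derivative (\<lambda>v. dirderiv F v x)) (at x)" by (simp add: Ck_on_Suc_iff del: Ck_on.simps)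
  then show ?case
    by (auto intro!: continuous_at_imp_continuous_on has_derivative_continuous)
next
  case (Suc k)
  then show ?case by (metis Ck_on_Suc_iff)
qed

lemma Ck_on_const: "Ck_on k S (\<lambda>x. c)"
proof (induction k arbitrary: c)
  case (Suc k)
  show ?case by (simp, rule exI[of _ "\<lambda>x v. 0"]) (use Suc in auto)
qed simp

lemma Ck_on_linear:
  assumes "bounded_linear l"
  shows "Ck_on k S l"
proof (cases k)
  case 0 then show ?thesis using assms by (simp add: linear_continuous_on)
next
  case (Suc j)
  then show ?thesis
    by (simp, intro exI[of _ "\<lambda>x. l"]) (use assms Ck_on_const in \<open>auto intro: bounded_linear_imp_has_derivative\<close>)
qed

lemma Ck_on_add: "open S \<Longrightarrow> Ck_on k S f \<Longrightarrow> Ck_on k S g \<Longrightarrow> Ck_on k S (\<lambda>x. f x + g x)"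
proof (induction k arbitrary: f g)
  case 0 then show ?case by (auto intro: continuous_intros)
next
  case (Suc k)
  from Suc.prems show ?case unfolding Ck_on_Suc_iff[OF Suc.prems(1)]
    apply (intro conjI ballI allI)
    subgoal for x
      apply (rule has_derivative_eq_rhs[where f'="\<lambda>v. dirderiv f v x + dirderiv g v x"])
       apply (auto intro!: has_derivative_add)[1]
      apply (rule ext, rule dirderiv_eq[symmetric])
      apply (auto intro!: has_derivative_add)[1]
      done
    subgoal for v
      apply (rule Ck_on_cong[OF Suc.prems(1), where f="\<lambda>x. dirderiv f v x + dirderiv g v x"])
       apply (rule dirderiv_eq[symmetric])
       apply (auto intro!: has_derivative_add)[1]
      using Suc.IH Suc.prems(1) by blast
    done
qed

lemma Ck_on_mult: "open S \<Longrightarrow> Ck_on k S f \<Longrightarrow> Ck_on k S g \<Longrightarrow> Ck_on k S (\<lambda>x. f x * g x)"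
proof (induction k arbitrary: f g)
  case 0 then show ?case by (auto intro: continuous_intros)
next
  case (Suc k)
  note f = Suc.prems(2)[unfolded Ck_on_Suc_iff[OF Suc.prems(1)]]
  note g = Suc.prems(3)[unfolded Ck_on_Suc_iff[OF Suc.prems(1)]]
  show ?case
  proof (rule Ck_on_SucI[OF Suc.prems(1)])
    show "((\<lambda>x. f x * g x) has_derivative (\<lambda>v. f x * dirderiv g v x + dirderiv f v x * g x)) (at x)" if "x \<in> S" for x
      using f g that by (auto intro!: has_derivative_mult)
    show "Ck_on k S (\<lambda>x. f x * dirderiv g v x + dirderiv f v x * g x)" for v
      using f g Ck_on_Suc_D[OF Suc.prems(1,2)] Ck_on_Suc_D[OF Suc.prems(1,3)]
      by (intro Ck_on_add[OF Suc.prems(1)] Suc.IH[OF Suc.prems(1)]) auto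
  qed
qed

lemma Ck_on_compose_linear:
  assumes "open S" "bounded_linear U" "U ` S \<subseteq> S"
  shows "Ck_on k S F \<Longrightarrow> Ck_on k S (\<lambda>x. F (U x))"
proof (induction k arbitrary: F)
  case 0 then show ?case
    using assms continuous_on_compose2[of S F S U] linear_continuous_on by auto
next
  case (Suc k)
  note f = Suc.prems[unfolded Ck_on_Suc_iff[OF assms(1)]]
  show ?case
  proof (rule Ck_on_SucI[OF assms(1)])
    show "((\<lambda>x. F (U x)) has_derivative (\<lambda>v. dirderiv F (U v) (U x))) (at x)" if "x \<in> S" for x
      using has_derivative_compose[OF bounded_linear_imp_has_derivative[OF assms(2)], of F "\<lambda>v. dirderiv F v (U x)" x UNIV] f assms(3) that
      by auto
    show "Ck_on k S (\<lambda>x. dirderiv F (U v) (U x))" for v using f Suc.IH by blast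
  qed
qed

lemma smooth_on_deriv:
  assumes "open S" "smooth_on S F" "x \<in> S"
  shows "(F has_derivative (\<lambda>v. dirderiv F v x)) (at x)"
  using assms Ck_on_Suc_iff unfolding smooth_on_def by blast

lemma smooth_on_dirderiv: "open S \<Longrightarrow> smooth_on S F \<Longrightarrow> smooth_on S (dirderiv F v)"
  using Ck_on_Suc_iff unfolding smooth_on_def by blast

lemma smooth_on_continuous: "smooth_on S F \<Longrightarrow> continuous_on S F"
  using Ck_on.simps(1) unfolding smooth_on_def by blast

lemma smooth_on_cong: "open S \<Longrightarrow> (\<And>x. x \<in> S \<Longrightarrow> f x = g x) \<Longrightarrow> smooth_on S f \<Longrightarrow> smooth_on S g"
  using Ck_on_cong unfolding smooth_on_def by blast

lemma smooth_on_const: "smooth_on S (\<lambda>x. c)"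
  by (simp add: smooth_on_def Ck_on_const)

lemma smooth_on_add: "open S \<Longrightarrow> smooth_on S f \<Longrightarrow> smooth_on S g \<Longrightarrow> smooth_on S (\<lambda>x. f x + g x)"
  by (simp add: smooth_on_def Ck_on_add)

lemma smooth_on_mult: "open S \<Longrightarrow> smooth_on S f \<Longrightarrow> smooth_on S g \<Longrightarrow> smooth_on S (\<lambda>x. f x * g x)"
  by (simp add: smooth_on_def Ck_on_mult)

lemma smooth_on_sum: "open S \<Longrightarrow> (\<And>i. i \<in> I \<Longrightarrow> smooth_on S (f i)) \<Longrightarrow> smooth_on S (\<lambda>x. \<Sum>i\<in>I. f i x)"
  by (induction I rule: infinite_finite_induct) (auto intro: smooth_on_const smooth_on_add)

lemma smooth_on_linear: "bounded_linear l \<Longrightarrow> smooth_on S l"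
  by (simp add: smooth_on_def Ck_on_linear)

section \<open>Linearity and symmetry of iterated directional derivatives\<close>

lemma dirderiv_linear:
  assumes "open S" "smooth_on S F" "x \<in> S"
  shows "linear (\<lambda>v. dirderiv F v x)"
  using smooth_on_deriv[OF assms] has_derivative_linear by blast

lemma dirderiv_expand:
  assumes "open S" "smooth_on S F" "x \<in> S"
  shows "dirderiv F v x = (\<Sum>b\<in>Basis. (v \<bullet> b) * dirderiv F b x)"
proof -
  have "dirderiv F v x = dirderiv F (\<Sum>b\<in>Basis. (v \<bullet> b) *\<^sub>R b) x" by (simp add: euclidean_representation)
  also have "\<dots> = (\<Sum>b\<in>Basis. (v \<bullet> b) * dirderiv F b x)"
    by (simp only: linear_sum[OF dirderiv_linear[OF assms]] linear_scale[OF dirderiv_linear[OF assms]] real_scaleR_def)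
  finally show ?thesis .
qed

text \<open>The mean value theorem is applied once in each direction. The left side is symmetric in
  \<open>a\<close> and \<open>b\<close>, the right side is not: this is the core of Schwarz's
  theorem.\<close>

lemma mixed_increment:
  fixes F :: "'a::euclidean_space \<Rightarrow> real"
  assumes "open S" "smooth_on S F" "h > 0"
    and sub: "\<And>s t. 0 \<le> s \<Longrightarrow> s \<le> h \<Longrightarrow> 0 \<le> t \<Longrightarrow> t \<le> h \<Longrightarrow> x + s *\<^sub>R a + t *\<^sub>R b \<in> S"
  shows "\<exists>s t. 0 \<le> s \<and> s \<le> h \<and> 0 \<le> t \<and> t \<le> h \<and>
     F (x + h *\<^sub>R a + h *\<^sub>R b) - F (x + h *\<^sub>R a) - F (x + h *\<^sub>R b) + F x
       = h * h * dirderiv (dirderiv F a) b (x + s *\<^sub>R a + t *\<^sub>R b)"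
proof -
  \<comment> \<open>The first difference in direction \<open>b\<close>, as a function of the
    position along \<open>a\<close>.\<close>
  define G where "G s = F (x + s *\<^sub>R a + h *\<^sub>R b) - F (x + s *\<^sub>R a)" for s
  have d: "((\<lambda>s. f (y + s *\<^sub>R v)) has_real_derivative dirderiv f v (y + s *\<^sub>R v)) (at s)"
    if "smooth_on S f" "y + s *\<^sub>R v \<in> S" for f y v s
  proof -
    have *: "((\<lambda>t. y + t *\<^sub>R v) has_derivative (\<lambda>t. t *\<^sub>R v)) (at s)"
      by (auto intro!: derivative_eq_intros)
    have "((\<lambda>t. f (y + t *\<^sub>R v)) has_derivative (\<lambda>t. dirderiv f (t *\<^sub>R v) (y + s *\<^sub>R v))) (at s)"
      using has_derivative_compose[OF *, of f "\<lambda>w. dirderiv f w (y + s *\<^sub>R v)"]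
        smooth_on_deriv[OF assms(1) that(1,2)] by simp
    moreover have "(\<lambda>t. dirderiv f (t *\<^sub>R v) (y + s *\<^sub>R v)) = (\<lambda>t. dirderiv f v (y + s *\<^sub>R v) * t)"
      using linear_scale[OF dirderiv_linear[OF assms(1) that]] by (auto simp: fun_eq_iff)
    ultimately show ?thesis by (simp add: has_field_derivative_def)
  qed
  have dG: "(G has_real_derivative (dirderiv F a (x + s *\<^sub>R a + h *\<^sub>R b) - dirderiv F a (x + s *\<^sub>R a))) (at s)"
    if "0 \<le> s" "s \<le> h" for s
  proof -
    have "x + h *\<^sub>R b + s *\<^sub>R a \<in> S" "x + s *\<^sub>R a \<in> S"
      using sub[OF that, of h] sub[OF that, of 0] assms(3) by (auto simp: algebra_simps)
    from d[OF assms(2) this(1)] d[OF assms(2) this(2)]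
    show ?thesis unfolding G_def by (intro derivative_intros) (simp_all add: algebra_simps)
  qed
  obtain s where s: "0 < s" "s < h"
     "G h - G 0 = (h - 0) * (dirderiv F a (x + s *\<^sub>R a + h *\<^sub>R b) - dirderiv F a (x + s *\<^sub>R a))"
    using MVT2[OF assms(3), of G, OF dG] by auto
  have dH: "((\<lambda>t. dirderiv F a (x + s *\<^sub>R a + t *\<^sub>R b)) has_real_derivative
      dirderiv (dirderiv F a) b (x + s *\<^sub>R a + t *\<^sub>R b)) (at t)" if "0 \<le> t" "t \<le> h" for t
    using d[OF smooth_on_dirderiv[OF assms(1,2)], of "x + s *\<^sub>R a" t b] sub[of s t] s that by auto
  obtain t where t: "0 < t" "t < h"
     "dirderiv F a (x + s *\<^sub>R a + h *\<^sub>R b) - dirderiv F a (x + s *\<^sub>R a + 0 *\<^sub>R b) = (h - 0) * dirderiv (dirderiv F a) b (x + s *\<^sub>R a + t *\<^sub>R b)"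
    using MVT2[OF assms(3), of "\<lambda>t. dirderiv F a (x + s *\<^sub>R a + t *\<^sub>R b)", OF dH] by auto
  show ?thesis
    using s t unfolding G_def by (intro exI[of _ s] exI[of _ t]) simp
qed

text \<open>Schwarz's theorem. Both mixed derivatives represent the same second difference at points
  near \<open>x\<close>; if they differed at \<open>x\<close>, continuity would keep them apart
  nearby.\<close>

lemma dirderiv_commute:
  fixes F :: "'a::euclidean_space \<Rightarrow> real"
  assumes S: "open S" "smooth_on S F" "x \<in> S"
  shows "dirderiv (dirderiv F a) b x = dirderiv (dirderiv F b) a x"
proof (rule ccontr)
  assume neq: "dirderiv (dirderiv F a) b x \<noteq> dirderiv (dirderiv F b) a x"
  define P where "P = dirderiv (dirderiv F a) b"
  define Q where "Q = dirderiv (dirderiv F b) a"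
  \<comment> \<open>Half the gap: a number within \<open>e\<close> of \<open>P x\<close> cannot also
    be within \<open>e\<close> of \<open>Q x\<close>.\<close>
  define e where "e = \<bar>P x - Q x\<bar> / 2"
  have e: "e > 0" using neq by (simp add: e_def P_def Q_def)
  have "isCont (dirderiv (dirderiv F u) v) x" for u v
    using smooth_on_continuous[OF smooth_on_dirderiv[OF S(1) smooth_on_dirderiv[OF S(1,2)]]] S(1,3)
    by (simp add: continuous_on_eq_continuous_at)
  then have "isCont P x" "isCont Q x" by (simp_all add: P_def Q_def)
  note cont = this
  obtain d1 where d1: "d1 > 0" "\<And>y. dist y x < d1 \<Longrightarrow> dist (P y) (P x) < e"
    using cont(1) e unfolding continuous_at_eps_delta by meson
  obtain d2 where d2: "d2 > 0" "\<And>y. dist y x < d2 \<Longrightarrow> dist (Q y) (Q x) < e"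
    using cont(2) e unfolding continuous_at_eps_delta by meson
  obtain d3 where d3: "d3 > 0" "ball x d3 \<subseteq> S" using S open_contains_ball by blast
  define d where "d = min d1 (min d2 d3)"
  \<comment> \<open>Small enough for the parallelogram spanned by \<open>h a\<close> and
    \<open>h b\<close> at \<open>x\<close> to stay within \<open>d\<close>; the \<open>+ 1\<close>
    covers the case that both vectors are zero.\<close>
  define h where "h = d / 2 / (norm a + norm b + 1)"
  have dpos: "d > 0" using d1 d2 d3 by (simp add: d_def)
  have np: "norm a + norm b + 1 > 0" by (smt (verit) norm_ge_zero)
  then have h: "h > 0" using dpos by (simp add: h_def)
  have hb: "h * (norm a + norm b + 1) < d"
  proof -
    have "h * (norm a + norm b + 1) = d / 2" using np unfolding h_def by (metis less_irrefl nonzero_eq_divide_eq)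
    then show ?thesis using dpos by simp
  qed
  have near: "dist (x + s *\<^sub>R u + t *\<^sub>R v) x < d" if "0 \<le> s" "s \<le> h" "0 \<le> t" "t \<le> h" "norm u + norm v = norm a + norm b" for s t u v
  proof -
    have "dist (x + s *\<^sub>R u + t *\<^sub>R v) x \<le> s * norm u + t * norm v"
      using norm_triangle_ineq[of "s *\<^sub>R u" "t *\<^sub>R v"] that by (simp add: dist_norm algebra_simps)
    also have "\<dots> \<le> h * norm u + h * norm v" using that by (intro add_mono mult_right_mono) auto
    also have "\<dots> = h * (norm a + norm b)" using that(5) by (simp add: distrib_left[symmetric])
    also have "\<dots> \<le> h * (norm a + norm b + 1)" using h by simp
    finally show ?thesis using hb by simp
  qed
  have inS: "x + s *\<^sub>R u + t *\<^sub>R v \<in> S" if "0 \<le> s" "s \<le> h" "0 \<le> t" "t \<le> h" "norm u + norm v = norm a + norm b" for s t u v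
    using near[OF that] d3 by (auto simp: d_def dist_commute)
  obtain s t where st: "0 \<le> s" "s \<le> h" "0 \<le> t" "t \<le> h"
     "F (x + h *\<^sub>R a + h *\<^sub>R b) - F (x + h *\<^sub>R a) - F (x + h *\<^sub>R b) + F x = h * h * P (x + s *\<^sub>R a + t *\<^sub>R b)"
    using mixed_increment[OF S(1,2) h, of x a b, OF inS] unfolding P_def by auto
  obtain s' t' where st': "0 \<le> s'" "s' \<le> h" "0 \<le> t'" "t' \<le> h"
     "F (x + h *\<^sub>R b + h *\<^sub>R a) - F (x + h *\<^sub>R b) - F (x + h *\<^sub>R a) + F x = h * h * Q (x + s' *\<^sub>R b + t' *\<^sub>R a)"
    using mixed_increment[OF S(1,2) h, of x b a, OF inS] unfolding Q_def by (auto simp: add.commute)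
  have "h * h * P (x + s *\<^sub>R a + t *\<^sub>R b) = h * h * Q (x + s' *\<^sub>R b + t' *\<^sub>R a)"
    using st(5) st'(5) by (simp add: algebra_simps)
  then have eq: "P (x + s *\<^sub>R a + t *\<^sub>R b) = Q (x + s' *\<^sub>R b + t' *\<^sub>R a)" using h by simp
  have "dist (P (x + s *\<^sub>R a + t *\<^sub>R b)) (P x) < e"
    using near[OF st(1-4)] by (intro d1(2)) (auto simp: d_def)
  moreover have "dist (Q (x + s' *\<^sub>R b + t' *\<^sub>R a)) (Q x) < e"
    using near[OF st'(1-4)] by (intro d2(2)) (auto simp: d_def)
  ultimately show False using eq unfolding e_def dist_real_def by (smt (verit) field_sum_of_halves)
qed

section \<open>Homogeneous eigenfunctions of the spherical Laplacian\<close>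

lemma Ck_on_sum: "open S \<Longrightarrow> (\<And>i. i \<in> I \<Longrightarrow> Ck_on k S (f i)) \<Longrightarrow> Ck_on k S (\<lambda>x. \<Sum>i\<in>I. f i x)"
  by (induction I rule: infinite_finite_induct) (auto intro: Ck_on_const Ck_on_add)

lemma dirderiv_cong:
  assumes "open S" "x \<in> S" "\<And>y. y \<in> S \<Longrightarrow> F y = G y" "smooth_on S F"
  shows "dirderiv F v x = dirderiv G v x"
  using dirderiv_eq[OF has_derivative_transform_within_open[OF smooth_on_deriv[OF assms(1,4,2)] assms(1,2)], of G v] assms(3)
  by auto

lemma dirderiv_compose_linear:
  assumes "open S" "bounded_linear U" "U x \<in> S" "smooth_on S F"
  shows "dirderiv (\<lambda>x. F (U x)) v x = dirderiv F (U v) (U x)"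
  using has_derivative_compose[OF bounded_linear_imp_has_derivative[OF assms(2)] smooth_on_deriv[OF assms(1,4,3)]]
  by (auto intro: dirderiv_eq)

lemma dirderiv_lincomb:
  assumes "open S" "x \<in> S" "smooth_on S F" "smooth_on S G"
  shows "dirderiv (\<lambda>x. a * F x + b * G x) v x = a * dirderiv F v x + b * dirderiv G v x"
  by (rule dirderiv_eq, rule has_derivative_eq_rhs)
    (use smooth_on_deriv[OF assms(1,3,2)] smooth_on_deriv[OF assms(1,4,2)] in \<open>auto intro!: derivative_eq_intros\<close>)

lemma smooth_on_lincomb:
  "open S \<Longrightarrow> smooth_on S F \<Longrightarrow> smooth_on S G \<Longrightarrow> smooth_on S (\<lambda>x. a * F x + b * G x)"
  by (intro smooth_on_add smooth_on_mult smooth_on_const)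

lemma dirderiv_sum:
  assumes "open S" "x \<in> S" "\<And>i. i \<in> I \<Longrightarrow> smooth_on S (f i)"
  shows "dirderiv (\<lambda>x. \<Sum>i\<in>I. f i x) v x = (\<Sum>i\<in>I. dirderiv (f i) v x)"
  by (rule dirderiv_eq) (intro has_derivative_sum smooth_on_deriv[OF assms(1) _ assms(2)] assms(3))

lemma dirderiv_linear_mult:
  assumes "open S" "x \<in> S" "bounded_linear l" "smooth_on S h"
  shows "dirderiv (\<lambda>x. l x * h x) v x = l v * h x + l x * dirderiv h v x"
  by (rule dirderiv_eq, rule has_derivative_eq_rhs)
    (use smooth_on_deriv[OF assms(1,4,2)] bounded_linear_imp_has_derivative[OF assms(3)] in
      \<open>auto intro!: derivative_eq_intros simp: algebra_simps\<close>)

lemma open_Compl_0: "open (- {0 :: 'a::euclidean_space})" by auto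

text \<open>The degree-0 homogeneous extensions of eigenfunctions. Scaling turns the equation on the sphere
  into \<open>\<bar>x\<bar>\<^sup>2 \<Delta>F = - lam F\<close> off the origin, which can be differentiated in all directions.\<close>
definition hom_eig :: "real \<Rightarrow> ('a::euclidean_space \<Rightarrow> real) set" where
  "hom_eig lam = {F. F 0 = 0 \<and> (\<forall>c>0. \<forall>x. F (c *\<^sub>R x) = F x) \<and> smooth_on (- {0}) F \<and>
     (\<forall>x. x \<noteq> 0 \<longrightarrow> (x \<bullet> x) * eucl_laplacian F x = - lam * F x)}"

lemma eucl_laplacian_lincomb:
  assumes "open S" "x \<in> S" "smooth_on S F" "smooth_on S G"
  shows "eucl_laplacian (\<lambda>x. a * F x + b * G x) x = a * eucl_laplacian F x + b * eucl_laplacian G x"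
proof -
  have "dirderiv (dirderiv (\<lambda>x. a * F x + b * G x) v) v x =
      a * dirderiv (dirderiv F v) v x + b * dirderiv (dirderiv G v) v x" for v
  proof -
    have "dirderiv (dirderiv (\<lambda>x. a * F x + b * G x) v) v x =
        dirderiv (\<lambda>x. a * dirderiv F v x + b * dirderiv G v x) v x"
      by (rule dirderiv_cong[OF assms(1,2)])
        (use assms in \<open>auto intro!: dirderiv_lincomb smooth_on_dirderiv smooth_on_lincomb\<close>)
    then show ?thesis using assms by (simp add: dirderiv_lincomb smooth_on_dirderiv)
  qed
  then show ?thesis by (simp add: eucl_laplacian_def sum.distrib sum_distrib_left)
qed

lemma hom_eig_lincomb:
  assumes "F \<in> hom_eig lam" "G \<in> hom_eig lam"
  shows "(\<lambda>x. a * F x + b * G x) \<in> hom_eig lam"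
proof -
  have "(x \<bullet> x) * eucl_laplacian (\<lambda>x. a * F x + b * G x) x = - lam * (a * F x + b * G x)" if "x \<noteq> 0" for x
  proof -
    have "(x \<bullet> x) * eucl_laplacian (\<lambda>x. a * F x + b * G x) x =
       a * ((x \<bullet> x) * eucl_laplacian F x) + b * ((x \<bullet> x) * eucl_laplacian G x)"
      using assms that by (subst eucl_laplacian_lincomb[OF open_Compl_0]) (auto simp: hom_eig_def algebra_simps)
    then show ?thesis using assms that by (simp add: hom_eig_def algebra_simps)
  qed
  then show ?thesis using assms smooth_on_lincomb[OF open_Compl_0] unfolding hom_eig_def by auto
qed

text \<open>The derivative along the linear vector field \<open>A\<close>. For skew \<open>A\<close>
  this is the infinitesimal action of the rotations \<open>exp (t A)\<close>.\<close>

definition lieder :: "('a \<Rightarrow> 'a) \<Rightarrow> ('a::euclidean_space \<Rightarrow> real) \<Rightarrow> 'a \<Rightarrow> real" where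
  "lieder A F x = dirderiv F (A x) x"

text \<open>Leibniz' rule twice; the linear factors have no second derivative, so only a cross term
  and a main term remain.\<close>

lemma laplacian_linear_mult_sum:
  fixes l :: "'i \<Rightarrow> 'a::euclidean_space \<Rightarrow> real"
  assumes S: "open S" "x \<in> S" and l: "\<And>c. c \<in> I \<Longrightarrow> bounded_linear (l c)" and h: "\<And>c. c \<in> I \<Longrightarrow> smooth_on S (h c)"
  shows "dirderiv (dirderiv (\<lambda>x. \<Sum>c\<in>I. l c x * h c x) v) v x =
    (\<Sum>c\<in>I. 2 * l c v * dirderiv (h c) v x + l c x * dirderiv (dirderiv (h c) v) v x)"
proof -
  have sm: "smooth_on S (\<lambda>x. l c x * h c x)" if "c \<in> I" for c
    by (intro smooth_on_mult[OF S(1) smooth_on_linear[OF l]] h that)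
  have 1: "dirderiv (\<lambda>x. \<Sum>c\<in>I. l c x * h c x) v y = (\<Sum>c\<in>I. l c v * h c y + l c y * dirderiv (h c) v y)" if "y \<in> S" for y
    using dirderiv_sum[OF S(1) that, of I "\<lambda>c x. l c x * h c x" v] sm dirderiv_linear_mult[OF S(1) that l h] by simp
  have sm2: "smooth_on S (\<lambda>y. l c v * h c y + 1 * (l c y * dirderiv (h c) v y))" if "c \<in> I" for c
    by (intro smooth_on_lincomb smooth_on_mult[OF S(1) smooth_on_linear[OF l]] smooth_on_dirderiv h S that)
  have "dirderiv (dirderiv (\<lambda>x. \<Sum>c\<in>I. l c x * h c x) v) v x =
     dirderiv (\<lambda>y. \<Sum>c\<in>I. l c v * h c y + 1 * (l c y * dirderiv (h c) v y)) v x"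
    by (rule dirderiv_cong[OF S(1,2)]) (use 1 S sm in \<open>auto intro!: smooth_on_dirderiv smooth_on_sum\<close>)
  also have "\<dots> = (\<Sum>c\<in>I. dirderiv (\<lambda>y. l c v * h c y + 1 * (l c y * dirderiv (h c) v y)) v x)"
    by (rule dirderiv_sum[OF S]) (rule sm2)
  also have "\<dots> = (\<Sum>c\<in>I. 2 * l c v * dirderiv (h c) v x + l c x * dirderiv (dirderiv (h c) v) v x)"
  proof (rule sum.cong[OF refl])
    fix c assume c: "c \<in> I"
    have "dirderiv (\<lambda>y. l c v * h c y + 1 * (l c y * dirderiv (h c) v y)) v x =
      l c v * dirderiv (h c) v x + 1 * dirderiv (\<lambda>y. l c y * dirderiv (h c) v y) v x"
      by (intro dirderiv_lincomb[OF S] smooth_on_mult[OF S(1) smooth_on_linear[OF l]] smooth_on_dirderiv h S c)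
    also have "dirderiv (\<lambda>y. l c y * dirderiv (h c) v y) v x = l c v * dirderiv (h c) v x + l c x * dirderiv (dirderiv (h c) v) v x"
      using c h l S by (intro dirderiv_linear_mult smooth_on_dirderiv) auto
    finally show "dirderiv (\<lambda>y. l c v * h c y + 1 * (l c y * dirderiv (h c) v y)) v x =
       2 * l c v * dirderiv (h c) v x + l c x * dirderiv (dirderiv (h c) v) v x" by simp
  qed
  finally show ?thesis .
qed

lemma lieder_expand:
  assumes "open S" "smooth_on S F" "x \<in> S"
  shows "lieder A F x = (\<Sum>c\<in>Basis. (A x \<bullet> c) * dirderiv F c x)"
  unfolding lieder_def by (rule dirderiv_expand[OF assms])

lemma bounded_linear_inner_comp: "bounded_linear A \<Longrightarrow> bounded_linear (\<lambda>x. A x \<bullet> c)"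
  using bounded_linear_compose[OF bounded_linear_inner_left] by blast

lemma smooth_on_lieder:
  assumes "open S" "smooth_on S F" "bounded_linear A"
  shows "smooth_on S (lieder A F)"
  by (rule smooth_on_cong[OF assms(1), of "\<lambda>x. \<Sum>c\<in>Basis. (A x \<bullet> c) * dirderiv F c x"])
    (use assms lieder_expand[OF assms(1,2)] in
      \<open>auto intro!: smooth_on_sum smooth_on_mult[OF _ smooth_on_linear[OF bounded_linear_inner_comp]] smooth_on_dirderiv\<close>)

text \<open>The infinitesimal form of the rotation invariance of the Laplacian: the main terms
  differentiate the Laplacian along \<open>A x\<close>, and the cross terms cancel.\<close>

lemma laplacian_lieder:
  fixes F :: "'a::euclidean_space \<Rightarrow> real"
  assumes S: "open S" "smooth_on S F" "x \<in> S" and A: "bounded_linear A" and skew: "\<And>x y. A x \<bullet> y = - (x \<bullet> A y)"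
  shows "eucl_laplacian (lieder A F) x = dirderiv (eucl_laplacian F) (A x) x"
proof -
  note sd = smooth_on_dirderiv[OF S(1)]
  have 1: "dirderiv (dirderiv (lieder A F) v) v x =
    (\<Sum>c\<in>Basis. 2 * (A v \<bullet> c) * dirderiv (dirderiv F c) v x + (A x \<bullet> c) * dirderiv (dirderiv (dirderiv F c) v) v x)" for v
  proof -
    have e: "dirderiv (lieder A F) v y = dirderiv (\<lambda>x. \<Sum>c\<in>Basis. (A x \<bullet> c) * dirderiv F c x) v y" if "y \<in> S" for y
      by (rule dirderiv_cong[OF S(1) that lieder_expand[OF S(1,2)] smooth_on_lieder[OF S(1,2) A]])
    have "dirderiv (dirderiv (lieder A F) v) v x = dirderiv (dirderiv (\<lambda>x. \<Sum>c\<in>Basis. (A x \<bullet> c) * dirderiv F c x) v) v x"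
      by (rule dirderiv_cong[OF S(1,3) e]) (simp_all add: sd smooth_on_lieder[OF S(1,2) A])
    then show ?thesis
      using laplacian_linear_mult_sum[OF S(1,3), of Basis "\<lambda>c x. A x \<bullet> c" "\<lambda>c. dirderiv F c" v] bounded_linear_inner_comp[OF A] sd[OF S(2)]
      by simp
  qed
  have 2: "dirderiv (dirderiv (dirderiv F c) v) v x = dirderiv (dirderiv (dirderiv F v) v) c x" for c v
  proof -
    have "dirderiv (dirderiv (dirderiv F c) v) v x = dirderiv (dirderiv (dirderiv F v) c) v x"
      by (rule dirderiv_cong[OF S(1,3) dirderiv_commute[OF S(1,2)]]) (simp_all add: sd S(2))
    also have "\<dots> = dirderiv (dirderiv (dirderiv F v) v) c x"
      by (rule dirderiv_commute[OF S(1) sd[OF S(2)] S(3)])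
    finally show ?thesis .
  qed
  \<comment> \<open>The cross terms contract the skew matrix of \<open>A\<close> with the symmetric
    Hessian, so their sum equals its own negative.\<close>
  define T where "T = (\<Sum>v\<in>Basis. \<Sum>c\<in>Basis. (A v \<bullet> c) * dirderiv (dirderiv F c) v x)"
  have "T = (\<Sum>c\<in>Basis. \<Sum>v\<in>Basis. (A v \<bullet> c) * dirderiv (dirderiv F c) v x)"
    unfolding T_def by (rule sum.swap)
  also have "\<dots> = (\<Sum>c\<in>Basis. \<Sum>v\<in>Basis. - ((A c \<bullet> v) * dirderiv (dirderiv F v) c x))"
  proof (intro sum.cong refl)
    fix c v :: 'a
    have "A v \<bullet> c = - (A c \<bullet> v)" using skew[of v c] by (simp add: inner_commute)
    then show "(A v \<bullet> c) * dirderiv (dirderiv F c) v x = - ((A c \<bullet> v) * dirderiv (dirderiv F v) c x)"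
      using dirderiv_commute[OF S, of c v] by simp
  qed
  also have "\<dots> = - T" unfolding T_def by (simp add: sum_negf)
  finally have T0: "T = 0" by simp
  have "eucl_laplacian (lieder A F) x = (\<Sum>v\<in>Basis. \<Sum>c\<in>Basis. 2 * ((A v \<bullet> c) * dirderiv (dirderiv F c) v x)
       + (A x \<bullet> c) * dirderiv (dirderiv (dirderiv F v) v) c x)"
    unfolding eucl_laplacian_def 1 2 by (simp add: mult.assoc)
  also have "\<dots> = 2 * T + (\<Sum>v\<in>Basis. \<Sum>c\<in>Basis. (A x \<bullet> c) * dirderiv (dirderiv (dirderiv F v) v) c x)"
    unfolding T_def by (simp add: sum.distrib sum_distrib_left)
  also have "\<dots> = (\<Sum>v\<in>Basis. dirderiv (dirderiv (dirderiv F v) v) (A x) x)"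
    unfolding T0 dirderiv_expand[OF S(1) sd[OF sd[OF S(2)]] S(3), of _ _ "A x"] by simp
  also have "\<dots> = dirderiv (\<lambda>x. \<Sum>v\<in>Basis. dirderiv (dirderiv F v) v x) (A x) x"
    by (rule dirderiv_sum[OF S(1,3) sd[OF sd[OF S(2)]], symmetric])
  finally show ?thesis unfolding eucl_laplacian_def .
qed

lemma smooth_on_laplacian: "open S \<Longrightarrow> smooth_on S F \<Longrightarrow> smooth_on S (eucl_laplacian F)"
  unfolding eucl_laplacian_def by (rule smooth_on_sum) (simp_all add: smooth_on_dirderiv)

lemma hom_eigD:
  assumes "F \<in> hom_eig lam"
  shows "F 0 = 0" "\<And>c x. c > 0 \<Longrightarrow> F (c *\<^sub>R x) = F x" "smooth_on (- {0}) F"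
    "\<And>x. x \<noteq> 0 \<Longrightarrow> (x \<bullet> x) * eucl_laplacian F x = - lam * F x"
  using assms by (auto simp: hom_eig_def)

lemma dirderiv_zero: "dirderiv F 0 x = 0"
  by (simp add: dirderiv_def)

lemma dirderiv_homogeneous:
  assumes "smooth_on (- {0}) F" "\<And>c x. c > 0 \<Longrightarrow> F (c *\<^sub>R x) = F x" "c > 0"
  shows "dirderiv F (c *\<^sub>R v) (c *\<^sub>R x) = dirderiv F v x"
proof (cases "x = 0 \<or> v = 0")
  case True
  then have "dirderiv F (c *\<^sub>R v) (c *\<^sub>R x) = dirderiv F v x"
  proof
    \<comment> \<open>At the origin \<open>F\<close> may fail to be differentiable, so the argument
      falls back on the definition of \<open>dirderiv\<close>.\<close>
    assume "x = 0"
    have "(\<lambda>t. F (t *\<^sub>R c *\<^sub>R v)) = (\<lambda>t. F (t *\<^sub>R v))"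
      using assms(2)[OF assms(3)] by (metis scaleR_left_commute)
    then show ?thesis by (simp add: dirderiv_def \<open>x = 0\<close>)
  qed (simp add: dirderiv_zero)
  then show ?thesis .
next
  case False
  have "dirderiv (\<lambda>x. F (c *\<^sub>R x)) v x = dirderiv F (c *\<^sub>R v) (c *\<^sub>R x)"
    using False assms by (intro dirderiv_compose_linear[OF open_Compl_0]) (auto intro: bounded_linear_scaleR_right)
  moreover have "(\<lambda>x. F (c *\<^sub>R x)) = F" using assms by auto
  ultimately show ?thesis by simp
qed

text \<open>\<open>A x\<close> is tangent to the sphere through \<open>x\<close>, so
  \<open>x \<bullet> x\<close> has derivative zero along it. Differentiating the equation of
  \<open>hom_eig\<close> along \<open>A x\<close> therefore only moves the Laplacian, which commutes
  with \<open>lieder A\<close>.\<close>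

lemma hom_eig_lieder:
  assumes F: "F \<in> hom_eig lam" and A: "bounded_linear A" and skew: "\<And>x y. A x \<bullet> y = - (x \<bullet> A y)"
  shows "lieder A F \<in> hom_eig lam"
proof -
  note d = hom_eigD[OF F]
  have A0: "A 0 = 0" using linear_0 A bounded_linear.linear by blast
  have Asc: "A (c *\<^sub>R x) = c *\<^sub>R A x" for c x using A bounded_linear.linear linear_scale by blast
  have "(x \<bullet> x) * eucl_laplacian (lieder A F) x = - lam * lieder A F x" if x: "x \<noteq> 0" for x
  proof -
    have x': "x \<in> - {0}" using x by simp
    have orth: "x \<bullet> A x = 0" using skew[of x x] by (simp add: inner_commute)
    have dl: "(eucl_laplacian F has_derivative (\<lambda>v. dirderiv (eucl_laplacian F) v x)) (at x)"
      by (rule smooth_on_deriv[OF open_Compl_0 smooth_on_laplacian[OF open_Compl_0 d(3)] x'])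
    have "((\<lambda>x. (x \<bullet> x) * eucl_laplacian F x) has_derivative
        (\<lambda>v. (x \<bullet> x) * dirderiv (eucl_laplacian F) v x + (x \<bullet> v + v \<bullet> x) * eucl_laplacian F x)) (at x)"
      by (intro has_derivative_mult dl has_derivative_inner has_derivative_ident)
    then have 1: "dirderiv (\<lambda>x. (x \<bullet> x) * eucl_laplacian F x) (A x) x = (x \<bullet> x) * dirderiv (eucl_laplacian F) (A x) x"
      using dirderiv_eq orth by (fastforce simp: inner_commute)
    have "((\<lambda>x. - lam * F x) has_derivative (\<lambda>v. - lam * dirderiv F v x)) (at x)"
      using has_derivative_mult_right[OF smooth_on_deriv[OF open_Compl_0 d(3) x'], of "- lam"] by simp
    from has_derivative_transform_within_open[OF this open_Compl_0 x', of "\<lambda>x. (x \<bullet> x) * eucl_laplacian F x"] d(4)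
    have "((\<lambda>x. (x \<bullet> x) * eucl_laplacian F x) has_derivative (\<lambda>v. - lam * dirderiv F v x)) (at x)" by auto
    from dirderiv_eq[OF this, of "A x"] 1
    show ?thesis unfolding laplacian_lieder[OF open_Compl_0 d(3) x' A skew] by (simp add: lieder_def)
  qed
  moreover have "lieder A F 0 = 0" by (simp add: lieder_def A0 dirderiv_zero)
  moreover have "lieder A F (c *\<^sub>R x) = lieder A F x" if "c > 0" for c x
    using dirderiv_homogeneous[OF d(3,2) that] by (simp add: lieder_def Asc)
  moreover have "smooth_on (- {0}) (lieder A F)" by (rule smooth_on_lieder[OF open_Compl_0 d(3) A])
  ultimately show ?thesis unfolding hom_eig_def by blast
qed

text \<open>Parseval's identity for the orthonormal basis formed by the images
  \<open>U v\<close>.\<close>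

lemma orthogonal_sum_frame:
  fixes U :: "'a::euclidean_space \<Rightarrow> 'a"
  assumes "orthogonal_transformation U"
  shows "(\<Sum>v\<in>Basis. (U v \<bullet> b) * (U v \<bullet> b')) = b \<bullet> b'"
proof -
  have "surj U" using assms orthogonal_transformation_surj by blast
  then obtain c c' where c: "b = U c" "b' = U c'" by (meson surjE)
  have "(\<Sum>v\<in>Basis. (U v \<bullet> b) * (U v \<bullet> b')) = (\<Sum>v\<in>Basis. (c \<bullet> v) * (c' \<bullet> v))"
    using assms by (simp add: c orthogonal_transformation_def inner_commute)
  also have "\<dots> = c \<bullet> c'" by (rule euclidean_inner[symmetric])
  also have "\<dots> = b \<bullet> b'" using assms by (simp add: c orthogonal_transformation_def)
  finally show ?thesis .
qed

text \<open>With basis vectors preserved up to sign the Laplacian is invariant summand by summand,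
  since each direction is differentiated twice. Coordinate reflections are the intended
  case.\<close>

lemma hom_eig_reflect:
  fixes U :: "'a::euclidean_space \<Rightarrow> 'a"
  assumes F: "F \<in> hom_eig lam" and U: "orthogonal_transformation U"
    and sgn: "\<And>b. b \<in> Basis \<Longrightarrow> U b = b \<or> U b = - b"
  shows "(\<lambda>x. F (U x)) \<in> hom_eig lam"
proof -
  note d = hom_eigD[OF F]
  have bl: "bounded_linear U" using U orthogonal_transformation_def linear_conv_bounded_linear by blast
  have nz: "U x \<noteq> 0" if "x \<noteq> 0" for x
    using orthogonal_transformation_norm[OF U, of x] that by auto
  have cd: "dirderiv (\<lambda>x. f (U x)) v x = dirderiv f (U v) (U x)" if "smooth_on (- {0}) f" "x \<noteq> 0" for f v x
    by (rule dirderiv_compose_linear[OF open_Compl_0 bl _ that(1)]) (simp add: nz that)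
  have im: "U ` (- {0}) \<subseteq> - {0}"
  proof (rule image_subsetI)
    show "U x \<in> - {0}" if "x \<in> - {0}" for x using nz[of x] that by simp
  qed
  have sm: "smooth_on (- {0}) (\<lambda>x. f (U x))" if "smooth_on (- {0}) f" for f
    using Ck_on_compose_linear[OF open_Compl_0 bl im, of _ f] that unfolding smooth_on_def by blast
  have "eucl_laplacian (\<lambda>x. F (U x)) x = eucl_laplacian F (U x)" if x: "x \<noteq> 0" for x
    unfolding eucl_laplacian_def
  proof (rule sum.cong[OF refl])
    fix b :: 'a assume b: "b \<in> Basis"
    have "dirderiv (dirderiv (\<lambda>x. F (U x)) b) b x = dirderiv (\<lambda>x. dirderiv F (U b) (U x)) b x"
      by (rule dirderiv_cong[OF open_Compl_0]) (use x cd d sm in \<open>auto intro: smooth_on_dirderiv\<close>)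
    also have "\<dots> = dirderiv (dirderiv F (U b)) (U b) (U x)"
      by (rule cd[OF smooth_on_dirderiv[OF open_Compl_0 d(3)] x])
    also have "\<dots> = dirderiv (dirderiv F b) b (U x)"
      using sgn[OF b]
    proof
      assume "U b = - b"
      have neg: "dirderiv f (- v) y = - dirderiv f v y" if "smooth_on (- {0}) f" "y \<noteq> 0" for f y and v :: 'a
        using linear_neg[OF dirderiv_linear[OF open_Compl_0 that(1)]] that by auto
      have "dirderiv (dirderiv F (- b)) (- b) (U x) = - dirderiv (dirderiv F (- b)) b (U x)"
        by (rule neg) (use d nz x smooth_on_dirderiv[OF open_Compl_0] in auto)
      also have "dirderiv (dirderiv F (- b)) b (U x) = dirderiv (\<lambda>y. (-1) * dirderiv F b y + 0 * dirderiv F b y) b (U x)"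
        by (rule dirderiv_cong[OF open_Compl_0]) (use d nz x neg smooth_on_dirderiv[OF open_Compl_0] in auto)
      also have "\<dots> = - dirderiv (dirderiv F b) b (U x)"
        by (subst dirderiv_lincomb[OF open_Compl_0]) (use d nz x smooth_on_dirderiv[OF open_Compl_0] in auto)
      finally show ?thesis using \<open>U b = - b\<close> by simp
    qed simp
    finally show "dirderiv (dirderiv (\<lambda>x. F (U x)) b) b x = dirderiv (dirderiv F b) b (U x)" .
  qed
  moreover have "U x \<bullet> U x = x \<bullet> x" for x using U by (simp add: orthogonal_transformation_def)
  moreover have "U (c *\<^sub>R x) = c *\<^sub>R U x" for c x
    using U linear_scale orthogonal_transformation_def by blast
  moreover have "U 0 = 0" using U linear_0 orthogonal_transformation_def by blast
  ultimately show ?thesis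
    unfolding hom_eig_def using d sm[OF d(3)] nz by (simp) metis
qed

section \<open>Averages over families of rotations\<close>

text \<open>With \<open>U\<close> a circle of rotations and \<open>c\<close> a cosine or sine, these
  are the real ingredients of Fourier coefficients along the orbits.\<close>

definition avg :: "(real \<Rightarrow> 'a \<Rightarrow> 'a) \<Rightarrow> (real \<Rightarrow> real) \<Rightarrow> ('a::euclidean_space \<Rightarrow> real) \<Rightarrow> 'a \<Rightarrow> real" where
  "avg U c F x = integral {0..2*pi} (\<lambda>t. c t * F (U t x))"

locale rotation_family =
  fixes U :: "real \<Rightarrow> 'a::euclidean_space \<Rightarrow> 'a"
  assumes orth: "\<And>t. orthogonal_transformation (U t)"
    and cont: "\<And>v. continuous_on UNIV (\<lambda>t. U t v)"
begin

lemma U_linear: "linear (U t)"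
  using orth by (simp add: orthogonal_transformation_def)

lemma U_eq_0_iff: "U t x = 0 \<longleftrightarrow> x = 0"
  using orthogonal_transformation_norm[OF orth, of t x] by (metis norm_eq_zero)

lemma U_in_basis: "U t x = (\<Sum>b\<in>Basis. (x \<bullet> b) *\<^sub>R U t b)"
  by (subst euclidean_representation[of x, symmetric], subst linear_sum[OF U_linear])
     (simp add: linear_scale[OF U_linear])

text \<open>Expansion in a basis turns continuity in \<open>t\<close> for each fixed vector into
  joint continuity.\<close>

lemma cont_joint: "continuous_on X (\<lambda>z. U (snd z) (fst z))"
proof -
  have "continuous_on X (\<lambda>z. U (snd z) b)" for b
    by (rule continuous_on_compose2[OF cont, of X snd b]) (auto intro: continuous_intros)
  then show ?thesis by (subst U_in_basis) (intro continuous_intros, simp)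
qed

lemma cont_comp:
  assumes "continuous_on (- {0}) F" "x \<noteq> 0"
  shows "continuous_on T (\<lambda>t. F (U t x))"
  by (rule continuous_on_compose2[OF assms(1) continuous_on_subset[OF cont]])
    (use assms(2) U_eq_0_iff in auto)

lemma cont_integrand:
  fixes F :: "'a \<Rightarrow> 'b::{real_normed_algebra,banach}"
  assumes "continuous_on {0..2*pi} c" "continuous_on (- {0}) F" "x \<noteq> 0"
  shows "continuous_on {0..2*pi} (\<lambda>t. c t * F (U t x))"
  by (intro continuous_on_mult assms(1) cont_comp[OF assms(2,3)])

lemma integrable_integrand:
  fixes F :: "'a \<Rightarrow> 'b::{real_normed_algebra,banach}"
  assumes "continuous_on {0..2*pi} c" "continuous_on (- {0}) F" "x \<noteq> 0"
  shows "(\<lambda>t. c t * F (U t x)) integrable_on {0..2*pi}"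
  by (rule integrable_continuous_real[OF cont_integrand[OF assms]])

lemma cont_coeff: "continuous_on {0..2*pi} c \<Longrightarrow> continuous_on {0..2*pi} (\<lambda>t. c t * (U t v \<bullet> b))"
  by (intro continuous_intros continuous_on_subset[OF cont]) auto

text \<open>Differentiation under the integral sign. The derivative is written as a finite sum of
  averages of the same kind, with matrix entries of \<open>U t\<close> absorbed into the
  coefficient, so that the formula can be iterated to any order.\<close>

lemma avg_has_derivative:
  assumes c: "continuous_on {0..2*pi} c" and F: "smooth_on (- {0}) F" and x: "x \<noteq> 0"
  shows "(avg U c F has_derivative (\<lambda>v. \<Sum>b\<in>Basis. avg U (\<lambda>t. c t * (U t v \<bullet> b)) (dirderiv F b) x)) (at x)"
proof -
  \<comment> \<open>The largest open ball around \<open>x\<close> that misses the origin; it is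
    convex, as Leibniz' rule asks.\<close>
  let ?B = "ball x (norm x)"
  have B: "y \<noteq> 0" if "y \<in> ?B" for y using that by auto
  have dF: "(F has_derivative (\<lambda>v. dirderiv F v y)) (at y)" if "y \<noteq> 0" for y
    using smooth_on_deriv[OF open_Compl_0 F] that by simp
  have cD: "continuous_on (- {0}) (dirderiv F b)" for b
    by (rule smooth_on_continuous[OF smooth_on_dirderiv[OF open_Compl_0 F]])
  define D where "D y t v = c t * dirderiv F (U t v) (U t y)" for y t v
  have bl: "bounded_linear (D y t)" if "y \<noteq> 0" for y t
  proof -
    have "linear (\<lambda>v. dirderiv F v (U t y))" using dirderiv_linear[OF open_Compl_0 F] that U_eq_0_iff by simp
    from linear_compose_scale_right[OF linear_compose[OF U_linear[of t] this], of "c t"] have "linear (D y t)"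
      by (simp add: o_def D_def[abs_def])
    then show ?thesis using linear_conv_bounded_linear by blast
  qed
  define fx where "fx y t = Blinfun (D y t)" for y t
  have fx: "blinfun_apply (fx y t) = D y t" if "y \<noteq> 0" for y t
    unfolding fx_def using bl[OF that] by (rule bounded_linear_Blinfun_apply)
  have Dexp: "D y t v = c t * (\<Sum>b\<in>Basis. (U t v \<bullet> b) * dirderiv F b (U t y))" if "y \<noteq> 0" for y t v
    unfolding D_def using dirderiv_expand[OF open_Compl_0 F, of "U t y" "U t v"] that U_eq_0_iff by simp
  have der: "((\<lambda>y. c t * F (U t y)) has_derivative blinfun_apply (fx y t)) (at y within ?B)" if "y \<in> ?B" for y t
  proof -
    have "((\<lambda>y. F (U t y)) has_derivative (\<lambda>v. dirderiv F (U t v) (U t y))) (at y within ?B)"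
      using has_derivative_compose[OF linear_imp_has_derivative[OF U_linear] dF[of "U t y"]] B[OF that] U_eq_0_iff by blast
    then show ?thesis unfolding fx[OF B[OF that]] D_def by (rule has_derivative_mult_right)
  qed
  have contfx: "continuous_on (?B \<times> cbox 0 (2*pi)) (\<lambda>(y, t). fx y t)"
  proof (rule continuous_on_blinfun_componentwise)
    fix i :: 'a assume "i \<in> Basis"
    have c2: "continuous_on (?B \<times> cbox 0 (2*pi)) (\<lambda>z. c (snd z))"
      by (rule continuous_on_compose2[OF c]) (auto intro: continuous_intros)
    have d2: "continuous_on (?B \<times> cbox 0 (2*pi)) (\<lambda>z. dirderiv F b (U (snd z) (fst z)))" for b
      by (rule continuous_on_compose2[OF cD cont_joint]) (use B U_eq_0_iff in auto)
    have u2: "continuous_on (?B \<times> cbox 0 (2*pi)) (\<lambda>z. U (snd z) i)"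
      by (rule continuous_on_compose2[OF cont, of _ snd i]) (auto intro: continuous_intros)
    have "continuous_on (?B \<times> cbox 0 (2*pi)) (\<lambda>z. c (snd z) * (\<Sum>b\<in>Basis. (U (snd z) i \<bullet> b) * dirderiv F b (U (snd z) (fst z))))"
      by (intro continuous_on_mult c2 continuous_on_sum d2 continuous_on_inner u2 continuous_on_const)
    then show "continuous_on (?B \<times> cbox 0 (2*pi)) (\<lambda>z. blinfun_apply (case z of (y, t) \<Rightarrow> fx y t) i)"
      by (rule continuous_on_eq) (use fx Dexp B in \<open>auto split: prod.split\<close>)
  qed
  have xB: "x \<in> ?B" using x by simp
  have "((\<lambda>y. integral (cbox 0 (2*pi)) (\<lambda>t. c t * F (U t y))) has_derivative integral (cbox 0 (2*pi)) (fx x)) (at x within ?B)"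
    by (rule leibniz_rule[OF der _ contfx xB]) 
       (use integrable_integrand[OF c smooth_on_continuous[OF F]] B in auto)
  then have 1: "(avg U c F has_derivative integral {0..2*pi} (fx x)) (at x)"
    unfolding at_within_open[OF xB open_ball] by (simp add: avg_def[abs_def])
  have "continuous_on (cbox 0 (2*pi)) (\<lambda>t. case (x, t) of (y, t) \<Rightarrow> fx y t)"
    by (rule continuous_on_compose2[OF contfx]) (use x in \<open>auto intro: continuous_intros\<close>)
  then have int: "fx x integrable_on {0..2*pi}" using integrable_continuous_real by simp
  have "blinfun_apply (integral {0..2*pi} (fx x)) v = (\<Sum>b\<in>Basis. avg U (\<lambda>t. c t * (U t v \<bullet> b)) (dirderiv F b) x)" for v
  proof -
    have "blinfun_apply (integral {0..2*pi} (fx x)) v = integral {0..2*pi} (\<lambda>t. fx x t v)"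
      by (rule blinfun_apply_integral[OF int])
    also have "\<dots> = integral {0..2*pi} (\<lambda>t. \<Sum>b\<in>Basis. c t * (U t v \<bullet> b) * dirderiv F b (U t x))"
      by (simp add: fx[OF x] Dexp[OF x] sum_distrib_left mult.assoc)
    also have "\<dots> = (\<Sum>b\<in>Basis. avg U (\<lambda>t. c t * (U t v \<bullet> b)) (dirderiv F b) x)"
      unfolding avg_def by (intro integral_sum integrable_integrand cont_coeff c cD x) auto
    finally show ?thesis .
  qed
  then have "blinfun_apply (integral {0..2*pi} (fx x)) = (\<lambda>v. \<Sum>b\<in>Basis. avg U (\<lambda>t. c t * (U t v \<bullet> b)) (dirderiv F b) x)" by auto
  with 1 show ?thesis by simp
qed

lemma avg_Ck:
  "continuous_on {0..2*pi} c \<Longrightarrow> smooth_on (- {0}) F \<Longrightarrow> Ck_on k (- {0}) (avg U c F)"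
proof (induction k arbitrary: c F)
  case 0
  then show ?case
    using has_derivative_continuous[OF avg_has_derivative] by (auto intro: continuous_at_imp_continuous_on)
next
  case (Suc k)
  show ?case
    by (rule Ck_on_SucI[OF open_Compl_0 avg_has_derivative[OF Suc.prems]])
      (auto intro!: Ck_on_sum[OF open_Compl_0] Suc.IH cont_coeff Suc.prems smooth_on_dirderiv[OF open_Compl_0])
qed

lemma smooth_on_avg: "continuous_on {0..2*pi} c \<Longrightarrow> smooth_on (- {0}) F \<Longrightarrow> smooth_on (- {0}) (avg U c F)"
  using avg_Ck by (simp add: smooth_on_def)

lemma dirderiv_avg:
  assumes "continuous_on {0..2*pi} c" "smooth_on (- {0}) F" "x \<noteq> 0"
  shows "dirderiv (avg U c F) v x = (\<Sum>b\<in>Basis. avg U (\<lambda>t. c t * (U t v \<bullet> b)) (dirderiv F b) x)"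
  by (rule dirderiv_eq[OF avg_has_derivative[OF assms]])

lemma dirderiv2_avg:
  assumes c: "continuous_on {0..2*pi} c" and F: "smooth_on (- {0}) F" and x: "x \<noteq> 0"
  shows "dirderiv (dirderiv (avg U c F) v) v x =
    (\<Sum>b\<in>Basis. \<Sum>b'\<in>Basis. avg U (\<lambda>t. c t * ((U t v \<bullet> b) * (U t v \<bullet> b'))) (dirderiv (dirderiv F b) b') x)"
proof -
  note sd = smooth_on_dirderiv[OF open_Compl_0 F]
  have "dirderiv (dirderiv (avg U c F) v) v x = dirderiv (\<lambda>y. \<Sum>b\<in>Basis. avg U (\<lambda>t. c t * (U t v \<bullet> b)) (dirderiv F b) y) v x"
    by (rule dirderiv_cong[OF open_Compl_0])
      (use x dirderiv_avg[OF c F] smooth_on_dirderiv[OF open_Compl_0 smooth_on_avg[OF c F]] in auto)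
  also have "\<dots> = (\<Sum>b\<in>Basis. dirderiv (avg U (\<lambda>t. c t * (U t v \<bullet> b)) (dirderiv F b)) v x)"
    by (rule dirderiv_sum[OF open_Compl_0]) (use x smooth_on_avg[OF cont_coeff[OF c] sd] in auto)
  also have "\<dots> = (\<Sum>b\<in>Basis. \<Sum>b'\<in>Basis. avg U (\<lambda>t. c t * ((U t v \<bullet> b) * (U t v \<bullet> b'))) (dirderiv (dirderiv F b) b') x)"
    by (simp add: dirderiv_avg[OF cont_coeff[OF c] sd x] mult.assoc)
  finally show ?thesis .
qed

text \<open>Summing the matrix entries over an orthonormal basis gives \<open>b \<bullet> b'\<close>
  by \<open>orthogonal_sum_frame\<close>, which leaves only the diagonal second derivatives.\<close>

lemma laplacian_avg:
  assumes c: "continuous_on {0..2*pi} c" and F: "smooth_on (- {0}) F" and x: "x \<noteq> 0"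
  shows "eucl_laplacian (avg U c F) x = avg U c (eucl_laplacian F) x"
proof -
  note sd = smooth_on_dirderiv[OF open_Compl_0 smooth_on_dirderiv[OF open_Compl_0 F]]
  have ii: "(\<lambda>t. c t * ((U t v \<bullet> b) * (U t v \<bullet> b')) * dirderiv (dirderiv F b) b' (U t x)) integrable_on {0..2*pi}" for v b b'
    using integrable_integrand[OF cont_coeff[OF cont_coeff[OF c]] smooth_on_continuous[OF sd] x] by (simp add: mult.assoc)
  have "eucl_laplacian (avg U c F) x = (\<Sum>v\<in>Basis. \<Sum>b\<in>Basis. \<Sum>b'\<in>Basis.
     integral {0..2*pi} (\<lambda>t. c t * ((U t v \<bullet> b) * (U t v \<bullet> b')) * dirderiv (dirderiv F b) b' (U t x)))"
    unfolding eucl_laplacian_def dirderiv2_avg[OF assms] avg_def ..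
  also have "\<dots> = integral {0..2*pi} (\<lambda>t. \<Sum>v\<in>Basis. \<Sum>b\<in>Basis. \<Sum>b'\<in>Basis.
      c t * ((U t v \<bullet> b) * (U t v \<bullet> b')) * dirderiv (dirderiv F b) b' (U t x))"
    by (simp add: integral_sum integrable_sum ii)
  also have "\<dots> = integral {0..2*pi} (\<lambda>t. c t * eucl_laplacian F (U t x))"
  proof (rule arg_cong[where f="integral _"], rule ext)
    fix t
    have frame: "(\<Sum>v\<in>Basis. c t * ((U t v \<bullet> b) * (U t v \<bullet> b')) * X) = c t * (b \<bullet> b') * X" for b b' X
      unfolding orthogonal_sum_frame[OF orth, of t b b', symmetric] by (simp only: sum_distrib_left sum_distrib_right)
    have "(\<Sum>v\<in>Basis. \<Sum>b\<in>Basis. \<Sum>b'\<in>Basis. c t * ((U t v \<bullet> b) * (U t v \<bullet> b')) * dirderiv (dirderiv F b) b' (U t x))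
      = (\<Sum>b\<in>Basis. \<Sum>b'\<in>Basis. \<Sum>v\<in>Basis. c t * ((U t v \<bullet> b) * (U t v \<bullet> b')) * dirderiv (dirderiv F b) b' (U t x))"
      by (subst sum.swap, rule sum.cong[OF refl], subst sum.swap, rule refl)
    also have "\<dots> = (\<Sum>b\<in>Basis. \<Sum>b'\<in>Basis. c t * (b \<bullet> b') * dirderiv (dirderiv F b) b' (U t x))"
      by (intro sum.cong refl) (simp only: frame)
    also have "\<dots> = (\<Sum>b\<in>Basis. \<Sum>b'\<in>Basis. if b' = b then c t * dirderiv (dirderiv F b) b' (U t x) else 0)"
      by (intro sum.cong refl) (simp add: inner_Basis)
    also have "\<dots> = c t * eucl_laplacian F (U t x)"
      by (simp add: eucl_laplacian_def sum_distrib_left)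
    finally show "(\<Sum>v\<in>Basis. \<Sum>b\<in>Basis. \<Sum>b'\<in>Basis. c t * ((U t v \<bullet> b) * (U t v \<bullet> b')) * dirderiv (dirderiv F b) b' (U t x))
      = c t * eucl_laplacian F (U t x)" .
  qed
  finally show ?thesis by (simp add: avg_def)
qed

lemma hom_eig_avg:
  assumes c: "continuous_on {0..2*pi} c" and F: "F \<in> hom_eig lam"
  shows "avg U c F \<in> hom_eig lam"
proof -
  note d = hom_eigD[OF F]
  have "(x \<bullet> x) * eucl_laplacian (avg U c F) x = - lam * avg U c F x" if x: "x \<noteq> 0" for x
  proof -
    have "(x \<bullet> x) * (c t * eucl_laplacian F (U t x)) = - lam * (c t * F (U t x))" for t
    proof -
      have "U t x \<bullet> U t x = x \<bullet> x" using orth by (simp add: orthogonal_transformation_def)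
      then have "(x \<bullet> x) * eucl_laplacian F (U t x) = - lam * F (U t x)" using d(4)[of "U t x"] x U_eq_0_iff by simp
      then show ?thesis by (simp add: algebra_simps)
    qed
    then have "(x \<bullet> x) * avg U c (eucl_laplacian F) x = - lam * avg U c F x"
      unfolding avg_def by (simp flip: integral_mult_right)
    then show ?thesis by (simp add: laplacian_avg[OF c d(3) x])
  qed
  moreover have "avg U c F 0 = 0" by (simp add: avg_def linear_0[OF U_linear] d)
  moreover have "avg U c F (r *\<^sub>R x) = avg U c F x" if "r > 0" for r x
    by (simp add: avg_def linear_scale[OF U_linear] d(2)[OF that])
  ultimately show ?thesis unfolding hom_eig_def using smooth_on_avg[OF c d(3)] by blast
qed

end

section \<open>The torus action and its weight spaces\<close>

text \<open>In the complex coordinates \<open>z\<^sub>j = x\<^sub>j + i y\<^sub>j\<close> this is \<open>z\<^sub>j \<mapsto> exp (- i \<theta>\<^sub>j) z\<^sub>j\<close>, so that \<open>z\<^sub>j\<close> itself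
  has weight \<open>-1\<close> in the \<open>j\<close>-th coordinate.\<close>
definition rot :: "('n::finite \<Rightarrow> real) \<Rightarrow> (real^'n) \<times> (real^'n) \<Rightarrow> (real^'n) \<times> (real^'n)" where
  "rot \<theta> z = ((\<chi> j. cos (\<theta> j) * fst z $ j + sin (\<theta> j) * snd z $ j),
             (\<chi> j. - sin (\<theta> j) * fst z $ j + cos (\<theta> j) * snd z $ j))"

definition rot1 :: "'n::finite \<Rightarrow> real \<Rightarrow> (real^'n) \<times> (real^'n) \<Rightarrow> (real^'n) \<times> (real^'n)" where
  "rot1 i t = rot (\<lambda>j. if j = i then t else 0)"

lemma lens_gen_rot: "lens_gen q p = rot (\<lambda>j. 2 * pi * real_of_int (p j) / real q)"
  by (auto simp: lens_gen_def rot_def fun_eq_iff)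

lemma rot_rot: "rot \<theta> (rot \<phi> z) = rot (\<lambda>j. \<theta> j + \<phi> j) z"
  by (simp add: rot_def vec_eq_iff prod_eq_iff cos_add sin_add algebra_simps)

lemma rot_zero: "rot (\<lambda>j. 0) z = z"
  by (simp add: rot_def vec_eq_iff prod_eq_iff)

lemma rot_cong: "(\<And>j. cis (\<theta> j) = cis (\<phi> j)) \<Longrightarrow> rot \<theta> z = rot \<phi> z"
  by (simp add: rot_def vec_eq_iff prod_eq_iff complex_eq_iff)

lemma rot_commute: "rot \<theta> (rot \<phi> z) = rot \<phi> (rot \<theta> z)"
  by (simp add: rot_rot add.commute)

lemma linear_rot: "linear (rot \<theta>)"
  by (rule linearI) (simp_all add: rot_def vec_eq_iff prod_eq_iff algebra_simps)

lemma orthogonal_rot: "orthogonal_transformation (rot \<theta>)"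
proof -
  have "(c * a + s * b) * (c * a' + s * b') + (- s * a + c * b) * (- s * a' + c * b') = a * a' + b * b'"
    if "s\<^sup>2 + c\<^sup>2 = 1" for s c a b a' b' :: real
  proof -
    have "(c * a + s * b) * (c * a' + s * b') + (- s * a + c * b) * (- s * a' + c * b') = (s\<^sup>2 + c\<^sup>2) * (a * a' + b * b')"
      by algebra
    then show ?thesis using that by simp
  qed
  then have "rot \<theta> v \<bullet> rot \<theta> w = v \<bullet> w" for v w
    by (simp add: rot_def inner_prod_def inner_vec_def flip: sum.distrib)
  then show ?thesis by (simp add: orthogonal_transformation_def linear_rot)
qed

lemma rotation_family_rot1: "rotation_family (rot1 i)"
proof
  show "orthogonal_transformation (rot1 i t)" for t by (simp add: rot1_def orthogonal_rot)
  have "continuous_on UNIV (\<lambda>t. if j = i then f t else c)" if "continuous_on UNIV f" for j and f :: "real \<Rightarrow> real" and c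
    using that by (cases "j = i") (auto intro: continuous_intros)
  then show "continuous_on UNIV (\<lambda>t. rot1 i t v)" for v :: "(real^'a) \<times> (real^'a)"
    unfolding rot1_def rot_def
    by (intro continuous_on_Pair continuous_on_vec_lambda continuous_intros) (auto intro: continuous_intros)
qed

interpretation rot1: rotation_family "rot1 i" for i :: "'n::finite"
  by (rule rotation_family_rot1)

text \<open>Complex values are needed for the torus to act diagonally; the definition goes through
  real and imaginary parts because \<open>Ck_on\<close> is a notion for real functions.\<close>

definition ceig :: "real \<Rightarrow> ('a::euclidean_space \<Rightarrow> complex) set" where
  "ceig lam = {F. (\<lambda>x. Re (F x)) \<in> hom_eig lam \<and> (\<lambda>x. Im (F x)) \<in> hom_eig lam}"

lemma ceig_lincomb:
  assumes "F \<in> ceig lam" "G \<in> ceig lam"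
  shows "(\<lambda>x. a * F x + b * G x) \<in> ceig lam"
proof -
  let ?h = "\<lambda>c1 c2 c3 c4 x. 1 * (c1 * Re (F x) + c2 * Im (F x)) + 1 * (c3 * Re (G x) + c4 * Im (G x))"
  have "?h c1 c2 c3 c4 \<in> hom_eig lam" for c1 c2 c3 c4
    using assms by (intro hom_eig_lincomb) (auto simp: ceig_def)
  from this[of "Re a" "- Im a" "Re b" "- Im b"] this[of "Im a" "Re a" "Im b" "Re b"]
  show ?thesis by (simp add: ceig_def algebra_simps)
qed

lemma ceig_zero: "F \<in> ceig lam \<Longrightarrow> F 0 = 0"
  by (simp add: ceig_def hom_eig_def complex_eq_iff)

lemma ceig_continuous: "F \<in> ceig lam \<Longrightarrow> continuous_on (- {0}) F"
  using continuous_on_Complex[of "- {0}" "\<lambda>x. Re (F x)" "\<lambda>x. Im (F x)"] smooth_on_continuous hom_eigD(3)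
  by (auto simp: ceig_def)

section \<open>Fourier projections for the circle that rotates one coordinate plane\<close>

lemma rot1_zero: "rot1 i t 0 = 0"
  by (rule linear_0[OF rot1.U_linear])

definition proj :: "'n::finite \<Rightarrow> int \<Rightarrow> ((real^'n) \<times> (real^'n) \<Rightarrow> complex) \<Rightarrow> (real^'n) \<times> (real^'n) \<Rightarrow> complex" where
  "proj i m F z = integral {0..2*pi} (\<lambda>t. cis (- (of_int m * t)) * F (rot1 i t z)) / of_real (2 * pi)"

lemma proj_integrable:
  assumes "F \<in> ceig lam"
  shows "(\<lambda>t. cis (- (of_int m * t)) * F (rot1 i t z)) integrable_on {0..2*pi}"
proof (cases "z = 0")
  case True
  then show ?thesis using ceig_zero[OF assms] by (simp add: rot1_zero integrable_0)
next
  case False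
  then show ?thesis
    by (intro rot1.integrable_integrand ceig_continuous[OF assms]) (auto intro!: continuous_intros)
qed

lemma proj_ceig:
  assumes "F \<in> ceig lam"
  shows "proj i m F \<in> ceig lam"
proof -
  have h: "(\<lambda>x. Re (F x)) \<in> hom_eig lam" "(\<lambda>x. Im (F x)) \<in> hom_eig lam" using assms by (auto simp: ceig_def)
  have c: "continuous_on {0..2*pi} (\<lambda>t. cos (of_int m * t) :: real)" "continuous_on {0..2*pi} (\<lambda>t. sin (of_int m * t) :: real)"
    by (auto intro!: continuous_intros)
  note m = rot1.hom_eig_avg[OF c(1) h(1), of i] rot1.hom_eig_avg[OF c(2) h(1), of i]
    rot1.hom_eig_avg[OF c(1) h(2), of i] rot1.hom_eig_avg[OF c(2) h(2), of i]
  let ?C = "avg (rot1 i) (\<lambda>t. cos (of_int m * t))" and ?S = "avg (rot1 i) (\<lambda>t. sin (of_int m * t))"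
  have ii: "(\<lambda>t. c t * f (rot1 i t z)) integrable_on {0..2*pi}"
    if "continuous_on {0..2*pi} c" "f \<in> hom_eig lam" for c f z
  proof (cases "z = 0")
    case True
    then show ?thesis using hom_eigD(1)[OF that(2)] by (simp add: rot1_zero integrable_0)
  next
    case False
    then show ?thesis by (intro rot1.integrable_integrand that smooth_on_continuous hom_eigD(3)[OF that(2)])
  qed
  note int = ii[OF c(1) h(1)] ii[OF c(2) h(1)] ii[OF c(1) h(2)] ii[OF c(2) h(2)]
  have Re: "Re (proj i m F z) = (1 / (2*pi)) * ?C (\<lambda>x. Re (F x)) z + (1 / (2*pi)) * ?S (\<lambda>x. Im (F x)) z" for z
  proof -
    have "Re (integral {0..2*pi} (\<lambda>t. cis (- (of_int m * t)) * F (rot1 i t z))) =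
      integral {0..2*pi} (\<lambda>t. cos (of_int m * t) * Re (F (rot1 i t z)) + sin (of_int m * t) * Im (F (rot1 i t z)))"
      by (subst integral_linear[OF proj_integrable[OF assms] bounded_linear_Re, symmetric]) (simp add: o_def)
    also have "\<dots> = ?C (\<lambda>x. Re (F x)) z + ?S (\<lambda>x. Im (F x)) z"
      unfolding avg_def by (rule integral_add[OF int(1) int(4)])
    finally show ?thesis by (simp add: proj_def Re_divide_of_real add_divide_distrib del: of_real_mult)
  qed
  have Im: "Im (proj i m F z) = (1 / (2*pi)) * ?C (\<lambda>x. Im (F x)) z + (- 1 / (2*pi)) * ?S (\<lambda>x. Re (F x)) z" for z
  proof -
    have "Im (integral {0..2*pi} (\<lambda>t. cis (- (of_int m * t)) * F (rot1 i t z))) =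
      integral {0..2*pi} (\<lambda>t. cos (of_int m * t) * Im (F (rot1 i t z)) - sin (of_int m * t) * Re (F (rot1 i t z)))"
      by (subst integral_linear[OF proj_integrable[OF assms] bounded_linear_Im, symmetric]) (simp add: o_def)
    also have "\<dots> = ?C (\<lambda>x. Im (F x)) z - ?S (\<lambda>x. Re (F x)) z"
      unfolding avg_def by (rule integral_diff[OF int(3) int(2)])
    finally show ?thesis by (simp add: proj_def Im_divide_of_real diff_divide_distrib del: of_real_mult)
  qed
  show ?thesis
    unfolding ceig_def mem_Collect_eq Re Im by (intro conjI hom_eig_lincomb m)
qed

lemma proj_lincomb:
  assumes "F \<in> ceig lam" "G \<in> ceig lam"
  shows "proj i m (\<lambda>z. a * F z + b * G z) = (\<lambda>z. a * proj i m F z + b * proj i m G z)"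
proof
  fix z
  have "integral {0..2*pi} (\<lambda>t. cis (- (of_int m * t)) * (a * F (rot1 i t z) + b * G (rot1 i t z)))
    = integral {0..2*pi} (\<lambda>t. a * (cis (- (of_int m * t)) * F (rot1 i t z)) + b * (cis (- (of_int m * t)) * G (rot1 i t z)))"
    by (simp add: algebra_simps)
  also have "\<dots> = a * integral {0..2*pi} (\<lambda>t. cis (- (of_int m * t)) * F (rot1 i t z))
      + b * integral {0..2*pi} (\<lambda>t. cis (- (of_int m * t)) * G (rot1 i t z))"
    using proj_integrable[OF assms(1)] proj_integrable[OF assms(2)]
    by (subst integral_add) (simp_all only: integral_mult_right integrable_on_mult_right)
  finally show "proj i m (\<lambda>z. a * F z + b * G z) z = a * proj i m F z + b * proj i m G z"
    by (simp add: proj_def add_divide_distrib)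
qed

lemma proj_rot: "proj i m F (rot \<theta> z) = proj i m (\<lambda>z. F (rot \<theta> z)) z"
  by (simp add: proj_def rot1_def rot_commute)

lemma proj_scale: "proj i m (\<lambda>z. a * F z) z = a * proj i m F z"
proof -
  have "(\<lambda>t. cis (- (of_int m * t)) * (a * F (rot1 i t z))) = (\<lambda>t. a * (cis (- (of_int m * t)) * F (rot1 i t z)))" by auto
  then show ?thesis by (simp add: proj_def)
qed

definition iwt :: "'n::finite \<Rightarrow> int \<Rightarrow> ((real^'n) \<times> (real^'n) \<Rightarrow> complex) \<Rightarrow> bool" where
  "iwt i m F \<longleftrightarrow> (\<forall>t z. F (rot1 i t z) = cis (of_int m * t) * F z)"

lemma iwt_proj_other: "iwt j k F \<Longrightarrow> iwt j k (proj i m F)"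
  by (simp add: iwt_def rot1_def[of j] proj_rot proj_scale del: split_paired_All)

lemma rot1_rot1: "rot1 i s (rot1 i t z) = rot1 i (s + t) z"
  unfolding rot1_def rot_rot by (rule arg_cong[where f="\<lambda>\<theta>. rot \<theta> z"]) auto

lemma rot1_cong: "cis s = cis t \<Longrightarrow> rot1 i s z = rot1 i t z"
  unfolding rot1_def by (rule rot_cong) auto

lemma cis_mult_int_cong: "cis s = cis t \<Longrightarrow> cis (of_int m * s) = cis (of_int m * t)"
  by (metis cis_power_int)

lemma cis_add_2pi: "cis (t + 2 * pi) = cis t"
  by (simp add: complex_eq_iff)

lemma integral_periodic_shift:
  fixes h :: "real \<Rightarrow> complex"
  assumes h: "continuous_on UNIV h" "\<And>t. h (t + 2 * pi) = h t" and s: "0 \<le> s" "s \<le> 2 * pi"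
  shows "integral {0..2*pi} (\<lambda>t. h (s + t)) = integral {0..2*pi} h"
proof -
  have int: "h integrable_on {a..b}" for a b
    by (rule integrable_continuous_real) (rule continuous_on_subset[OF h(1)], simp)
  have "integral {0..2*pi} (\<lambda>t. h (s + t)) = integral {s..2*pi + s} h"
    using integral_shift_Icc_real[of 0 "2*pi" h s] by (simp add: o_def)
  also have "\<dots> = integral {s..2*pi} h + integral {2*pi..2*pi+s} h"
    using Henstock_Kurzweil_Integration.integral_combine[where a=s and c="2*pi" and b="2*pi+s" and f=h] s int by simp
  also have "integral {2*pi..2*pi+s} h = integral {0..s} h"
    using integral_shift_Icc_real[of 0 s h "2*pi"] h(2) by (simp add: o_def add.commute)
  also have "integral {s..2*pi} h + integral {0..s} h = integral {0..2*pi} h"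
    using Henstock_Kurzweil_Integration.integral_combine[where a=0 and c=s and b="2*pi" and f=h] s int by (simp add: add.commute)
  finally show ?thesis .
qed

text \<open>Rotating the argument shifts the integration variable; the integrand is periodic, so
  only the factor \<open>cis (m s)\<close> remains.\<close>

lemma iwt_proj:
  assumes F: "F \<in> ceig lam"
  shows "iwt i m (proj i m F)"
proof -
  have 1: "proj i m F (rot1 i s z) = cis (of_int m * s) * proj i m F z" if s: "0 \<le> s" "s \<le> 2 * pi" for s z
  proof (cases "z = 0")
    case True
    then show ?thesis using ceig_zero[OF proj_ceig[OF F]] by (simp add: rot1_zero integrable_0)
  next
    case False
    define h where "h t = cis (- (of_int m * t)) * F (rot1 i t z)" for t
    have "continuous_on UNIV h" unfolding h_def
      by (intro continuous_on_mult rot1.cont_comp ceig_continuous[OF F] False) (auto intro!: continuous_intros)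
    moreover have "h (t + 2 * pi) = h t" for t
      using cis_mult_int_cong[OF cis_add_2pi, of "- m" t] rot1_cong[OF cis_add_2pi, of i t]
      by (simp add: h_def del: cis_mult)
    ultimately have "integral {0..2*pi} (\<lambda>t. h (s + t)) = integral {0..2*pi} h"
      using s by (rule integral_periodic_shift)
    moreover have "cis (- (of_int m * t)) * F (rot1 i t (rot1 i s z)) = cis (of_int m * s) * h (s + t)" for t
    proof -
      have "cis (of_int m * s) * cis (- (of_int m * (s + t))) = cis (- (of_int m * t))"
        by (simp add: cis_mult algebra_simps)
      then show ?thesis by (simp only: h_def rot1_rot1 mult.assoc[symmetric] add.commute[of t s])
    qed
    moreover have "integral {0..2*pi} h = integral {0..2*pi} (\<lambda>t. cis (- (of_int m * t)) * F (rot1 i t z))"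
      by (simp add: h_def[abs_def])
    ultimately show ?thesis by (simp only: proj_def integral_mult_right times_divide_eq_right)
  qed
  show ?thesis unfolding iwt_def
  proof (intro allI)
    fix t z
    \<comment> \<open>Reduction of the angle to one period, where
      \<open>integral_periodic_shift\<close> applies.\<close>
    define s where "s = t - 2 * pi * of_int \<lfloor>t / (2 * pi)\<rfloor>"
    have "of_int \<lfloor>t / (2 * pi)\<rfloor> \<le> t / (2 * pi)" "t / (2 * pi) < of_int \<lfloor>t / (2 * pi)\<rfloor> + 1" by linarith+
    then have "of_int \<lfloor>t / (2 * pi)\<rfloor> * (2 * pi) \<le> t" "t < (of_int \<lfloor>t / (2 * pi)\<rfloor> + 1) * (2 * pi)"
      by (simp_all only: pos_le_divide_eq pos_divide_less_eq pi_gt_zero zero_less_mult_iff zero_less_numeral simp_thms)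
    then have s: "0 \<le> s" "s \<le> 2 * pi" unfolding s_def by (simp_all add: algebra_simps)
    have "cis t = cis (s + 2 * pi * of_int \<lfloor>t / (2 * pi)\<rfloor>)" by (simp add: s_def)
    also have "\<dots> = cis s" by (simp only: cis_mult[symmetric]) simp
    finally have c: "cis t = cis s" .
    show "proj i m F (rot1 i t z) = cis (of_int m * t) * proj i m F z"
      unfolding rot1_cong[OF c] cis_mult_int_cong[OF c] by (rule 1[OF s])
  qed
qed

lemma integral_cis_int: "integral {0..2*pi} (\<lambda>t. cis (of_int k * t)) = (if k = 0 then of_real (2 * pi) else 0)"
proof (cases "k = 0")
  case False
  have "((\<lambda>t. cis (of_int k * t)) has_integral
     (cis (of_int k * (2 * pi)) / (\<i> * of_int k) - cis (of_int k * 0) / (\<i> * of_int k))) {0..2*pi}"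
  proof (rule fundamental_theorem_of_calculus)
    fix t :: real
    have "((\<lambda>t. cis (of_int k * t) / (\<i> * of_int k)) has_derivative
        (\<lambda>u. ((of_int k * u) *\<^sub>R (\<i> * cis (of_int k * t))) / (\<i> * of_int k))) (at t within {0..2*pi})"
      using False by (auto intro!: derivative_eq_intros simp: fun_eq_iff scaleR_conv_of_real field_simps)
    then show "((\<lambda>t. cis (of_int k * t) / (\<i> * of_int k)) has_vector_derivative cis (of_int k * t)) (at t within {0..2*pi})"
      using False by (simp add: has_vector_derivative_def scaleR_conv_of_real field_simps)
  qed simp
  moreover have "cis (of_int k * (2 * pi)) = 1"
    using cis_multiple_2pi[of "of_int k"] by (simp add: mult.commute)
  ultimately show ?thesis using False by (simp add: integral_unique)
qed (simp add: scaleR_conv_of_real)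

lemma proj_iwt:
  assumes "iwt i m F"
  shows "proj i k F = (if k = m then F else (\<lambda>z. 0))"
proof
  fix z
  have "(\<lambda>t. cis (- (of_int k * t)) * F (rot1 i t z)) = (\<lambda>t. cis (of_int (m - k) * t) * F z)"
    using assms by (simp add: iwt_def cis_mult left_diff_distrib del: split_paired_All flip: mult.assoc)
  then have "proj i k F z = integral {0..2*pi} (\<lambda>t. cis (of_int (m - k) * t)) * F z / of_real (2 * pi)"
    unfolding proj_def by (simp del: of_int_diff)
  then show "proj i k F z = (if k = m then F else (\<lambda>z. 0)) z"
    unfolding integral_cis_int by auto
qed

section \<open>Completeness of the Fourier modes on the circle\<close>

definition no_fourier :: "(real \<Rightarrow> complex) \<Rightarrow> bool" where
  "no_fourier \<phi> \<longleftrightarrow> continuous_on {0..2*pi} \<phi> \<and>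
     (\<forall>m::int. integral {0..2*pi} (\<lambda>t. cis (of_int m * t) * \<phi> t) = 0)"

lemma no_fourier_add:
  assumes "no_fourier \<phi>" "no_fourier \<psi>"
  shows "no_fourier (\<lambda>t. a * \<phi> t + b * \<psi> t)"
proof -
  have i: "(\<lambda>t. cis (of_int m * t) * f t) integrable_on {0..2*pi}" if "no_fourier f" for m f
    using that unfolding no_fourier_def by (intro integrable_continuous_real continuous_on_mult) (auto intro!: continuous_intros)
  have "integral {0..2*pi} (\<lambda>t. cis (of_int m * t) * (a * \<phi> t + b * \<psi> t)) = 0" for m
  proof -
    have "integral {0..2*pi} (\<lambda>t. cis (of_int m * t) * (a * \<phi> t + b * \<psi> t)) =
      integral {0..2*pi} (\<lambda>t. a * (cis (of_int m * t) * \<phi> t) + b * (cis (of_int m * t) * \<psi> t))"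
      by (simp add: algebra_simps)
    also have "\<dots> = integral {0..2*pi} (\<lambda>t. a * (cis (of_int m * t) * \<phi> t)) + integral {0..2*pi} (\<lambda>t. b * (cis (of_int m * t) * \<psi> t))"
      by (rule integral_add) (intro integrable_on_mult_right i assms)+
    finally show ?thesis using assms by (simp add: no_fourier_def)
  qed
  then show ?thesis using assms by (auto simp: no_fourier_def intro!: continuous_intros)
qed

lemma no_fourier_cis:
  assumes "no_fourier \<phi>"
  shows "no_fourier (\<lambda>t. cis (of_int k * t) * \<phi> t)"
proof -
  have "(\<lambda>t. cis (of_int m * t) * (cis (of_int k * t) * \<phi> t)) = (\<lambda>t. cis (of_int (m + k) * t) * \<phi> t)" for m
    by (simp add: cis_mult distrib_right flip: mult.assoc)
  moreover have "integral {0..2*pi} (\<lambda>t. cis (of_int (m + k) * t) * \<phi> t) = 0" for m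
    using assms unfolding no_fourier_def by blast
  ultimately show ?thesis using assms unfolding no_fourier_def
    by (auto intro!: continuous_intros simp del: of_int_add)
qed

text \<open>Multiplication by polynomials in \<open>cos t\<close>, \<open>sin t\<close> only shifts Fourier modes; with Stone--Weierstrass
  a function without Fourier modes is therefore orthogonal to itself.\<close>
lemma no_fourier_poly:
  fixes g :: "complex \<Rightarrow> real"
  assumes "real_polynomial_function g" "no_fourier \<phi>"
  shows "no_fourier (\<lambda>t. of_real (g (cis t)) * \<phi> t)"
  using assms
proof (induction g arbitrary: \<phi>)
  case (linear f)
  then have lin: "linear f" by (simp add: bounded_linear.linear)
  have f: "f (cis t) = cos t * f 1 + sin t * f \<i>" for t
  proof -
    have "cis t = cos t *\<^sub>R 1 + sin t *\<^sub>R \<i>" by (simp add: complex_eq_iff)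
    then show ?thesis by (simp add: linear_add[OF lin] linear_scale[OF lin])
  qed
  have "complex_of_real (f (cis t)) = ((f 1 - \<i> * f \<i>) / 2) * cis (of_int 1 * t) + ((f 1 + \<i> * f \<i>) / 2) * cis (of_int (-1) * t)" for t
    by (simp add: f complex_eq_iff field_simps)
  then have eq: "(\<lambda>t. of_real (f (cis t)) * \<phi> t) =
    (\<lambda>t. ((f 1 - \<i> * f \<i>) / 2) * (cis (of_int 1 * t) * \<phi> t) + ((f 1 + \<i> * f \<i>) / 2) * (cis (of_int (-1) * t) * \<phi> t))"
    by (simp add: algebra_simps)
  show ?case unfolding eq by (rule no_fourier_add[OF no_fourier_cis[OF linear.prems] no_fourier_cis[OF linear.prems]])
next
  case (const c)
  then show ?case using no_fourier_add[OF const const, of c 0] by simp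
next
  case (add f g)
  then show ?case using no_fourier_add[OF add.IH(1)[OF add.prems] add.IH(2)[OF add.prems], of 1 1]
    by (simp add: algebra_simps)
next
  case (mult f g)
  then show ?case using mult.IH(1)[OF mult.IH(2)[OF mult.prems]] by (simp add: algebra_simps)
qed

text \<open>The value at \<open>1\<close> is enough for the application: there \<open>cis t\<close>
  runs through the circle orbit of an arbitrary point, which itself sits at
  \<open>t = 0\<close>.\<close>

lemma no_fourier_imp_zero:
  assumes G: "continuous_on (sphere 0 1) G" and nf: "no_fourier (\<lambda>t. G (cis t))"
  shows "G 1 = 0"
proof -
  define h where "h t = G (cis t)" for t
  have ch: "continuous_on {0..2*pi} h" using nf by (simp add: no_fourier_def h_def[abs_def])
  define I where "I = integral {0..2*pi} (\<lambda>t. norm (h t))"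
  have I0: "I \<ge> 0" unfolding I_def by (intro integral_nonneg integrable_continuous_real continuous_on_norm ch) auto
  have ih2: "(\<lambda>t. cnj (h t) * h t) integrable_on {0..2*pi}"
    by (intro integrable_continuous_real continuous_on_mult continuous_on_cnj ch)
  have "norm (integral {0..2*pi} (\<lambda>t. cnj (h t) * h t)) \<le> e * I" if e: "e > 0" for e
  proof -
    obtain g1 where g1: "real_polynomial_function g1" "\<And>x. x \<in> sphere 0 1 \<Longrightarrow> \<bar>Re (G x) - g1 x\<bar> < e / 2"
      using Stone_Weierstrass_real_polynomial_function[OF compact_sphere continuous_on_Re[OF G], of "e / 2"] e by auto
    obtain g2 where g2: "real_polynomial_function g2" "\<And>x. x \<in> sphere 0 1 \<Longrightarrow> \<bar>Im (G x) - g2 x\<bar> < e / 2"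
      using Stone_Weierstrass_real_polynomial_function[OF compact_sphere continuous_on_Im[OF G], of "e / 2"] e by auto
    have nf1: "no_fourier (\<lambda>t. 1 * (of_real (g1 (cis t)) * h t) + (- \<i>) * (of_real (g2 (cis t)) * h t))"
      using nf by (intro no_fourier_add no_fourier_poly g1(1) g2(1)) (simp_all add: h_def[abs_def])
    \<comment> \<open>A polynomial approximation of \<open>cnj h\<close>, whose integral against
      \<open>h\<close> is zero.\<close>
    define k where "k t = (of_real (g1 (cis t)) - \<i> * of_real (g2 (cis t)))" for t
    have nk: "no_fourier (\<lambda>t. k t * h t)" using nf1 by (simp add: k_def algebra_simps)
    then have k0: "integral {0..2*pi} (\<lambda>t. k t * h t) = 0" and ck: "continuous_on {0..2*pi} (\<lambda>t. k t * h t)"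
      unfolding no_fourier_def by (auto dest: spec[of _ 0])
    have near: "norm (cnj (h t) - k t) \<le> e" for t
    proof -
      have "norm (cnj (h t) - k t) \<le> \<bar>Re (cnj (h t) - k t)\<bar> + \<bar>Im (cnj (h t) - k t)\<bar>" by (rule cmod_le)
      also have "\<dots> \<le> e / 2 + e / 2"
        using g1(2)[of "cis t"] g2(2)[of "cis t"] by (simp add: h_def k_def abs_minus_commute)
      finally show ?thesis by simp
    qed
    have "integral {0..2*pi} (\<lambda>t. cnj (h t) * h t) = integral {0..2*pi} (\<lambda>t. cnj (h t) * h t - k t * h t)"
      using integral_diff[OF ih2 integrable_continuous_real[OF ck]] k0 by simp
    also have "norm \<dots> \<le> integral {0..2*pi} (\<lambda>t. e * norm (h t))"
    proof (rule integral_norm_bound_integral)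
      show "(\<lambda>t. cnj (h t) * h t - k t * h t) integrable_on {0..2 * pi}"
        by (rule integrable_diff[OF ih2 integrable_continuous_real[OF ck]])
      show "(\<lambda>t. e * norm (h t)) integrable_on {0..2 * pi}"
        by (intro integrable_continuous_real continuous_intros ch)
      show "norm (cnj (h t) * h t - k t * h t) \<le> e * norm (h t)" for t
        using mult_right_mono[OF near[of t], of "norm (h t)"] by (simp add: left_diff_distrib[symmetric] norm_mult)
    qed
    finally show ?thesis by (simp add: I_def)
  qed
  then have "norm (integral {0..2*pi} (\<lambda>t. cnj (h t) * h t)) \<le> 0"
  proof -
    have "norm (integral {0..2*pi} (\<lambda>t. cnj (h t) * h t)) \<le> 0 + e" if "e > 0" for e
    proof -
      \<comment> \<open>Division by \<open>I + 1\<close> because \<open>I\<close> may be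
        zero.\<close>
      have "norm (integral {0..2*pi} (\<lambda>t. cnj (h t) * h t)) \<le> e / (I + 1) * I"
        using I0 that \<open>\<And>e. e > 0 \<Longrightarrow> norm (integral {0..2*pi} (\<lambda>t. cnj (h t) * h t)) \<le> e * I\<close>[of "e / (I + 1)"] by simp
      also have "\<dots> \<le> e" using I0 that by (simp add: field_simps)
      finally show ?thesis by simp
    qed
    then show ?thesis using field_le_epsilon by blast
  qed
  then have z: "integral {0..2*pi} (\<lambda>t. cnj (h t) * h t) = 0" by simp
  have "integral {0..2*pi} (\<lambda>t. (norm (h t))\<^sup>2) = 0"
  proof -
    have "(\<lambda>t. (norm (h t))\<^sup>2) = Re \<circ> (\<lambda>t. cnj (h t) * h t)"
      unfolding cmod_power2 by (auto simp: fun_eq_iff power2_eq_square)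
    then show ?thesis using integral_linear[OF ih2 bounded_linear_Re] z by simp
  qed
  moreover have "continuous_on {0..2*pi} (\<lambda>t. (norm (h t))\<^sup>2)" by (intro continuous_intros ch)
  ultimately have "(norm (h 0))\<^sup>2 = 0" using integral_eq_0_iff[of 0 "2*pi" "\<lambda>t. (norm (h t))\<^sup>2"] by auto
  then show ?thesis by (simp add: h_def)
qed

text \<open>The rotation of the \<open>i\<close>-th plane as a function of \<open>cis t\<close>
  rather than of \<open>t\<close>, since Stone-Weierstrass is applied on the unit circle in the
  complex plane.\<close>

definition twist :: "'n::finite \<Rightarrow> (real^'n) \<times> (real^'n) \<Rightarrow> complex \<Rightarrow> (real^'n) \<times> (real^'n)" where
  "twist i z \<zeta> = ((\<chi> j. if j = i then Re \<zeta> * fst z $ j + Im \<zeta> * snd z $ j else fst z $ j),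
     (\<chi> j. if j = i then - Im \<zeta> * fst z $ j + Re \<zeta> * snd z $ j else snd z $ j))"

lemma twist_cis: "twist i z (cis t) = rot1 i t z"
  by (simp add: twist_def rot1_def rot_def vec_eq_iff prod_eq_iff)

text \<open>Restricted to the circle orbit of a point, \<open>F\<close> has no Fourier modes and is
  therefore zero there.\<close>

lemma proj_separates:
  assumes F: "F \<in> ceig lam" and z: "\<And>m. proj i m F = (\<lambda>z. 0)"
  shows "F = (\<lambda>z. 0)"
proof
  fix z :: "(real^'a) \<times> (real^'a)"
  show "F z = 0"
  proof (cases "z = 0")
    case True then show ?thesis using ceig_zero[OF F] by simp
  next
    case False
    have nz: "twist i z \<zeta> \<noteq> 0" if "\<zeta> \<in> sphere 0 1" for \<zeta>
    proof -
      have "\<zeta> = cis (Arg \<zeta>)" using that cis_Arg[of \<zeta>] by (cases "\<zeta> = 0") (auto simp: sgn_div_norm)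
      then show ?thesis using twist_cis[of i z "Arg \<zeta>"] rot1.U_eq_0_iff False by metis
    qed
    have cont_if: "continuous_on S (\<lambda>x. if P then f x else g x)" if "continuous_on S f" "continuous_on S g"
      for S :: "complex set" and f g :: "complex \<Rightarrow> real" and P
      using that by (cases P) auto
    have "continuous_on (sphere 0 1) (twist i z)"
      unfolding twist_def[abs_def]
      by (intro continuous_on_Pair continuous_on_vec_lambda cont_if) (auto intro!: continuous_intros)
    then have c: "continuous_on (sphere 0 1) (\<lambda>\<zeta>. F (twist i z \<zeta>))"
      by (rule continuous_on_compose2[OF ceig_continuous[OF F]]) (use nz in auto)
    have "no_fourier (\<lambda>t. F (twist i z (cis t)))" unfolding no_fourier_def twist_cis
    proof (intro conjI allI)
      show "continuous_on {0..2 * pi} (\<lambda>t. F (rot1 i t z))"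
        by (rule rot1.cont_comp[OF ceig_continuous[OF F] False])
      fix m :: int
      have "proj i (- m) F z = 0" using z by simp
      then show "integral {0..2 * pi} (\<lambda>t. cis (of_int m * t) * F (rot1 i t z)) = 0"
        by (simp add: proj_def)
    qed
    from no_fourier_imp_zero[OF c this] show ?thesis
      using twist_cis[of i z 0] by (simp add: rot1_def rot_zero)
  qed
qed

section \<open>Weight spaces of the full torus\<close>

definition wdot :: "('n::finite \<Rightarrow> int) \<Rightarrow> ('n \<Rightarrow> real) \<Rightarrow> real" where
  "wdot w \<theta> = (\<Sum>j\<in>UNIV. of_int (w j) * \<theta> j)"

definition wt :: "real \<Rightarrow> ('n::finite \<Rightarrow> int) \<Rightarrow> ((real^'n) \<times> (real^'n) \<Rightarrow> complex) set" where
  "wt lam w = {F \<in> ceig lam. \<forall>\<theta> z. F (rot \<theta> z) = cis (wdot w \<theta>) * F z}"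

text \<open>A torus element is a product of rotations of single planes; the induction is on the set
  of planes that have been rotated.\<close>

lemma wtI:
  assumes "F \<in> ceig lam" "\<And>i. iwt i (w i) F"
  shows "F \<in> wt lam w"
proof -
  have "F (rot (\<lambda>j. if j \<in> J then \<theta> j else 0) z) = cis (\<Sum>j\<in>J. of_int (w j) * \<theta> j) * F z" for J \<theta> z
  proof (induction J arbitrary: z rule: infinite_finite_induct)
    case (insert i J)
    have "(\<lambda>j. if j \<in> insert i J then \<theta> j else 0) = (\<lambda>j. (if j = i then \<theta> i else 0) + (if j \<in> J then \<theta> j else 0))"
      using insert by auto
    then have "rot (\<lambda>j. if j \<in> insert i J then \<theta> j else 0) z = rot1 i (\<theta> i) (rot (\<lambda>j. if j \<in> J then \<theta> j else 0) z)"
      by (simp only: rot1_def rot_rot)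
    then show ?case using assms(2)[of i] insert by (simp add: iwt_def cis_mult flip: mult.assoc del: split_paired_All)
  qed (auto simp: rot_zero)
  from this[of UNIV] show ?thesis using assms(1) by (simp add: wt_def wdot_def del: split_paired_All)
qed

lemma wtD:
  assumes "F \<in> wt lam w"
  shows "F \<in> ceig lam" "F (rot \<theta> z) = cis (wdot w \<theta>) * F z" "iwt i (w i) F"
proof -
  show 1: "F \<in> ceig lam" and 2: "F (rot \<theta> z) = cis (wdot w \<theta>) * F z" for \<theta> z
    using assms by (simp_all add: wt_def del: split_paired_All)
  have "(\<Sum>j\<in>UNIV. of_int (w j) * (if j = i then t else 0)) = of_int (w i) * t" for t :: real
    by (simp add: if_distrib cong: if_cong)
  then show "iwt i (w i) F" unfolding iwt_def rot1_def 2 wdot_def by simp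
qed

lemma wt_lincomb: "F \<in> wt lam w \<Longrightarrow> G \<in> wt lam w \<Longrightarrow> (\<lambda>z. a * F z + b * G z) \<in> wt lam w"
  by (simp add: wt_def ceig_lincomb algebra_simps del: split_paired_All)

definition projs :: "'n::finite list \<Rightarrow> ('n \<Rightarrow> int) \<Rightarrow> ((real^'n) \<times> (real^'n) \<Rightarrow> complex) \<Rightarrow> (real^'n) \<times> (real^'n) \<Rightarrow> complex" where
  "projs xs w = fold (\<lambda>i. proj i (w i)) xs"

lemma projs_simps [simp]: "projs [] w F = F" "projs (x # xs) w F = projs xs w (proj x (w x) F)"
  by (simp_all add: projs_def)

lemma projs_ceig: "F \<in> ceig lam \<Longrightarrow> projs xs w F \<in> ceig lam"
  by (induction xs arbitrary: F) (auto intro: proj_ceig)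

lemma projs_lincomb:
  "F \<in> ceig lam \<Longrightarrow> G \<in> ceig lam \<Longrightarrow>
    projs xs w (\<lambda>z. a * F z + b * G z) = (\<lambda>z. a * projs xs w F z + b * projs xs w G z)"
  by (induction xs arbitrary: F G) (simp_all add: proj_lincomb proj_ceig)

lemma projs_eigen:
  "(\<And>z. F (rot \<theta> z) = c * F z) \<Longrightarrow> projs xs w F (rot \<theta> z) = c * projs xs w F z"
proof (induction xs arbitrary: F z)
  case (Cons x xs)
  have "proj x (w x) F (rot \<theta> z) = c * proj x (w x) F z" for z
    unfolding proj_rot Cons.prems by (rule proj_scale)
  then show ?case using Cons.IH by simp
qed simp

lemma projs_iwt_keep: "iwt j k F \<Longrightarrow> iwt j k (projs xs w F)"
  by (induction xs arbitrary: F) (auto intro: iwt_proj_other)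

lemma projs_iwt: "F \<in> ceig lam \<Longrightarrow> i \<in> set xs \<Longrightarrow> iwt i (w i) (projs xs w F)"
  by (induction xs arbitrary: F) (auto intro: iwt_proj projs_iwt_keep proj_ceig)

lemma projs_separates:
  "distinct xs \<Longrightarrow> F \<in> ceig lam \<Longrightarrow> F \<noteq> (\<lambda>z. 0) \<Longrightarrow> \<exists>w. projs xs w F \<noteq> (\<lambda>z. 0)"
proof (induction xs arbitrary: F)
  case (Cons x xs)
  obtain m where m: "proj x m F \<noteq> (\<lambda>z. 0)" using proj_separates Cons.prems by blast
  obtain w where w: "projs xs w (proj x m F) \<noteq> (\<lambda>z. 0)"
    using Cons.IH[OF _ proj_ceig[OF Cons.prems(2)] m] Cons.prems by auto
  have "projs xs (w(x := m)) G = projs xs w G" for G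
    using Cons.prems(1) unfolding projs_def by (intro fold_cong) (auto intro: fold_cong)
  then have "projs (x # xs) (w(x := m)) F \<noteq> (\<lambda>z. 0)" using w by simp
  then show ?case by blast
qed auto

lemma proj_zero: "proj i m (\<lambda>z. 0) = (\<lambda>z. 0)"
  by (simp add: proj_def fun_eq_iff)

lemma projs_zero: "projs xs w (\<lambda>z. 0) = (\<lambda>z. 0)"
  by (induction xs) (simp_all add: proj_zero)

lemma projs_same: "(\<And>i. iwt i (w i) F) \<Longrightarrow> projs xs w F = F"
proof (induction xs)
  case (Cons x xs)
  then show ?case using proj_iwt[of x "w x" F "w x"] by simp
qed simp

lemma projs_other: "(\<And>i. iwt i (w i) F) \<Longrightarrow> j \<in> set xs \<Longrightarrow> w' j \<noteq> w j \<Longrightarrow> projs xs w' F = (\<lambda>z. 0)"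
proof (induction xs)
  case (Cons x xs)
  then show ?case by (cases "w' x = w x") (auto simp: proj_iwt[OF Cons.prems(1)] projs_zero)
qed simp

text \<open>The projection onto a torus weight, taken one coordinate circle at a time along an
  arbitrarily chosen enumeration of the coordinates.\<close>

definition wproj :: "('n::finite \<Rightarrow> int) \<Rightarrow> ((real^'n) \<times> (real^'n) \<Rightarrow> complex) \<Rightarrow> (real^'n) \<times> (real^'n) \<Rightarrow> complex" where
  "wproj = projs (SOME xs. set xs = UNIV \<and> distinct xs)"

lemma some_enum: "set (SOME xs. set xs = (UNIV :: 'n::finite set) \<and> distinct xs) = UNIV"
    "distinct (SOME xs. set xs = (UNIV :: 'n::finite set) \<and> distinct xs)"
  using someI_ex[OF finite_distinct_list[of "UNIV :: 'n set"]] by auto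

lemma wproj_wt: "F \<in> ceig lam \<Longrightarrow> wproj w F \<in> wt lam w"
  unfolding wproj_def by (rule wtI[OF projs_ceig projs_iwt]) (auto simp: some_enum)

lemma wproj_lincomb: "F \<in> ceig lam \<Longrightarrow> G \<in> ceig lam \<Longrightarrow>
    wproj w (\<lambda>z. a * F z + b * G z) = (\<lambda>z. a * wproj w F z + b * wproj w G z)"
  unfolding wproj_def by (rule projs_lincomb)

lemma wproj_eigen: "(\<And>z. F (rot \<theta> z) = c * F z) \<Longrightarrow> wproj w F (rot \<theta> z) = c * wproj w F z"
  unfolding wproj_def by (rule projs_eigen)

lemma wproj_separates: "F \<in> ceig lam \<Longrightarrow> F \<noteq> (\<lambda>z. 0) \<Longrightarrow> \<exists>w. wproj w F \<noteq> (\<lambda>z. 0)"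
  unfolding wproj_def by (rule projs_separates[OF some_enum(2)])

lemma wproj_of_wt:
  assumes "F \<in> wt lam w"
  shows "wproj w' F = (if w' = w then F else (\<lambda>z. 0))"
proof (cases "w' = w")
  case True
  then show ?thesis unfolding wproj_def using projs_same wtD(3)[OF assms] by auto
next
  case False
  then obtain j where "w' j \<noteq> w j" by auto
  then show ?thesis unfolding wproj_def by (simp add: some_enum False projs_other[where j=j, OF wtD(3)[OF assms]])
qed

section \<open>Root vectors and weight multiplicities\<close>

definition cdir :: "('a::euclidean_space \<Rightarrow> complex) \<Rightarrow> 'a \<Rightarrow> 'a \<Rightarrow> complex" where
  "cdir F v z = Complex (dirderiv (\<lambda>x. Re (F x)) v z) (dirderiv (\<lambda>x. Im (F x)) v z)"

lemma ceig_has_derivative: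
  assumes "F \<in> ceig lam" "z \<noteq> 0"
  shows "(F has_derivative (\<lambda>v. cdir F v z)) (at z)"
proof -
  have h: "smooth_on (- {0}) (\<lambda>x. Re (F x))" "smooth_on (- {0}) (\<lambda>x. Im (F x))"
    using assms hom_eigD(3) by (auto simp: ceig_def)
  have z: "z \<in> - {0}" using assms(2) by simp
  have "((\<lambda>x. complex_of_real (Re (F x)) + \<i> * complex_of_real (Im (F x))) has_derivative
     (\<lambda>v. complex_of_real (dirderiv (\<lambda>x. Re (F x)) v z) + \<i> * complex_of_real (dirderiv (\<lambda>x. Im (F x)) v z))) (at z)"
    by (intro has_derivative_add has_derivative_mult_right bounded_linear.has_derivative[OF bounded_linear_of_real]
      smooth_on_deriv[OF open_Compl_0 h(1) z] smooth_on_deriv[OF open_Compl_0 h(2) z])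
  then show ?thesis by (simp add: cdir_def Complex_eq complex_eq[symmetric])
qed

lemma cdir_linear: "F \<in> ceig lam \<Longrightarrow> z \<noteq> 0 \<Longrightarrow> linear (\<lambda>v. cdir F v z)"
  using ceig_has_derivative has_derivative_linear by blast

lemma cdir_eq:
  assumes "F \<in> ceig lam" "z \<noteq> 0" "(F has_derivative F') (at z)"
  shows "cdir F v z = F' v"
  using has_derivative_unique[OF ceig_has_derivative[OF assms(1,2)] assms(3)] by metis

lemma cdir_zero: "cdir F 0 z = 0"
  by (simp add: cdir_def dirderiv_zero complex_eq_iff)

section \<open>Root vectors of the unitary group\<close>

definition bx :: "'n::finite \<Rightarrow> (real^'n) \<times> (real^'n)" where "bx k = (axis k 1, 0)"
definition bw :: "'n::finite \<Rightarrow> (real^'n) \<times> (real^'n)" where "bw k = (0, axis k 1)"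

text \<open>In complex coordinates \<open>gen1\<close> is \<open>z\<^sub>i' = z\<^sub>j, z\<^sub>j' = - z\<^sub>i\<close> and \<open>gen2\<close> is \<open>z\<^sub>i' = i z\<^sub>j, z\<^sub>j' = i z\<^sub>i\<close>.
  The combination \<open>gen1 + i gen2\<close> is a root vector, acting as
  \<open>- 2 (z\<^sub>i \<partial>/\<partial>z\<^sub>j - cnj z\<^sub>j \<partial>/\<partial>cnj z\<^sub>i)\<close>.\<close>
definition gen1 :: "'n::finite \<Rightarrow> 'n \<Rightarrow> (real^'n) \<times> (real^'n) \<Rightarrow> (real^'n) \<times> (real^'n)" where
  "gen1 i j z = (fst z $ j) *\<^sub>R bx i - (fst z $ i) *\<^sub>R bx j + (snd z $ j) *\<^sub>R bw i - (snd z $ i) *\<^sub>R bw j"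

definition gen2 :: "'n::finite \<Rightarrow> 'n \<Rightarrow> (real^'n) \<times> (real^'n) \<Rightarrow> (real^'n) \<times> (real^'n)" where
  "gen2 i j z = (fst z $ j) *\<^sub>R bw i + (fst z $ i) *\<^sub>R bw j - (snd z $ j) *\<^sub>R bx i - (snd z $ i) *\<^sub>R bx j"

lemma inner_bx: "bx k \<bullet> w = fst w $ k" "w \<bullet> bx k = fst w $ k" "bw k \<bullet> w = snd w $ k" "w \<bullet> bw k = snd w $ k"
  by (simp_all add: bx_def bw_def inner_prod_def inner_axis inner_axis')

lemma bounded_linear_gen: "bounded_linear (gen1 i j)" "bounded_linear (gen2 i j)"
  unfolding linear_conv_bounded_linear[symmetric] gen1_def gen2_def
  by (auto intro!: linearI simp: algebra_simps)

lemma gen_skew: "gen1 i j z \<bullet> w = - (z \<bullet> gen1 i j w)" "gen2 i j z \<bullet> w = - (z \<bullet> gen2 i j w)"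
  by (simp_all add: gen1_def gen2_def inner_add_left inner_add_right inner_diff_left inner_diff_right inner_bx)

lemma gen_comps:
  assumes "i \<noteq> j"
  shows "fst (gen1 i j z) $ k = (if k = i then fst z $ j else if k = j then - fst z $ i else 0)"
    "snd (gen1 i j z) $ k = (if k = i then snd z $ j else if k = j then - snd z $ i else 0)"
    "fst (gen2 i j z) $ k = (if k = i then - snd z $ j else if k = j then - snd z $ i else 0)"
    "snd (gen2 i j z) $ k = (if k = i then fst z $ j else if k = j then fst z $ i else 0)"
  using assms by (auto simp: gen1_def gen2_def bx_def bw_def axis_def)

lemma rot_comps: "fst (rot \<theta> z) $ k = cos (\<theta> k) * fst z $ k + sin (\<theta> k) * snd z $ k"
    "snd (rot \<theta> z) $ k = - sin (\<theta> k) * fst z $ k + cos (\<theta> k) * snd z $ k"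
  by (simp_all add: rot_def)

lemma prod_vec_eqI: "(\<And>k. fst z $ k = fst w $ k) \<Longrightarrow> (\<And>k. snd z $ k = snd w $ k) \<Longrightarrow> z = w"
  by (simp add: prod_eq_iff vec_eq_iff)

text \<open>The adjoint action of the torus on the root plane spanned by \<open>gen1 i j\<close> and
  \<open>gen2 i j\<close>: conjugation rotates it by the root
  \<open>\<theta> i - \<theta> j\<close>.\<close>

lemma gen_rot:
  fixes \<theta> :: "'n::finite \<Rightarrow> real"
  assumes ij: "i \<noteq> j"
  defines "d \<equiv> \<theta> i - \<theta> j"
  shows "gen1 i j (rot \<theta> z) = rot \<theta> (cos d *\<^sub>R gen1 i j z + sin d *\<^sub>R gen2 i j z)"
    "gen2 i j (rot \<theta> z) = rot \<theta> (- sin d *\<^sub>R gen1 i j z + cos d *\<^sub>R gen2 i j z)"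
proof -
  have j: "cos (\<theta> j) = cos (\<theta> i) * cos d + sin (\<theta> i) * sin d" "sin (\<theta> j) = sin (\<theta> i) * cos d - cos (\<theta> i) * sin d"
    using cos_diff[of "\<theta> i" d] sin_diff[of "\<theta> i" d] by (simp_all add: d_def)
  have i: "cos (\<theta> i) = cos (\<theta> j) * cos d - sin (\<theta> j) * sin d" "sin (\<theta> i) = sin (\<theta> j) * cos d + cos (\<theta> j) * sin d"
    using cos_add[of "\<theta> j" d] sin_add[of "\<theta> j" d] by (simp_all add: d_def)
  note c = gen_comps[OF ij] rot_comps
  show "gen1 i j (rot \<theta> z) = rot \<theta> (cos d *\<^sub>R gen1 i j z + sin d *\<^sub>R gen2 i j z)"
  proof (rule prod_vec_eqI)
    fix k
    consider "k = i" | "k = j" "k \<noteq> i" | "k \<noteq> i" "k \<noteq> j" by blast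
    then show "fst (gen1 i j (rot \<theta> z)) $ k = fst (rot \<theta> (cos d *\<^sub>R gen1 i j z + sin d *\<^sub>R gen2 i j z)) $ k"
    proof cases
      case 1 then show ?thesis by (simp add: c j algebra_simps)
    next
      case 2 then show ?thesis by (simp add: c i algebra_simps)
    qed (simp add: c)
    consider "k = i" | "k = j" "k \<noteq> i" | "k \<noteq> i" "k \<noteq> j" by blast
    then show "snd (gen1 i j (rot \<theta> z)) $ k = snd (rot \<theta> (cos d *\<^sub>R gen1 i j z + sin d *\<^sub>R gen2 i j z)) $ k"
    proof cases
      case 1 then show ?thesis by (simp add: c j algebra_simps)
    next
      case 2 then show ?thesis by (simp add: c i algebra_simps)
    qed (simp add: c)
  qed
  show "gen2 i j (rot \<theta> z) = rot \<theta> (- sin d *\<^sub>R gen1 i j z + cos d *\<^sub>R gen2 i j z)"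
  proof (rule prod_vec_eqI)
    fix k
    consider "k = i" | "k = j" "k \<noteq> i" | "k \<noteq> i" "k \<noteq> j" by blast
    then show "fst (gen2 i j (rot \<theta> z)) $ k = fst (rot \<theta> (- sin d *\<^sub>R gen1 i j z + cos d *\<^sub>R gen2 i j z)) $ k"
    proof cases
      case 1 then show ?thesis by (simp add: c j algebra_simps)
    next
      case 2 then show ?thesis by (simp add: c i algebra_simps)
    qed (simp add: c)
    consider "k = i" | "k = j" "k \<noteq> i" | "k \<noteq> i" "k \<noteq> j" by blast
    then show "snd (gen2 i j (rot \<theta> z)) $ k = snd (rot \<theta> (- sin d *\<^sub>R gen1 i j z + cos d *\<^sub>R gen2 i j z)) $ k"
    proof cases
      case 1 then show ?thesis by (simp add: c j algebra_simps)
    next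
      case 2 then show ?thesis by (simp add: c i algebra_simps)
    qed (simp add: c)
  qed
qed

definition raise :: "'n::finite \<Rightarrow> 'n \<Rightarrow> ((real^'n) \<times> (real^'n) \<Rightarrow> complex) \<Rightarrow> (real^'n) \<times> (real^'n) \<Rightarrow> complex" where
  "raise i j F z = cdir F (gen1 i j z) z + \<i> * cdir F (gen2 i j z) z"

lemma raise_ceig:
  assumes "F \<in> ceig lam"
  shows "raise i j F \<in> ceig lam"
proof -
  have h: "(\<lambda>x. Re (F x)) \<in> hom_eig lam" "(\<lambda>x. Im (F x)) \<in> hom_eig lam" using assms by (auto simp: ceig_def)
  note l = hom_eig_lieder[OF _ bounded_linear_gen(1) gen_skew(1)] hom_eig_lieder[OF _ bounded_linear_gen(2) gen_skew(2)]
  have "(\<lambda>z. Re (raise i j F z)) = (\<lambda>z. 1 * lieder (gen1 i j) (\<lambda>x. Re (F x)) z + (-1) * lieder (gen2 i j) (\<lambda>x. Im (F x)) z)"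
    "(\<lambda>z. Im (raise i j F z)) = (\<lambda>z. 1 * lieder (gen1 i j) (\<lambda>x. Im (F x)) z + 1 * lieder (gen2 i j) (\<lambda>x. Re (F x)) z)"
    by (simp_all add: raise_def lieder_def cdir_def fun_eq_iff)
  then show ?thesis unfolding ceig_def mem_Collect_eq by (simp only: hom_eig_lincomb l h simp_thms)
qed

lemma raise_lincomb:
  assumes "F \<in> ceig lam" "G \<in> ceig lam"
  shows "raise i j (\<lambda>z. a * F z + b * G z) = (\<lambda>z. a * raise i j F z + b * raise i j G z)"
proof
  fix z
  show "raise i j (\<lambda>z. a * F z + b * G z) z = a * raise i j F z + b * raise i j G z"
  proof (cases "z = 0")
    case True
    have "gen1 i j 0 = 0" "gen2 i j 0 = 0" by (simp_all add: gen1_def gen2_def)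
    then show ?thesis using True by (simp add: raise_def cdir_zero)
  next
    case False
    have "cdir (\<lambda>z. a * F z + b * G z) v z = a * cdir F v z + b * cdir G v z" for v
      by (rule cdir_eq[OF ceig_lincomb[OF assms] False])
        (intro has_derivative_add has_derivative_mult_right ceig_has_derivative[OF assms(1) False] ceig_has_derivative[OF assms(2) False])
    then show ?thesis by (simp add: raise_def algebra_simps)
  qed
qed

lemma rot_eq_0: "rot \<theta> z = 0 \<longleftrightarrow> z = 0"
  using orthogonal_transformation_norm[OF orthogonal_rot, of \<theta> z] by (metis norm_eq_zero)

lemma cdir_rot:
  assumes F: "F \<in> wt lam w" and z: "z \<noteq> 0"
  shows "cdir F (rot \<theta> v) (rot \<theta> z) = cis (wdot w \<theta>) * cdir F v z"
proof -
  note c = wtD(1)[OF F]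
  have "((\<lambda>z. F (rot \<theta> z)) has_derivative (\<lambda>v. cdir F (rot \<theta> v) (rot \<theta> z))) (at z)"
    using has_derivative_compose[OF linear_imp_has_derivative[OF linear_rot] ceig_has_derivative[OF c]] z rot_eq_0 by blast
  moreover have "(\<lambda>z. F (rot \<theta> z)) = (\<lambda>z. cis (wdot w \<theta>) * F z)" using wtD(2)[OF F] by blast
  ultimately have 1: "((\<lambda>z. cis (wdot w \<theta>) * F z) has_derivative (\<lambda>v. cdir F (rot \<theta> v) (rot \<theta> z))) (at z)" by simp
  have 2: "((\<lambda>z. cis (wdot w \<theta>) * F z) has_derivative (\<lambda>v. cis (wdot w \<theta>) * cdir F v z)) (at z)"
    by (intro has_derivative_mult_right ceig_has_derivative[OF c z])
  show ?thesis using has_derivative_unique[OF 1 2] by metis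
qed

text \<open>The complex combination in \<open>raise\<close> is an eigenvector of the rotation in
  \<open>gen_rot\<close>, with factor \<open>cis (- d)\<close>. This agrees with the picture that a
  factor \<open>z_j\<close> is replaced by \<open>z_i\<close>, as each of these coordinates has
  weight \<open>-1\<close> in its own circle.\<close>

lemma raise_wt:
  assumes F: "F \<in> wt lam w" and ij: "i \<noteq> j"
  shows "raise i j F \<in> wt lam (w(i := w i - 1, j := w j + 1))"
proof -
  note c = wtD(1)[OF F]
  have "raise i j F (rot \<theta> z) = cis (wdot (w(i := w i - 1, j := w j + 1)) \<theta>) * raise i j F z" for \<theta> z
  proof (cases "z = 0")
    case True
    then show ?thesis using ceig_zero[OF raise_ceig[OF c]] by (simp add: linear_0[OF linear_rot])
  next
    case False
    define d where "d = \<theta> i - \<theta> j"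
    have lin: "cdir F (a *\<^sub>R u + b *\<^sub>R v) z = of_real a * cdir F u z + of_real b * cdir F v z" for a b u v
      using linear_add[OF cdir_linear[OF c False]] linear_scale[OF cdir_linear[OF c False]] by (simp add: scaleR_conv_of_real)
    have w': "wdot (w(i := w i - 1, j := w j + 1)) \<theta> = wdot w \<theta> - d"
    proof -
      have "wdot (w(i := w i - 1, j := w j + 1)) \<theta> = (\<Sum>k\<in>UNIV. of_int (w k) * \<theta> k + ((if k = i then - \<theta> k else 0) + (if k = j then \<theta> k else 0)))"
        unfolding wdot_def using ij by (intro sum.cong) (auto simp: algebra_simps)
      also have "\<dots> = wdot w \<theta> - d" unfolding sum.distrib wdot_def d_def by simp
      finally show ?thesis .
    qed
    have "raise i j F (rot \<theta> z) = cis (wdot w \<theta>) * (cdir F (cos d *\<^sub>R gen1 i j z + sin d *\<^sub>R gen2 i j z) z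
        + \<i> * cdir F (- sin d *\<^sub>R gen1 i j z + cos d *\<^sub>R gen2 i j z) z)"
      unfolding raise_def gen_rot[OF ij] d_def[symmetric] cdir_rot[OF F False] by (simp add: algebra_simps)
    also have "\<dots> = cis (wdot w \<theta>) * (cis (- d) * raise i j F z)"
      unfolding lin raise_def by (simp add: complex_eq_iff algebra_simps)
    also have "\<dots> = cis (wdot w \<theta> - d) * raise i j F z" by (simp add: cis_mult flip: mult.assoc)
    finally show ?thesis unfolding w' .
  qed
  then show ?thesis by (simp add: wt_def raise_ceig[OF c] del: split_paired_All fun_upd_apply)
qed

text \<open>The velocity of \<open>rot1 i t z\<close> at \<open>t = 0\<close>; in complex
  coordinates \<open>z_i' = - i z_i\<close>.\<close>

definition tang :: "'n::finite \<Rightarrow> (real^'n) \<times> (real^'n) \<Rightarrow> (real^'n) \<times> (real^'n)" where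
  "tang i z = (snd z $ i) *\<^sub>R bx i - (fst z $ i) *\<^sub>R bw i"

lemma bx_bw_comps: "fst (bx i) $ k = (if k = i then 1 else 0)" "snd (bx i) $ k = 0"
   "fst (bw i) $ k = 0" "snd (bw i) $ k = (if k = i then 1 else 0)"
  by (auto simp: bx_def bw_def axis_def)

lemma rot1_decomp:
  "rot1 i t z = z + (cos t - 1) *\<^sub>R ((fst z $ i) *\<^sub>R bx i + (snd z $ i) *\<^sub>R bw i) + sin t *\<^sub>R tang i z"
  by (rule prod_vec_eqI) (simp_all add: rot1_def rot_comps tang_def bx_bw_comps algebra_simps)

lemma cdir_tang:
  assumes F: "F \<in> wt lam w" and z: "z \<noteq> 0"
  shows "cdir F (tang i z) z = \<i> * of_int (w i) * F z"
proof -
  have z0: "rot1 i 0 z = z" by (simp add: rot1_decomp)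
  have "((\<lambda>t. rot1 i t z) has_derivative (\<lambda>h. h *\<^sub>R tang i z)) (at 0)"
    unfolding rot1_decomp by (auto intro!: derivative_eq_intros)
  from has_derivative_compose[OF this, of F "\<lambda>v. cdir F v z"] ceig_has_derivative[OF wtD(1)[OF F] z]
  have 1: "((\<lambda>t. F (rot1 i t z)) has_derivative (\<lambda>h. cdir F (h *\<^sub>R tang i z) z)) (at 0)" by (simp add: z0)
  have 2: "((\<lambda>t. cis (of_int (w i) * t) * F z) has_derivative (\<lambda>h. (of_int (w i) * h) *\<^sub>R (\<i> * cis 0) * F z)) (at 0)"
    by (auto intro!: derivative_eq_intros)
  have "(\<lambda>t. F (rot1 i t z)) = (\<lambda>t. cis (of_int (w i) * t) * F z)" using wtD(3)[OF F] unfolding iwt_def by blast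
  with 2 have "((\<lambda>t. F (rot1 i t z)) has_derivative (\<lambda>h. (of_int (w i) * h) *\<^sub>R (\<i> * cis 0) * F z)) (at 0)" by simp
  from fun_cong[OF has_derivative_unique[OF 1 this], of 1] show ?thesis
    by (simp add: scaleR_conv_of_real mult.commute mult.left_commute)
qed

text \<open>Along the great circle \<open>z\<^sub>i = R sin t, z\<^sub>j = R cos t\<close> the equation \<open>raise i j F = 0\<close> becomes
  \<open>h' = - (w\<^sub>i cot t + w\<^sub>j tan t) h\<close>, so \<open>(sin t)^w\<^sub>i h / (cos t)^w\<^sub>j\<close> is constant, and it vanishes at \<open>t = 0\<close>.\<close>
lemma raise_zero_plane:
  assumes F: "F \<in> wt lam w" and ij: "i \<noteq> j" and wi: "w i \<ge> 1" and wj: "w j \<ge> 0" and r0: "raise i j F = (\<lambda>z. 0)"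
    and R: "R > 0" and z0: "fst z0 $ i = 0" "fst z0 $ j = 0" "snd z0 $ i = 0" "snd z0 $ j = 0"
    and p: "0 \<le> p" "p \<le> pi / 2"
  shows "F (z0 + (R * sin p) *\<^sub>R bx i + (R * cos p) *\<^sub>R bx j) = 0"
proof -
  note c = wtD(1)[OF F]
  define \<gamma> where "\<gamma> t = z0 + (R * sin t) *\<^sub>R bx i + (R * cos t) *\<^sub>R bx j" for t
  have comps: "fst (\<gamma> t) $ i = R * sin t" "fst (\<gamma> t) $ j = R * cos t" "snd (\<gamma> t) $ i = 0" "snd (\<gamma> t) $ j = 0" for t
    using ij z0 by (simp_all add: \<gamma>_def bx_bw_comps)
  have nz: "\<gamma> t \<noteq> 0" for t
  proof
    assume "\<gamma> t = 0"
    then have "sin t = 0" "cos t = 0" using comps(1,2)[of t] R by auto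
    then show False using sin_cos_squared_add[of t] by simp
  qed
  define h where "h t = F (\<gamma> t)" for t
  have h': "(h has_vector_derivative (- of_real (cos t / sin t * of_int (w i) + sin t / cos t * of_int (w j)) * h t)) (at t)"
    if t: "0 < t" "t < pi / 2" for t
  proof -
    have sc: "sin t > 0" "cos t > 0" using t by (auto intro!: sin_gt_zero cos_gt_zero_pi)
    have "(\<gamma> has_vector_derivative gen1 i j (\<gamma> t)) (at t)"
    proof -
      have "gen1 i j (\<gamma> t) = (R * cos t) *\<^sub>R bx i - (R * sin t) *\<^sub>R bx j" by (simp add: gen1_def comps)
      show ?thesis unfolding \<open>gen1 i j (\<gamma> t) = _\<close> unfolding \<gamma>_def[abs_def] has_vector_derivative_def
        by (auto intro!: derivative_eq_intros simp: algebra_simps)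
    qed
    from vector_derivative_diff_chain_within[OF this has_derivative_at_withinI[OF ceig_has_derivative[OF c nz]]]
    have 1: "(h has_vector_derivative cdir F (gen1 i j (\<gamma> t)) (\<gamma> t)) (at t)"
      by (simp add: o_def h_def[abs_def])
    \<comment> \<open>On this slice \<open>gen2\<close> is tangent to the torus orbit, so the
      weights determine the derivative of \<open>F\<close> along it, and
      \<open>raise i j F = 0\<close> becomes an equation along the curve alone.\<close>
    have g2: "gen2 i j (\<gamma> t) = (- (cos t / sin t)) *\<^sub>R tang i (\<gamma> t) + (- (sin t / cos t)) *\<^sub>R tang j (\<gamma> t)"
      unfolding gen2_def tang_def comps using sc by (simp add: field_simps)
    have D2: "cdir F (gen2 i j (\<gamma> t)) (\<gamma> t) = - of_real (cos t / sin t) * (\<i> * of_int (w i) * h t)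
          + (- of_real (sin t / cos t)) * (\<i> * of_int (w j) * h t)"
      unfolding g2 linear_add[OF cdir_linear[OF c nz]] linear_scale[OF cdir_linear[OF c nz]] cdir_tang[OF F nz] h_def
      by (simp add: scaleR_conv_of_real)
    have D1: "cdir F (gen1 i j (\<gamma> t)) (\<gamma> t) = - \<i> * cdir F (gen2 i j (\<gamma> t)) (\<gamma> t)"
      using fun_cong[OF r0, of "\<gamma> t"] by (simp add: raise_def add_eq_0_iff)
    have "cdir F (gen1 i j (\<gamma> t)) (\<gamma> t) = - of_real (cos t / sin t * of_int (w i) + sin t / cos t * of_int (w j)) * h t"
      unfolding D1 D2 by (simp add: algebra_simps)
    with 1 show ?thesis by simp
  qed
  have ch: "continuous_on S h" for S
    unfolding h_def \<gamma>_def
    by (rule continuous_on_compose2[OF ceig_continuous[OF c]]) (use nz in \<open>auto intro!: continuous_intros simp: \<gamma>_def\<close>)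
  define a where "a = nat (w i)"
  define b where "b = nat (w j)"
  have a: "a \<ge> 1" "of_int (w i) = real a" "of_int (w j) = real b" using wi wj by (simp_all add: a_def b_def)
  \<comment> \<open>The integrating factor. It vanishes at \<open>0\<close> because
    \<open>w i \<ge> 1\<close>.\<close>
  define s where "s t = sin t ^ a * inverse (cos t) ^ b" for t :: real
  have ds: "(s has_real_derivative s t * (cos t / sin t * real a + sin t / cos t * real b)) (at t)" if t: "0 < t" "t < pi / 2" for t
  proof -
    have sc: "sin t > 0" "cos t > 0" using t by (auto intro!: sin_gt_zero cos_gt_zero_pi)
    obtain a' where a': "a = Suc a'" using a(1) by (cases a) auto
    have "(s has_real_derivative (real a * sin t ^ (a - 1) * cos t * inverse (cos t) ^ b
       + sin t ^ a * (real b * inverse (cos t) ^ (b - 1) * (sin t * inverse (cos t) * inverse (cos t))))) (at t)"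
      unfolding s_def[abs_def] using sc by (auto intro!: derivative_eq_intros simp: algebra_simps)
    also have "real a * sin t ^ (a - 1) * cos t * inverse (cos t) ^ b
       + sin t ^ a * (real b * inverse (cos t) ^ (b - 1) * (sin t * inverse (cos t) * inverse (cos t)))
      = s t * (cos t / sin t * real a + sin t / cos t * real b)"
      unfolding s_def using sc a' by (cases b) (simp_all add: field_simps)
    finally show ?thesis .
  qed
  have inner: "h t = 0" if t: "0 < t" "t < pi / 2" for t
  proof -
    have "of_real (s t) * h t = 0"
    proof (rule has_derivative_zero_unique_strong_interval[of "{0}" 0 t "\<lambda>t. of_real (s t) * h t" 0 t])
      have "cos u \<noteq> 0" if "u \<in> {0..t}" for u using cos_gt_zero_pi[of u] that t by auto
      then show "continuous_on {0..t} (\<lambda>t. of_real (s t) * h t)"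
        unfolding s_def by (intro continuous_intros ch) auto
      show "of_real (s 0) * h 0 = 0" using a(1) by (simp add: s_def)
      fix u assume "u \<in> {0..t} - {0}"
      then have u: "0 < u" "u < pi / 2" using t by auto
      have "((\<lambda>t. of_real (s t) * h t) has_vector_derivative
         (of_real (s u) * (- of_real (cos u / sin u * of_int (w i) + sin u / cos u * of_int (w j)) * h u) +
          of_real (s u * (cos u / sin u * real a + sin u / cos u * real b)) * h u)) (at u within {0..t})"
        by (intro has_vector_derivative_mult has_vector_derivative_of_real
            has_vector_derivative_at_within[OF h'[OF u]] has_field_derivative_at_within[OF ds[OF u]])
      also have "of_real (s u) * (- of_real (cos u / sin u * of_int (w i) + sin u / cos u * of_int (w j)) * h u) +
          of_real (s u * (cos u / sin u * real a + sin u / cos u * real b)) * h u = 0"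
        unfolding a(2,3) by (simp add: algebra_simps)
      finally show "((\<lambda>t. of_real (s t) * h t) has_derivative (\<lambda>h. 0)) (at u within {0..t})"
        by (simp add: has_vector_derivative_def)
    qed (use t in auto)
    moreover have "s t > 0" unfolding s_def using t by (auto intro!: mult_pos_pos zero_less_power sin_gt_zero cos_gt_zero_pi)
    ultimately show ?thesis by simp
  qed
  have cl: "closure {0<..<pi/2} = {0..pi/2::real}" by simp
  \<comment> \<open>Continuity carries the vanishing over to the endpoints, where the differential
    equation is singular.\<close>
  have "h p = 0"
    by (rule continuous_constant_on_closure[of "{0<..<pi/2}" h]) (use ch inner p cl in auto)
  then show ?thesis by (simp add: h_def \<gamma>_def)
qed

text \<open>The absolute value of \<open>F\<close> is constant on torus orbits, and each orbit
  contains a point whose coordinates \<open>z_i\<close> and \<open>z_j\<close> are real and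
  nonnegative. Such a point lies on one of the great circles of \<open>raise_zero_plane\<close>,
  unless both coordinates vanish.\<close>

lemma raise_injective:
  assumes F: "F \<in> wt lam w" and ij: "i \<noteq> j" and wi: "w i \<ge> 1" and wj: "w j \<ge> 0" and r0: "raise i j F = (\<lambda>z. 0)"
  shows "F = (\<lambda>z. 0)"
proof
  fix z :: "(real^'a) \<times> (real^'a)"
  define \<theta> where "\<theta> k = (if k = i \<or> k = j then Arg (Complex (fst z $ k) (snd z $ k)) else 0)" for k
  define y where "y = rot \<theta> z"
  define r where "r k = norm (Complex (fst z $ k) (snd z $ k))" for k
  have yk: "fst y $ k = r k" "snd y $ k = 0" if "k = i \<or> k = j" for k
  proof -
    let ?c = "Complex (fst z $ k) (snd z $ k)"
    have "?c = of_real (r k) * cis (\<theta> k)" using that rcis_cmod_Arg[of ?c] by (simp add: r_def \<theta>_def rcis_def)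
    then have e: "fst z $ k = r k * cos (\<theta> k)" "snd z $ k = r k * sin (\<theta> k)" by (simp_all add: complex_eq_iff)
    have "fst y $ k = r k * ((cos (\<theta> k))\<^sup>2 + (sin (\<theta> k))\<^sup>2)" unfolding y_def rot_comps e by algebra
    then show "fst y $ k = r k" by simp
    show "snd y $ k = 0" unfolding y_def rot_comps e by (simp add: algebra_simps)
  qed
  have Fy: "F y = cis (wdot w \<theta>) * F z" unfolding y_def by (rule wtD(2)[OF F])
  have "F y = 0"
  proof (cases "r i = 0 \<and> r j = 0")
    case True
    then have "rot1 i t y = y" for t using yk by (simp add: rot1_decomp tang_def)
    \<comment> \<open>The circle fixes \<open>y\<close>, and the angle \<open>pi / w i\<close> gives
      the weight factor \<open>-1\<close>.\<close>
    then have "F y = cis (of_int (w i) * (pi / of_int (w i))) * F y" using wtD(3)[OF F] unfolding iwt_def by metis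
    then show ?thesis using wi by simp
  next
    case False
    have rpos: "r i \<ge> 0" "r j \<ge> 0" by (simp_all add: r_def)
    define R where "R = sqrt ((r i)\<^sup>2 + (r j)\<^sup>2)"
    have "(r i)\<^sup>2 + (r j)\<^sup>2 > 0" using False by (auto simp: sum_power2_gt_zero_iff)
    then have R: "R > 0" unfolding R_def by (rule real_sqrt_gt_zero)
    have R2: "R\<^sup>2 = (r i)\<^sup>2 + (r j)\<^sup>2" by (simp add: R_def)
    have "(r j / R)\<^sup>2 + (r i / R)\<^sup>2 = ((r i)\<^sup>2 + (r j)\<^sup>2) / R\<^sup>2"
      by (simp add: power_divide add_divide_distrib)
    then have "(r j / R)\<^sup>2 + (r i / R)\<^sup>2 = 1" unfolding R2[symmetric] using R by simp
    from sincos_total_pi_half[OF _ _ this] R rpos obtain p where p: "0 \<le> p" "p \<le> pi / 2" "r j / R = cos p" "r i / R = sin p" by auto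
    then have ri: "r i = R * sin p" "r j = R * cos p" using R by (auto simp: field_simps)
    define y0 where "y0 = y - r i *\<^sub>R bx i - r j *\<^sub>R bx j"
    have "fst y0 $ i = 0" "fst y0 $ j = 0" "snd y0 $ i = 0" "snd y0 $ j = 0"
      unfolding y0_def using ij yk[of i] yk[of j] by (simp_all add: bx_bw_comps)
    from raise_zero_plane[OF assms R this p(1,2)] show ?thesis unfolding ri[symmetric] y0_def by simp
  qed
  then show "F z = 0" using Fy by simp
qed

text \<open>Plays the role of an inequality between the multiplicities of \<open>w\<close> and
  \<open>w'\<close> without any dimension: a linear map with trivial kernel.\<close>

definition weight_embeds :: "real \<Rightarrow> ('n::finite \<Rightarrow> int) \<Rightarrow> ('n \<Rightarrow> int) \<Rightarrow> bool" where
  "weight_embeds lam w w' \<longleftrightarrow> (\<exists>T. (\<forall>F\<in>wt lam w. T F \<in> wt lam w' \<and> (T F = (\<lambda>z. 0) \<longrightarrow> F = (\<lambda>z. 0))) \<and>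
     (\<forall>F\<in>wt lam w. \<forall>G\<in>wt lam w. \<forall>a b. T (\<lambda>z. a * F z + b * G z) = (\<lambda>z. a * T F z + b * T G z)))"

lemma weight_embedsI:
  assumes "\<And>F. F \<in> wt lam w \<Longrightarrow> T F \<in> wt lam w'" "\<And>F. F \<in> wt lam w \<Longrightarrow> T F = (\<lambda>z. 0) \<Longrightarrow> F = (\<lambda>z. 0)"
    "\<And>F G a b. F \<in> wt lam w \<Longrightarrow> G \<in> wt lam w \<Longrightarrow> T (\<lambda>z. a * F z + b * G z) = (\<lambda>z. a * T F z + b * T G z)"
  shows "weight_embeds lam w w'"
  unfolding weight_embeds_def by (rule exI[of _ T]) (use assms in blast)

lemma weight_embeds_refl: "weight_embeds lam w w"
  by (rule weight_embedsI[where T="\<lambda>F. F"]) auto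

lemma weight_embeds_trans:
  assumes "weight_embeds lam w1 w2" "weight_embeds lam w2 w3"
  shows "weight_embeds lam w1 w3"
proof -
  obtain T1 where T1: "\<And>F. F \<in> wt lam w1 \<Longrightarrow> T1 F \<in> wt lam w2" "\<And>F. F \<in> wt lam w1 \<Longrightarrow> T1 F = (\<lambda>z. 0) \<Longrightarrow> F = (\<lambda>z. 0)"
    "\<And>F G a b. F \<in> wt lam w1 \<Longrightarrow> G \<in> wt lam w1 \<Longrightarrow> T1 (\<lambda>z. a * F z + b * G z) = (\<lambda>z. a * T1 F z + b * T1 G z)"
    using assms(1) unfolding weight_embeds_def by blast
  obtain T2 where T2: "\<And>F. F \<in> wt lam w2 \<Longrightarrow> T2 F \<in> wt lam w3" "\<And>F. F \<in> wt lam w2 \<Longrightarrow> T2 F = (\<lambda>z. 0) \<Longrightarrow> F = (\<lambda>z. 0)"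
    "\<And>F G a b. F \<in> wt lam w2 \<Longrightarrow> G \<in> wt lam w2 \<Longrightarrow> T2 (\<lambda>z. a * F z + b * G z) = (\<lambda>z. a * T2 F z + b * T2 G z)"
    using assms(2) unfolding weight_embeds_def by blast
  show ?thesis
    by (rule weight_embedsI[where T="\<lambda>F. T2 (T1 F)"]) (simp_all add: T1(1,3) T2(1,3), use T1(1,2) T2(2) in blast)
qed

lemma weight_embeds_shift:
  assumes "i \<noteq> j" "w i \<ge> 1" "w j \<ge> 0"
  shows "weight_embeds lam w (w(i := w i - 1, j := w j + 1))"
  by (rule weight_embedsI[where T="raise i j"])
    (use raise_wt[OF _ assms(1)] raise_injective[OF _ assms] raise_lincomb wtD(1) in \<open>blast+\<close>)

text \<open>Complex conjugation of the coordinate \<open>z_i\<close>. It inverts the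
  \<open>i\<close>-th circle and so changes the sign of the \<open>i\<close>-th weight.\<close>

definition flip :: "'n::finite \<Rightarrow> (real^'n) \<times> (real^'n) \<Rightarrow> (real^'n) \<times> (real^'n)" where
  "flip i z = (fst z, (\<chi> k. if k = i then - snd z $ k else snd z $ k))"

lemma flip_flip: "flip i (flip i z) = z"
  by (rule prod_vec_eqI) (simp_all add: flip_def)

lemma flip_rot: "flip i (rot \<theta> z) = rot (\<theta>(i := - \<theta> i)) (flip i z)"
  by (rule prod_vec_eqI) (simp_all add: flip_def rot_comps)

lemma linear_flip: "linear (flip i)"
  by (rule linearI; rule prod_vec_eqI) (simp_all add: flip_def)

lemma orthogonal_flip: "orthogonal_transformation (flip i)"
proof -
  have "flip i v \<bullet> flip i w = v \<bullet> w" for v w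
    by (simp add: flip_def inner_prod_def inner_vec_def) (rule sum.cong, auto)
  then show ?thesis by (simp add: orthogonal_transformation_def linear_flip)
qed

lemma flip_basis: "b \<in> Basis \<Longrightarrow> flip i b = b \<or> flip i b = - b"
proof -
  assume "b \<in> Basis"
  then obtain k where "b = bx k \<or> b = bw k" by (auto simp: Basis_prod_def Basis_vec_def bx_def bw_def)
  moreover have "flip i (bx k) = bx k" by (rule prod_vec_eqI) (simp_all add: flip_def bx_bw_comps)
  moreover have "flip i (bw k) = (if k = i then - bw k else bw k)"
    by (rule prod_vec_eqI) (auto simp: flip_def bx_bw_comps)
  ultimately show ?thesis by auto
qed

lemma weight_embeds_flip: "weight_embeds lam w (w(i := - w i))"
proof (rule weight_embedsI[where T="\<lambda>F z. F (flip i z)"])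
  show "(\<lambda>z. F (flip i z)) \<in> wt lam (w(i := - w i))" if F: "F \<in> wt lam w" for F
  proof -
    have "(\<lambda>z. F (flip i z)) \<in> ceig lam"
      using wtD(1)[OF F] unfolding ceig_def
      by (auto intro: hom_eig_reflect[OF _ orthogonal_flip flip_basis, of "\<lambda>x. Re (F x)"]
          hom_eig_reflect[OF _ orthogonal_flip flip_basis, of "\<lambda>x. Im (F x)"])
    moreover have "wdot w (\<theta>(i := - \<theta> i)) = wdot (w(i := - w i)) \<theta>" for \<theta>
      unfolding wdot_def by (rule sum.cong) auto
    ultimately show ?thesis using wtD(2)[OF F] by (simp add: wt_def flip_rot del: split_paired_All fun_upd_apply)
  qed
  show "F = (\<lambda>z. 0)" if "(\<lambda>z. F (flip i z)) = (\<lambda>z. 0)" for F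
  proof
    fix z show "F z = 0" using fun_cong[OF that, of "flip i z"] by (simp add: flip_flip)
  qed
qed auto

lemma weight_embeds_signs:
  assumes "\<And>j. \<bar>w j\<bar> = \<bar>w' j\<bar>"
  shows "weight_embeds lam w w'"
proof -
  have "weight_embeds lam w (\<lambda>j. if j \<in> J then w' j else w j)" for J
  proof (induction J rule: infinite_finite_induct)
    case (insert i J)
    have "weight_embeds lam (\<lambda>j. if j \<in> J then w' j else w j) (\<lambda>j. if j \<in> insert i J then w' j else w j)"
    proof (cases "w' i = w i")
      case True
      then have "(\<lambda>j. if j \<in> insert i J then w' j else w j) = (\<lambda>j. if j \<in> J then w' j else w j)" by auto
      then show ?thesis by (simp add: weight_embeds_refl)
    next
      case False
      then have "w' i = - w i" using assms[of i] by linarith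
      then have "(\<lambda>j. if j \<in> insert i J then w' j else w j) = (\<lambda>j. if j \<in> J then w' j else w j)(i := - (\<lambda>j. if j \<in> J then w' j else w j) i)"
        using insert by auto
      then show ?thesis by (rule ssubst) (rule weight_embeds_flip)
    qed
    with insert show ?case using weight_embeds_trans by blast
  qed (auto intro: weight_embeds_refl)
  from this[of UNIV] show ?thesis by simp
qed

text \<open>Unit shifts move a nonnegative weight onto the single coordinate \<open>i\<close>. Every
  shift can be undone, since its target again meets the sign conditions of
  \<open>weight_embeds_shift\<close>. The resulting normal form depends on the sum only.\<close>

lemma weight_embeds_collect:
  fixes w :: "'n::finite \<Rightarrow> int"
  assumes "\<And>j. w j \<ge> 0"
  shows "weight_embeds lam w (\<lambda>j. if j = i then (\<Sum>k\<in>UNIV. w k) else 0) \<and> weight_embeds lam (\<lambda>j. if j = i then (\<Sum>k\<in>UNIV. w k) else 0) w"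
  using assms
proof (induction "nat (\<Sum>k\<in>UNIV - {i}. w k)" arbitrary: w rule: less_induct)
  case less
  have split: "(\<Sum>k\<in>UNIV. v k) = v i + (\<Sum>k\<in>UNIV - {i}. v k)" for v :: "'n \<Rightarrow> int"
    by (rule sum.remove) auto
  show ?case
  proof (cases "\<forall>j. j \<noteq> i \<longrightarrow> w j = 0")
    case True
    then have "w = (\<lambda>j. if j = i then (\<Sum>k\<in>UNIV. w k) else 0)" unfolding split by auto
    then show ?thesis using weight_embeds_refl by metis
  next
    case False
    then obtain j where j: "j \<noteq> i" "w j \<noteq> 0" by blast
    then have wj: "w j \<ge> 1" using less.prems[of j] by linarith
    define v where "v = w(j := w j - 1, i := w i + 1)"
    have v: "v k \<ge> 0" for k using less.prems wj by (simp add: v_def)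
    have s: "(\<Sum>k\<in>UNIV - {i}. v k) = (\<Sum>k\<in>UNIV - {i}. w k) - 1"
    proof -
      have "(\<Sum>k\<in>UNIV - {i}. v k) = v j + (\<Sum>k\<in>UNIV - {i} - {j}. v k)" using j by (intro sum.remove) auto
      also have "(\<Sum>k\<in>UNIV - {i} - {j}. v k) = (\<Sum>k\<in>UNIV - {i} - {j}. w k)" by (rule sum.cong) (auto simp: v_def)
      also have "v j = w j - 1" using j by (simp add: v_def)
      finally show ?thesis using sum.remove[of "UNIV - {i}" j w] j by simp
    qed
    have pos: "(\<Sum>k\<in>UNIV - {i}. v k) \<ge> 0" by (intro sum_nonneg v)
    then have lt: "nat (\<Sum>k\<in>UNIV - {i}. v k) < nat (\<Sum>k\<in>UNIV - {i}. w k)" using s by simp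
    have tot: "(\<Sum>k\<in>UNIV. v k) = (\<Sum>k\<in>UNIV. w k)" unfolding split[of v] split[of w] s by (simp add: v_def)
    have wv: "weight_embeds lam w v" unfolding v_def using weight_embeds_shift[of j i w] j wj less.prems by simp
    have "weight_embeds lam v (v(i := v i - 1, j := v j + 1))" using weight_embeds_shift[of i j v] j v wj less.prems[of i] by (simp add: v_def)
    also have "v(i := v i - 1, j := v j + 1) = w" using j by (auto simp: v_def)
    finally have vw: "weight_embeds lam v w" .
    show ?thesis using less.hyps[OF lt v] wv vw weight_embeds_trans unfolding tot by blast
  qed
qed

lemma weight_embeds_norm:
  fixes w w' :: "'n::finite \<Rightarrow> int"
  assumes "(\<Sum>j\<in>UNIV. \<bar>w j\<bar>) = (\<Sum>j\<in>UNIV. \<bar>w' j\<bar>)"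
  shows "weight_embeds lam w w'"
proof -
  obtain i :: 'n where True by blast
  have "weight_embeds lam w (\<lambda>j. \<bar>w j\<bar>)" "weight_embeds lam (\<lambda>j. \<bar>w' j\<bar>) w'" by (rule weight_embeds_signs; simp)+
  moreover have "weight_embeds lam (\<lambda>j. \<bar>w j\<bar>) (\<lambda>j. if j = i then (\<Sum>k\<in>UNIV. \<bar>w k\<bar>) else 0)"
      "weight_embeds lam (\<lambda>j. if j = i then (\<Sum>k\<in>UNIV. \<bar>w k\<bar>) else 0) (\<lambda>j. \<bar>w' j\<bar>)"
    using weight_embeds_collect[of "\<lambda>j. \<bar>w j\<bar>" lam i] weight_embeds_collect[of "\<lambda>j. \<bar>w' j\<bar>" lam i] unfolding assms by auto
  ultimately show ?thesis using weight_embeds_trans by blast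
qed

section \<open>Comparing dimensions of eigenspaces\<close>

text \<open>Replaces finite-dimensionality of the eigenspaces: on the span of finitely many functions,
  finitely many weights already separate.\<close>
lemma finite_separation:
  fixes Z :: "'w \<Rightarrow> ('b \<Rightarrow> complex) \<Rightarrow> bool"
  assumes "finite B"
    and "\<And>w c c' a a'. Z w c \<Longrightarrow> Z w c' \<Longrightarrow> Z w (\<lambda>b. a * c b + a' * c' b)"
    and "\<And>w c c'. (\<And>b. b \<in> B \<Longrightarrow> c b = c' b) \<Longrightarrow> Z w c \<Longrightarrow> Z w c'"
    and "\<And>c. (\<And>w. Z w c) \<Longrightarrow> \<forall>b\<in>B. c b = 0"
  shows "\<exists>W. finite W \<and> (\<forall>c. (\<forall>w\<in>W. Z w c) \<longrightarrow> (\<forall>b\<in>B. c b = 0))"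
  using assms
proof (induction B arbitrary: Z rule: finite_induct)
  case empty
  then show ?case by auto
next
  case (insert b B)
  note lin = insert.prems(1) and cong = insert.prems(2) and sep = insert.prems(3)
  define Z' where "Z' w c = Z w (c(b := 0))" for w and c :: "'b \<Rightarrow> complex"
  have "\<exists>W. finite W \<and> (\<forall>c. (\<forall>w\<in>W. Z' w c) \<longrightarrow> (\<forall>b\<in>B. c b = 0))"
  proof (rule insert.IH)
    show "Z' w (\<lambda>b. a * c b + a' * c' b)" if "Z' w c" "Z' w c'" for w c c' a a'
    proof -
      have "(\<lambda>x. a * (c(b := 0)) x + a' * (c'(b := 0)) x) = (\<lambda>b. a * c b + a' * c' b)(b := 0)" by auto
      then show ?thesis using lin[OF that[unfolded Z'_def], of a a'] by (simp add: Z'_def)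
    qed
    show "Z' w c'" if "\<And>b. b \<in> B \<Longrightarrow> c b = c' b" "Z' w c" for w c c'
      unfolding Z'_def by (rule cong[OF _ that(2)[unfolded Z'_def]]) (use that(1) in auto)
    show "\<forall>b\<in>B. c b = 0" if "\<And>w. Z' w c" for c
      using sep[of "c(b := 0)"] that insert.hyps unfolding Z'_def by (metis fun_upd_other insertI2)
  qed
  then obtain W0 where W0: "finite W0" "\<And>c. (\<forall>w\<in>W0. Z' w c) \<Longrightarrow> \<forall>b\<in>B. c b = 0" by blast
  show ?case
  proof (cases "\<forall>c. (\<forall>w\<in>W0. Z w c) \<longrightarrow> (\<forall>b\<in>insert b B. c b = 0)")
    case True
    then show ?thesis using W0 by blast
  next
    case False
    then obtain c0 where c0: "\<forall>w\<in>W0. Z w c0" "\<not> (\<forall>b\<in>insert b B. c0 b = 0)" by blast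
    have c0b: "c0 b \<noteq> 0"
    proof
      assume "c0 b = 0"
      then have "c0(b := 0) = c0" by auto
      then have "\<forall>w\<in>W0. Z' w c0" using c0 by (simp add: Z'_def)
      then show False using W0(2)[of c0] c0(2) \<open>c0 b = 0\<close> by auto
    qed
    \<comment> \<open>\<open>W0\<close> leaves at most the line spanned by \<open>c0\<close>; one
      more weight that does not annihilate \<open>c0\<close> reduces it to zero.\<close>
    obtain w1 where w1: "\<not> Z w1 c0" using sep[of c0] c0(2) by blast
    have "\<forall>x\<in>insert b B. c x = 0" if c: "\<forall>w\<in>insert w1 W0. Z w c" for c
    proof -
      define m where "m = c b / c0 b"
      define d where "d x = 1 * c x + (- m) * c0 x" for x
      have "\<forall>w\<in>W0. Z w d" unfolding d_def using c c0(1) lin by blast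
      moreover have "d(b := 0) = d" using c0b by (auto simp: d_def m_def)
      ultimately have "\<forall>x\<in>B. d x = 0" using W0(2)[of d] by (simp add: Z'_def)
      then have cd: "c x = m * c0 x" if "x \<in> insert b B" for x using that c0b by (auto simp: d_def m_def)
      have "m = 0"
      proof (rule ccontr)
        assume m: "m \<noteq> 0"
        have "Z w1 (\<lambda>x. (1 / m) * c x + 0 * c x)" using c lin by blast
        then have "Z w1 c0" by (rule cong[rotated]) (use cd m in simp)
        then show False using w1 by simp
      qed
      then show ?thesis using cd by simp
    qed
    then show ?thesis using W0(1) by (intro exI[of _ "insert w1 W0"]) auto
  qed
qed

lemma sum_apply: "(\<Sum>i\<in>I. f i) x = (\<Sum>i\<in>I. f i x :: complex)"
  by (induction I rule: infinite_finite_induct) auto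

interpretation cfun: vector_space "\<lambda>(c::complex) f x. c * f x :: complex"
  by unfold_locales (auto simp: fun_eq_iff algebra_simps)

text \<open>Return from complex to real functions: the \<open>P f\<close> lie in the complex span of
  their real and imaginary parts, so a maximal independent subset of those parts has at least as
  many members as \<open>B\<close>.\<close>

lemma real_imag_extraction:
  fixes P :: "'b \<Rightarrow> 'a \<Rightarrow> complex"
  assumes B: "finite B" and ind: "\<And>c. (\<And>x. (\<Sum>f\<in>B. c f * P f x) = 0) \<Longrightarrow> \<forall>f\<in>B. c f = 0"
  shows "\<exists>R \<subseteq> (\<lambda>f x. complex_of_real (Re (P f x))) ` B \<union> (\<lambda>f x. complex_of_real (Im (P f x))) ` B.
     finite R \<and> card B \<le> card R \<and> (\<forall>c. (\<forall>x. (\<Sum>r\<in>R. c r * r x) = 0) \<longrightarrow> (\<forall>r\<in>R. c r = 0))"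
proof -
  let ?S = "(\<lambda>f x. complex_of_real (Re (P f x))) ` B \<union> (\<lambda>f x. complex_of_real (Im (P f x))) ` B :: ('a \<Rightarrow> complex) set"
  have inj: "inj_on P B"
  proof (rule inj_onI, rule ccontr)
    fix f g assume fg: "f \<in> B" "g \<in> B" "P f = P g" "f \<noteq> g"
    define c where "c h = (if h = f then 1 else if h = g then -1 else 0 :: complex)" for h
    have "(\<Sum>h\<in>B. c h * P h x) = 0" for x
    proof -
      have "(\<Sum>h\<in>B. c h * P h x) = (\<Sum>h\<in>B. (if h = f then P f x else 0) + (if h = g then - P g x else 0))"
        using fg by (intro sum.cong) (auto simp: c_def)
      also have "\<dots> = 0" using fg B by (simp add: sum.distrib)
      finally show ?thesis .
    qed
    from ind[OF this] fg show False by (auto simp: c_def)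
  qed
  have indP: "cfun.independent (P ` B)"
  proof (rule cfun.independent_if_scalars_zero)
    show "finite (P ` B)" using B by simp
    fix c F assume "(\<Sum>F\<in>P ` B. (\<lambda>x. c F * F x)) = 0" "F \<in> P ` B"
    then have "(\<Sum>f\<in>B. c (P f) * P f x) = 0" for x
      by (simp add: sum.reindex[OF inj] fun_eq_iff sum_apply)
    from ind[OF this] \<open>F \<in> P ` B\<close> show "c F = 0" by auto
  qed
  obtain R where R: "R \<subseteq> ?S" "cfun.independent R" "?S \<subseteq> cfun.span R"
    by (rule cfun.maximal_independent_subset)
  have finR: "finite R" using R(1) B by (meson finite_UnI finite_imageI finite_subset)
  have "P f \<in> cfun.span R" if "f \<in> B" for f
  proof -
    have "(\<lambda>x. of_real (Re (P f x))) \<in> cfun.span R" "(\<lambda>x. of_real (Im (P f x))) \<in> cfun.span R"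
      using R(3) that by auto
    from cfun.span_add[OF this(1) cfun.span_scale[OF this(2), of \<i>]]
    show ?thesis by (simp add: plus_fun_def complex_eq[symmetric])
  qed
  then have "card (P ` B) \<le> card R" using cfun.independent_span_bound[OF finR indP] by blast
  moreover have "\<forall>r\<in>R. c r = 0" if "\<forall>x. (\<Sum>r\<in>R. c r * r x) = 0" for c
  proof -
    have "(\<Sum>r\<in>R. (\<lambda>x. c r * r x)) = 0" using that by (simp add: fun_eq_iff sum_apply)
    then show ?thesis using cfun.independentD[OF R(2) finR subset_refl] by blast
  qed
  ultimately show ?thesis using R(1) finR card_image[OF inj] by (intro exI[of _ R]) auto
qed

definition clinear_on :: "('a \<Rightarrow> complex) set \<Rightarrow> (('a \<Rightarrow> complex) \<Rightarrow> 'c \<Rightarrow> complex) \<Rightarrow> bool" where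
  "clinear_on V T \<longleftrightarrow> (\<lambda>z. 0) \<in> V \<and> (\<forall>F\<in>V. \<forall>G\<in>V. \<forall>a b. (\<lambda>z. a * F z + b * G z) \<in> V \<and>
      T (\<lambda>z. a * F z + b * G z) = (\<lambda>z. a * T F z + b * T G z))"

lemma clinear_on_sum:
  assumes T: "clinear_on V T" and G: "\<And>f. f \<in> B \<Longrightarrow> G f \<in> V"
  shows "(\<lambda>z. \<Sum>f\<in>B. c f * G f z) \<in> V" "T (\<lambda>z. \<Sum>f\<in>B. c f * G f z) = (\<lambda>z. \<Sum>f\<in>B. c f * T (G f) z)"
proof -
  have z: "(\<lambda>z. 0) \<in> V" and l: "\<And>F G a b. F \<in> V \<Longrightarrow> G \<in> V \<Longrightarrow> (\<lambda>z. a * F z + b * G z) \<in> V"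
    "\<And>F G a b. F \<in> V \<Longrightarrow> G \<in> V \<Longrightarrow> T (\<lambda>z. a * F z + b * G z) = (\<lambda>z. a * T F z + b * T G z)"
    using T unfolding clinear_on_def by blast+
  have T0: "T (\<lambda>z. 0) = (\<lambda>z. 0)" using l(2)[OF z z, of 0 0] by simp
  have "(\<lambda>z. \<Sum>f\<in>B. c f * G f z) \<in> V \<and> T (\<lambda>z. \<Sum>f\<in>B. c f * G f z) = (\<lambda>z. \<Sum>f\<in>B. c f * T (G f) z)"
    using G
  proof (induction B rule: infinite_finite_induct)
    case (insert b B)
    then have "(\<lambda>z. c b * G b z + 1 * (\<Sum>f\<in>B. c f * G f z)) \<in> V \<and>
       T (\<lambda>z. c b * G b z + 1 * (\<Sum>f\<in>B. c f * G f z)) = (\<lambda>z. c b * T (G b) z + 1 * T (\<lambda>z. \<Sum>f\<in>B. c f * G f z) z)"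
      by (intro conjI l) auto
    then show ?case using insert by auto
  qed (simp_all add: z T0)
  then show "(\<lambda>z. \<Sum>f\<in>B. c f * G f z) \<in> V" "T (\<lambda>z. \<Sum>f\<in>B. c f * G f z) = (\<lambda>z. \<Sum>f\<in>B. c f * T (G f) z)" by auto
qed

lemma hom_eig_zero: "(\<lambda>x. 0 :: real) \<in> hom_eig lam"
  by (simp add: hom_eig_def smooth_on_const eucl_laplacian_def dirderiv_def)

lemma ceig_zero_fun: "(\<lambda>x. 0) \<in> ceig lam"
  by (simp add: ceig_def hom_eig_zero)

lemma wt_zero_fun: "(\<lambda>x. 0) \<in> wt lam w"
  by (simp add: wt_def ceig_zero_fun)

lemma clinear_on_wproj: "clinear_on (ceig lam) (wproj w)"
  unfolding clinear_on_def using ceig_zero_fun ceig_lincomb wproj_lincomb by blast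

section \<open>From eigenfunctions on the sphere to homogeneous functions\<close>

lemma dirderiv_scale_vec:
  assumes "open S" "smooth_on S F" "x \<in> S"
  shows "dirderiv F (c *\<^sub>R v) x = c * dirderiv F v x"
  using linear_scale[OF dirderiv_linear[OF assms]] by simp

text \<open>Each derivative lowers the degree of homogeneity by one, starting from degree
  \<open>0\<close>.\<close>

lemma eucl_laplacian_homogeneous:
  fixes F :: "'a::euclidean_space \<Rightarrow> real"
  assumes F: "smooth_on (- {0}) F" "\<And>c x. c > 0 \<Longrightarrow> F (c *\<^sub>R x) = F x" and c: "c > 0" and x: "x \<noteq> 0"
  shows "eucl_laplacian F (c *\<^sub>R x) = eucl_laplacian F x / c\<^sup>2"
proof -
  have cx: "c *\<^sub>R y \<in> - {0}" if "y \<noteq> 0" for y :: 'a using c that by simp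
  have 1: "dirderiv F v (c *\<^sub>R y) = (1 / c) * dirderiv F v y" if "y \<noteq> 0" for y v
    using dirderiv_homogeneous[OF F c, of v y] dirderiv_scale_vec[OF open_Compl_0 F(1) cx[OF that], of c v] c
    by (simp add: field_simps)
  have "dirderiv (dirderiv F v) v (c *\<^sub>R x) = dirderiv (dirderiv F v) v x / c\<^sup>2" for v
  proof -
    note sd = smooth_on_dirderiv[OF open_Compl_0 F(1), of v]
    have "c * dirderiv (dirderiv F v) v (c *\<^sub>R x) = dirderiv (dirderiv F v) (c *\<^sub>R v) (c *\<^sub>R x)"
      by (rule dirderiv_scale_vec[OF open_Compl_0 sd cx[OF x], symmetric])
    also have "\<dots> = dirderiv (\<lambda>y. dirderiv F v (c *\<^sub>R y)) v x"
      by (rule dirderiv_compose_linear[OF open_Compl_0 bounded_linear_scaleR_right cx[OF x] sd, symmetric])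
    also have "\<dots> = dirderiv (\<lambda>y. (1 / c) * dirderiv F v y + 0 * dirderiv F v y) v x"
      by (rule dirderiv_cong[OF open_Compl_0, symmetric])
        (use x 1 smooth_on_lincomb[OF open_Compl_0 sd sd, of "1 / c" 0] in auto)
    also have "\<dots> = (1 / c) * dirderiv (dirderiv F v) v x"
      by (subst dirderiv_lincomb[OF open_Compl_0 _ sd sd]) (use x in auto)
    finally show ?thesis using c by (simp add: field_simps power2_eq_square)
  qed
  then show ?thesis by (simp add: eucl_laplacian_def sum_divide_distrib)
qed

text \<open>Homogeneity of degree \<open>-2\<close> of the Laplacian spreads the eigenvalue equation
  from the sphere to all nonzero points, and invariance under the generator gives invariance under
  its powers.\<close>

lemma lens_eigenspace_iff:
  fixes f :: "(real^'n::finite) \<times> (real^'n) \<Rightarrow> real"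
  shows "f \<in> lens_eigenspace q p lam \<longleftrightarrow> (\<forall>x. x \<notin> sphere 0 1 \<longrightarrow> f x = 0) \<and> radial_ext f \<in> hom_eig lam \<and>
     (\<forall>x. radial_ext f (lens_gen q p x) = radial_ext f x)"
proof -
  have hom: "radial_ext f (c *\<^sub>R x) = radial_ext f x" if "c > 0" for c x
    using that by (simp add: radial_ext_def)
  have on: "radial_ext f x = f x" if "x \<in> sphere 0 1" for x using that by (simp add: radial_ext_def)
  have h0: "radial_ext f 0 = 0" if "\<forall>x. x \<notin> sphere 0 1 \<longrightarrow> f x = 0"
    using that[rule_format, of 0] by (simp add: radial_ext_def)
  have gn: "norm (lens_gen q p x) = norm x" for x
    unfolding lens_gen_rot using orthogonal_transformation_norm[OF orthogonal_rot] by blast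
  have gs: "lens_gen q p (c *\<^sub>R x) = c *\<^sub>R lens_gen q p x" for c x
    unfolding lens_gen_rot by (rule linear_scale[OF linear_rot])
  have inv: "(\<forall>h\<in>lens_group q p. \<forall>x\<in>sphere 0 1. f (h x) = f x) \<longleftrightarrow> (\<forall>x. radial_ext f (lens_gen q p x) = radial_ext f x)"
  proof
    assume a: "\<forall>h\<in>lens_group q p. \<forall>x\<in>sphere 0 1. f (h x) = f x"
    have g: "lens_gen q p \<in> lens_group q p" unfolding lens_group_def by (rule CollectI, rule exI[of _ 1]) simp
    show "\<forall>x. radial_ext f (lens_gen q p x) = radial_ext f x"
    proof
      fix x
      show "radial_ext f (lens_gen q p x) = radial_ext f x"
      proof (cases "x = 0")
        case True
        then show ?thesis by (simp add: lens_gen_rot rot_eq_0[THEN iffD2])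
      next
        case False
        then have "(1 / norm x) *\<^sub>R x \<in> sphere 0 1" by simp
        then show ?thesis using a g unfolding radial_ext_def gn gs[symmetric] by blast
      qed
    qed
  next
    assume a: "\<forall>x. radial_ext f (lens_gen q p x) = radial_ext f x"
    have "norm ((lens_gen q p ^^ k) x) = norm x \<and> radial_ext f ((lens_gen q p ^^ k) x) = radial_ext f x" for k x
      by (induction k) (simp_all add: gn a)
    then have "f ((lens_gen q p ^^ k) x) = f x" if "x \<in> sphere 0 1" for k x
      using on[of "(lens_gen q p ^^ k) x"] on[OF that] that by simp
    then show "\<forall>h\<in>lens_group q p. \<forall>x\<in>sphere 0 1. f (h x) = f x"
      unfolding lens_group_def by blast
  qed
  have eig: "(\<forall>x\<in>sphere 0 1. - eucl_laplacian (radial_ext f) x = lam * f x) \<longleftrightarrow>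
      (\<forall>x. x \<noteq> 0 \<longrightarrow> (x \<bullet> x) * eucl_laplacian (radial_ext f) x = - lam * radial_ext f x)"
    if sm: "smooth_on (- {0}) (radial_ext f)"
  proof
    assume a: "\<forall>x\<in>sphere 0 1. - eucl_laplacian (radial_ext f) x = lam * f x"
    show "\<forall>x. x \<noteq> 0 \<longrightarrow> (x \<bullet> x) * eucl_laplacian (radial_ext f) x = - lam * radial_ext f x"
    proof (intro allI impI)
      fix x :: "(real^'n) \<times> (real^'n)" assume x: "x \<noteq> 0"
      define y where "y = (1 / norm x) *\<^sub>R x"
      have y: "y \<in> sphere 0 1" "y \<noteq> 0" "x = norm x *\<^sub>R y" using x by (auto simp: y_def)
      have "eucl_laplacian (radial_ext f) x = eucl_laplacian (radial_ext f) y / (norm x)\<^sup>2"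
        using eucl_laplacian_homogeneous[OF sm hom _ y(2), of "norm x"] x y(3) by simp
      moreover have "radial_ext f x = f y" by (simp add: radial_ext_def y_def)
      moreover have "eucl_laplacian (radial_ext f) y = - lam * f y" using a y(1) by force
      ultimately show "(x \<bullet> x) * eucl_laplacian (radial_ext f) x = - lam * radial_ext f x"
        using x by (simp add: power2_norm_eq_inner)
    qed
  next
    assume a: "\<forall>x. x \<noteq> 0 \<longrightarrow> (x \<bullet> x) * eucl_laplacian (radial_ext f) x = - lam * radial_ext f x"
    show "\<forall>x\<in>sphere 0 1. - eucl_laplacian (radial_ext f) x = lam * f x"
    proof
      fix x :: "(real^'n) \<times> (real^'n)" assume x: "x \<in> sphere 0 1"
      then have "x \<noteq> 0" "x \<bullet> x = 1" by (auto simp: power2_norm_eq_inner[symmetric])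
      then show "- eucl_laplacian (radial_ext f) x = lam * f x"
        using a[rule_format, of x] on[OF x] by simp
    qed
  qed
  show ?thesis
    unfolding lens_eigenspace_def mem_Collect_eq inv hom_eig_def using eig hom h0 by blast
qed

text \<open>The torus weights that are trivial on the group. A nonzero function of weight
  \<open>w\<close> is invariant exactly when \<open>w\<close> lies here; see
  \<open>wt_invariant\<close> and \<open>wt_not_invariant\<close>.\<close>

definition congruence_lattice :: "nat \<Rightarrow> ('n::finite \<Rightarrow> int) \<Rightarrow> ('n \<Rightarrow> int) set" where
  "congruence_lattice q p = {w. int q dvd (\<Sum>j\<in>UNIV. w j * p j)}"

lemma cis_2pi_div: "q > 0 \<Longrightarrow> cis (2 * pi * of_int k / real q) = 1 \<longleftrightarrow> int q dvd k"
proof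
  assume q: "q > 0" and "cis (2 * pi * of_int k / real q) = 1"
  then have "cos (2 * pi * of_int k / real q) = 1" by (simp add: complex_eq_iff)
  then obtain n :: int where "2 * pi * of_int k / real q = of_int n * 2 * pi" by (auto simp: cos_one_2pi_int)
  then have "of_int k = (of_int (n * int q) :: real)" using q by (simp add: field_simps)
  then show "int q dvd k" by (metis dvd_triv_right of_int_eq_iff)
next
  assume q: "q > 0" and "int q dvd k"
  then obtain n where "k = int q * n" by (elim dvdE)
  then have "2 * pi * of_int k / real q = 2 * pi * of_int n" using q by simp
  then show "cis (2 * pi * of_int k / real q) = 1" using cis_multiple_2pi[of "of_int n"] by simp
qed

lemma wdot_lens: "wdot w (\<lambda>j. 2 * pi * real_of_int (p j) / real q) = 2 * pi * of_int (\<Sum>j\<in>UNIV. w j * p j) / real q"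
  by (simp add: wdot_def sum_distrib_left sum_divide_distrib algebra_simps)

lemma wt_invariant:
  assumes "q > 0" "F \<in> wt lam w" "w \<in> congruence_lattice q p"
  shows "F (lens_gen q p z) = F z"
proof -
  have "cis (2 * pi * of_int (\<Sum>j\<in>UNIV. w j * p j) / real q) = 1"
    using assms(3) cis_2pi_div[OF assms(1)] unfolding congruence_lattice_def by blast
  then show ?thesis by (simp only: lens_gen_rot wtD(2)[OF assms(2)] wdot_lens mult_1)
qed

lemma wt_not_invariant:
  assumes "q > 0" "F \<in> wt lam w" "w \<notin> congruence_lattice q p" "\<And>z. F (lens_gen q p z) = F z"
  shows "F = (\<lambda>z. 0)"
proof
  fix z
  have "F z = cis (2 * pi * of_int (\<Sum>j\<in>UNIV. w j * p j) / real q) * F z"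
    using wtD(2)[OF assms(2), of "\<lambda>j. 2 * pi * real_of_int (p j) / real q" z] assms(4)[of z]
    unfolding lens_gen_rot wdot_lens by simp
  then show "F z = 0" using assms(1,3) cis_2pi_div[OF assms(1), of "\<Sum>j\<in>UNIV. w j * p j"]
    by (auto simp: congruence_lattice_def)
qed

text \<open>Suprema over finite independent sets are compared set by set, so the argument also makes
  sense for values that are a priori infinite.\<close>

lemma fun_dim_le:
  assumes "\<And>B. finite B \<Longrightarrow> B \<subseteq> V \<Longrightarrow> fun_lin_indep B \<Longrightarrow> \<exists>B'. finite B' \<and> B' \<subseteq> V' \<and> fun_lin_indep B' \<and> card B \<le> card B'"
  shows "fun_dim V \<le> fun_dim V'"
  unfolding fun_dim_def
proof (rule Sup_least)
  fix n assume "n \<in> {enat (card B) |B. finite B \<and> B \<subseteq> V \<and> fun_lin_indep B}"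
  then obtain B where "n = enat (card B)" "finite B" "B \<subseteq> V" "fun_lin_indep B" by auto
  moreover from assms[OF this(2-4)] obtain B' where "finite B' \<and> B' \<subseteq> V' \<and> fun_lin_indep B' \<and> card B \<le> card B'" by blast
  ultimately show "n \<le> Sup {enat (card B) |B. finite B \<and> B \<subseteq> V' \<and> fun_lin_indep B}"
    by (intro Sup_upper2[of "enat (card B')"]) auto
qed

lemma real_family_in_eigenspace:
  fixes R :: "((real^'n::finite) \<times> (real^'n) \<Rightarrow> complex) set"
  assumes fin: "finite R" and ind: "\<And>c. (\<forall>x. (\<Sum>r\<in>R. c r * r x) = 0) \<Longrightarrow> \<forall>r\<in>R. c r = 0"
    and R: "\<And>r. r \<in> R \<Longrightarrow> \<exists>F\<in>hom_eig lam. (\<forall>x. F (lens_gen q p x) = F x) \<and> r = (\<lambda>x. of_real (F x))"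
  shows "\<exists>B. finite B \<and> B \<subseteq> lens_eigenspace q p lam \<and> fun_lin_indep B \<and> card R \<le> card B"
proof -
  define g where "g r x = (if x \<in> sphere 0 1 then Re (r x) else 0)" for r :: "(real^'n) \<times> (real^'n) \<Rightarrow> complex" and x
  have rep: "of_real (radial_ext (g r) x) = r x \<and> radial_ext (g r) = (\<lambda>x. Re (r x)) \<and> g r \<in> lens_eigenspace q p lam" if r: "r \<in> R" for r x
  proof -
    obtain F where F: "F \<in> hom_eig lam" "\<And>x. F (lens_gen q p x) = F x" "r = (\<lambda>x. of_real (F x))" using R[OF r] by blast
    have "radial_ext (g r) x = F x" for x
    proof (cases "x = 0")
      case True
      then show ?thesis using hom_eigD(1)[OF F(1)] by (simp add: radial_ext_def g_def)
    next
      case False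
      then have "F ((1 / norm x) *\<^sub>R x) = F x" by (intro hom_eigD(2)[OF F(1)]) simp
      then show ?thesis using False by (simp add: radial_ext_def g_def F(3))
    qed
    then have "radial_ext (g r) = F" by auto
    then show ?thesis using F by (auto simp: lens_eigenspace_iff g_def)
  qed
  have inj: "inj_on g R"
  proof (rule inj_onI)
    fix r r' assume r: "r \<in> R" "r' \<in> R" "g r = g r'"
    show "r = r'"
    proof
      fix x show "r x = r' x" using rep[OF r(1), of x] rep[OF r(2), of x] r(3) by metis
    qed
  qed
  have "fun_lin_indep (g ` R)"
    unfolding fun_lin_indep_def
  proof (intro allI impI)
    fix c assume a: "\<forall>x. (\<Sum>f\<in>g ` R. c f * f x) = 0"
    have "(\<Sum>r\<in>R. of_real (c (g r)) * r x) = 0" for x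
    proof -
      have "(\<Sum>r\<in>R. of_real (c (g r)) * r x) = (\<Sum>r\<in>R. of_real (c (g r)) * of_real (radial_ext (g r) x))"
        by (intro sum.cong refl) (simp only: rep[THEN conjunct1])
      also have "\<dots> = of_real (\<Sum>r\<in>R. c (g r) * g r ((1 / norm x) *\<^sub>R x))" by (simp add: radial_ext_def)
      also have "\<dots> = 0" using a[THEN spec, of "(1 / norm x) *\<^sub>R x"] by (simp add: sum.reindex[OF inj] del: of_real_sum)
      finally show ?thesis .
    qed
    then have "\<forall>r\<in>R. complex_of_real (c (g r)) = 0" using ind[of "\<lambda>r. of_real (c (g r))"] by blast
    then show "\<forall>f\<in>g ` R. c f = 0" by auto
  qed
  then show ?thesis using fin rep card_image[OF inj] by (intro exI[of _ "g ` R"]) auto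
qed

text \<open>Finitely many lattice weights separate the complex span of \<open>B\<close>. Each weight
  component is moved injectively into the weight space of \<open>\<beta> w\<close>, and the results
  are added. As \<open>\<beta>\<close> is injective, components of different weight stay in
  different weight spaces and cannot cancel, so independence survives. Real and imaginary parts then
  give a real family of at least the same size.\<close>

lemma fun_dim_lens_eigenspace_le:
  fixes p s :: "'n::finite \<Rightarrow> int"
  assumes q: "q > 0"
    and \<beta>: "\<And>w. w \<in> congruence_lattice q p \<Longrightarrow> \<beta> w \<in> congruence_lattice q s"
      "\<And>w. w \<in> congruence_lattice q p \<Longrightarrow> (\<Sum>j\<in>UNIV. \<bar>w j\<bar>) = (\<Sum>j\<in>UNIV. \<bar>\<beta> w j\<bar>)"
      "inj_on \<beta> (congruence_lattice q p)"
  shows "fun_dim (lens_eigenspace q p lam) \<le> fun_dim (lens_eigenspace q s lam)"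
proof (rule fun_dim_le)
  fix B assume B: "finite B" "B \<subseteq> lens_eigenspace q p lam" "fun_lin_indep B"
  define E where "E f x = complex_of_real (radial_ext f x)" for f and x :: "(real^'n) \<times> (real^'n)"
  have E: "E f \<in> ceig lam" "\<And>z. E f (lens_gen q p z) = E f z" if "f \<in> B" for f
    using that B(2) hom_eig_zero by (auto simp: lens_eigenspace_iff ceig_def E_def)
  define C where "C c = (\<lambda>z. \<Sum>f\<in>B. c f * E f z)" for c
  have C: "C c \<in> ceig lam" "C c (lens_gen q p z) = C c z" for c z
    using clinear_on_sum(1)[OF clinear_on_wproj, of B E] E by (simp_all add: C_def)
  have C0: "\<forall>f\<in>B. c f = 0" if c: "C c = (\<lambda>z. 0)" for c
  proof -
    have z: "(\<Sum>f\<in>B. c f * of_real (f x)) = 0" for x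
    proof (cases "x \<in> sphere 0 1")
      case True
      then show ?thesis using fun_cong[OF c, of x] by (simp add: C_def E_def radial_ext_def)
    next
      case False
      have fx: "f x = 0" if "f \<in> B" for f
        using subsetD[OF B(2) that] False unfolding lens_eigenspace_iff by blast
      show ?thesis by (rule sum.neutral) (use fx in auto)
    qed
    have "(\<Sum>f\<in>B. Re (c f) * f x) = 0" "(\<Sum>f\<in>B. Im (c f) * f x) = 0" for x
      using arg_cong[OF z[of x], of Re] arg_cong[OF z[of x], of Im] by simp_all
    then have "\<forall>f\<in>B. Re (c f) = 0" "\<forall>f\<in>B. Im (c f) = 0"
      using B(3)[unfolded fun_lin_indep_def, THEN spec, of "\<lambda>f. Re (c f)"]
        B(3)[unfolded fun_lin_indep_def, THEN spec, of "\<lambda>f. Im (c f)"] by blast+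
    then show ?thesis by (simp add: complex_eq_iff)
  qed
  have wC: "wproj w (C c) = (\<lambda>z. \<Sum>f\<in>B. c f * wproj w (E f) z)" for w c
    unfolding C_def by (rule clinear_on_sum(2)[OF clinear_on_wproj E(1)])
  have "\<exists>W. finite W \<and> (\<forall>c. (\<forall>w\<in>W. wproj w (C c) = (\<lambda>z. 0)) \<longrightarrow> (\<forall>f\<in>B. c f = 0))"
  proof (rule finite_separation[OF B(1)])
    show "wproj w (C (\<lambda>b. a * c b + a' * c' b)) = (\<lambda>z. 0)"
      if "wproj w (C c) = (\<lambda>z. 0)" "wproj w (C c') = (\<lambda>z. 0)" for w c c' a a'
    proof
      fix z
      have "wproj w (C (\<lambda>b. a * c b + a' * c' b)) z = a * wproj w (C c) z + a' * wproj w (C c') z"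
        unfolding wC by (simp add: sum_distrib_left sum.distrib algebra_simps)
      then show "wproj w (C (\<lambda>b. a * c b + a' * c' b)) z = 0" using that by simp
    qed
    show "wproj w (C c') = (\<lambda>z. 0)" if "\<And>b. b \<in> B \<Longrightarrow> c b = c' b" "wproj w (C c) = (\<lambda>z. 0)" for w c c'
    proof -
      have "C c = C c'" unfolding C_def using that(1) by (auto intro!: sum.cong ext)
      then show ?thesis using that(2) by simp
    qed
    show "\<forall>b\<in>B. c b = 0" if "\<And>w. wproj w (C c) = (\<lambda>z. 0)" for c
      using wproj_separates[OF C(1)] that C0 by blast
  qed
  then obtain W0 where W0: "finite W0" "\<And>c. (\<forall>w\<in>W0. wproj w (C c) = (\<lambda>z. 0)) \<Longrightarrow> \<forall>f\<in>B. c f = 0" by blast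
  \<comment> \<open>Invariant functions have no component outside the lattice, so discarding those
    weights loses no separation.\<close>
  define W where "W = W0 \<inter> congruence_lattice q p"
  have W: "finite W" "W \<subseteq> congruence_lattice q p" using W0 by (auto simp: W_def)
  have Wsep: "\<forall>f\<in>B. c f = 0" if "\<forall>w\<in>W. wproj w (C c) = (\<lambda>z. 0)" for c
  proof (rule W0(2), rule ballI)
    fix w assume "w \<in> W0"
    show "wproj w (C c) = (\<lambda>z. 0)"
    proof (cases "w \<in> congruence_lattice q p")
      case True
      then show ?thesis using that \<open>w \<in> W0\<close> by (auto simp: W_def)
    next
      case False
      show ?thesis
      proof (rule wt_not_invariant[OF q wproj_wt[OF C(1)] False])
        fix z show "wproj w (C c) (lens_gen q p z) = wproj w (C c) z"
          using wproj_eigen[of "C c" _ 1 w] C(2) unfolding lens_gen_rot by simp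
      qed
    qed
  qed
  have "\<exists>T. (\<forall>F\<in>wt lam w. T F \<in> wt lam (\<beta> w) \<and> (T F = (\<lambda>z. 0) \<longrightarrow> F = (\<lambda>z. 0))) \<and> clinear_on (wt lam w) T" if w: "w \<in> W" for w
  proof -
    have "weight_embeds lam w (\<beta> w)" using weight_embeds_norm[OF \<beta>(2)] w W(2) by blast
    then obtain T where "\<forall>F\<in>wt lam w. T F \<in> wt lam (\<beta> w) \<and> (T F = (\<lambda>z. 0) \<longrightarrow> F = (\<lambda>z. 0))"
      "\<forall>F\<in>wt lam w. \<forall>G\<in>wt lam w. \<forall>a b. T (\<lambda>z. a * F z + b * G z) = (\<lambda>z. a * T F z + b * T G z)"
      unfolding weight_embeds_def by blast
    then show ?thesis by (intro exI[of _ T]) (simp add: clinear_on_def wt_zero_fun wt_lincomb)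
  qed
  then have "\<forall>w\<in>W. \<exists>T. (\<forall>F\<in>wt lam w. T F \<in> wt lam (\<beta> w) \<and> (T F = (\<lambda>z. 0) \<longrightarrow> F = (\<lambda>z. 0))) \<and> clinear_on (wt lam w) T"
    by blast
  then obtain T where T0: "\<forall>w\<in>W. (\<forall>F\<in>wt lam w. T w F \<in> wt lam (\<beta> w) \<and> (T w F = (\<lambda>z. 0) \<longrightarrow> F = (\<lambda>z. 0))) \<and> clinear_on (wt lam w) (T w)"
    by (rule bchoice[THEN exE])
  have T: "\<And>w F. w \<in> W \<Longrightarrow> F \<in> wt lam w \<Longrightarrow> T w F \<in> wt lam (\<beta> w)"
      "\<And>w F. w \<in> W \<Longrightarrow> F \<in> wt lam w \<Longrightarrow> T w F = (\<lambda>z. 0) \<Longrightarrow> F = (\<lambda>z. 0)"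
      "\<And>w. w \<in> W \<Longrightarrow> clinear_on (wt lam w) (T w)" using T0 by blast+
  \<comment> \<open>The factor \<open>1\<close> fits the shape of
    \<open>clinear_on_sum\<close>.\<close>
  define P where "P f = (\<lambda>z. \<Sum>w\<in>W. 1 * T w (wproj w (E f)) z)" for f
  have TE: "T w (wproj w (E f)) \<in> wt lam (\<beta> w)" if "w \<in> W" "f \<in> B" for w f
    by (rule T(1)[OF that(1) wproj_wt[OF E(1)[OF that(2)]]])
  have Pceig: "P f \<in> ceig lam" if "f \<in> B" for f
    unfolding P_def by (rule clinear_on_sum(1)[OF clinear_on_wproj]) (rule wtD(1)[OF TE[OF _ that]])
  have Pinv: "P f (lens_gen q s z) = P f z" if "f \<in> B" for f z
    unfolding P_def
  proof (intro sum.cong refl)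
    fix w assume w: "w \<in> W"
    show "1 * T w (wproj w (E f)) (lens_gen q s z) = 1 * T w (wproj w (E f)) z"
      by (rule arg_cong[where f="\<lambda>x. 1 * x"], rule wt_invariant[OF q TE[OF w that] \<beta>(1)[OF subsetD[OF W(2) w]]])
  qed
  have indP: "\<forall>f\<in>B. c f = 0" if c: "\<And>x. (\<Sum>f\<in>B. c f * P f x) = 0" for c
  proof (rule Wsep, rule ballI)
    fix w0 assume w0: "w0 \<in> W"
    have TC: "T w (wproj w (C c)) = (\<lambda>z. \<Sum>f\<in>B. c f * T w (wproj w (E f)) z)" if "w \<in> W" for w
      unfolding wC by (rule clinear_on_sum(2)[OF T(3)[OF that] wproj_wt[OF E(1)]])
    have TCw: "T w (wproj w (C c)) \<in> wt lam (\<beta> w)" if "w \<in> W" for w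
      by (rule T(1)[OF that wproj_wt[OF C(1)]])
    have "(\<lambda>z. \<Sum>w\<in>W. 1 * T w (wproj w (C c)) z) = (\<lambda>z. 0)"
    proof
      fix z
      have "(\<Sum>w\<in>W. 1 * T w (wproj w (C c)) z) = (\<Sum>w\<in>W. \<Sum>f\<in>B. c f * T w (wproj w (E f)) z)"
        by (intro sum.cong refl) (simp add: TC)
      also have "\<dots> = (\<Sum>f\<in>B. c f * P f z)"
        unfolding P_def by (subst sum.swap) (simp add: sum_distrib_left)
      finally show "(\<Sum>w\<in>W. 1 * T w (wproj w (C c)) z) = 0" using c by simp
    qed
    \<comment> \<open>Projecting the vanishing sum onto the weight \<open>\<beta> w0\<close>
      isolates the component that comes from \<open>w0\<close>.\<close>
    then have "(\<lambda>z. 0) = wproj (\<beta> w0) (\<lambda>z. \<Sum>w\<in>W. 1 * T w (wproj w (C c)) z)"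
      using wproj_lincomb[OF ceig_zero_fun ceig_zero_fun, of "\<beta> w0" 0 0] by simp
    also have "\<dots> = (\<lambda>z. \<Sum>w\<in>W. 1 * wproj (\<beta> w0) (T w (wproj w (C c))) z)"
      by (rule clinear_on_sum(2)[OF clinear_on_wproj wtD(1)[OF TCw]])
    also have "\<dots> = (\<lambda>z. \<Sum>w\<in>W. if w = w0 then T w0 (wproj w0 (C c)) z else 0)"
    proof (intro ext sum.cong refl)
      fix z w assume w: "w \<in> W"
      have "\<beta> w0 = \<beta> w \<longleftrightarrow> w = w0" using \<beta>(3) w w0 W(2) unfolding inj_on_def by blast
      then show "1 * wproj (\<beta> w0) (T w (wproj w (C c))) z = (if w = w0 then T w0 (wproj w0 (C c)) z else 0)"
        using wproj_of_wt[OF TCw[OF w], of "\<beta> w0"] by auto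
    qed
    also have "\<dots> = T w0 (wproj w0 (C c))" using w0 W(1) by simp
    finally have "T w0 (wproj w0 (C c)) = (\<lambda>z. 0)" by (rule sym)
    then show "wproj w0 (C c) = (\<lambda>z. 0)" by (rule T(2)[OF w0 wproj_wt[OF C(1)]])
  qed
  have "\<exists>R \<subseteq> (\<lambda>f x. complex_of_real (Re (P f x))) ` B \<union> (\<lambda>f x. complex_of_real (Im (P f x))) ` B.
     finite R \<and> card B \<le> card R \<and> (\<forall>c. (\<forall>x. (\<Sum>r\<in>R. c r * r x) = 0) \<longrightarrow> (\<forall>r\<in>R. c r = 0))"
  proof (rule real_imag_extraction[OF B(1)])
    fix c assume "\<And>x. (\<Sum>f\<in>B. c f * P f x) = 0"
    then show "\<forall>f\<in>B. c f = 0" by (rule indP)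
  qed
  then obtain R where R: "R \<subseteq> (\<lambda>f x. complex_of_real (Re (P f x))) ` B \<union> (\<lambda>f x. complex_of_real (Im (P f x))) ` B"
     "finite R" "card B \<le> card R" "\<forall>c. (\<forall>x. (\<Sum>r\<in>R. c r * r x) = 0) \<longrightarrow> (\<forall>r\<in>R. c r = 0)"
    by (elim exE conjE)
  have "\<exists>B'. finite B' \<and> B' \<subseteq> lens_eigenspace q s lam \<and> fun_lin_indep B' \<and> card R \<le> card B'"
  proof (rule real_family_in_eigenspace[OF R(2) R(4)[THEN spec, THEN mp]])
    fix r assume "r \<in> R"
    then obtain f where f: "f \<in> B" "r = (\<lambda>x. of_real (Re (P f x))) \<or> r = (\<lambda>x. of_real (Im (P f x)))" using R(1) by blast
    have "(\<lambda>x. Re (P f x)) \<in> hom_eig lam" "(\<lambda>x. Im (P f x)) \<in> hom_eig lam" using Pceig[OF f(1)] by (auto simp: ceig_def)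
    then show "\<exists>F\<in>hom_eig lam. (\<forall>x. F (lens_gen q s x) = F x) \<and> r = (\<lambda>x. complex_of_real (F x))"
      using f(2) Pinv[OF f(1)] by (elim disjE) (rule bexI[rotated], assumption, simp)+
  qed
  then show "\<exists>B'. finite B' \<and> B' \<subseteq> lens_eigenspace q s lam \<and> fun_lin_indep B' \<and> card B \<le> card B'"
    using R(3) le_trans by blast
qed

section \<open>Lattice points of given norm\<close>

unbundle fps_syntax

section \<open>Roots of unity and the generating series of one coordinate\<close>

definition rootq :: "nat \<Rightarrow> int \<Rightarrow> complex" where
  "rootq q t = cis (2 * pi * of_int t / real q)"

lemma rootq_add: "rootq q (s + t) = rootq q s * rootq q t"
  by (simp add: rootq_def cis_mult distrib_left add_divide_distrib)

lemma rootq_0 [simp]: "rootq q 0 = 1"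
  by (simp add: rootq_def)

lemma rootq_eq_1_iff: "q > 0 \<Longrightarrow> rootq q t = 1 \<longleftrightarrow> int q dvd t"
  unfolding rootq_def by (rule cis_2pi_div)

lemma rootq_cong:
  assumes "q > 0" "int q dvd (s - t)"
  shows "rootq q s = rootq q t"
  using rootq_add[of q "s - t" t] assms rootq_eq_1_iff[of q "s - t"] by simp

lemma rootq_power: "rootq q (int n * t) = rootq q t ^ n"
  by (induction n) (simp_all add: distrib_right rootq_add)

lemma sum_rootq:
  assumes q: "q > 0"
  shows "(\<Sum>l<q. rootq q (int l * t)) = (if int q dvd t then of_nat q else 0)"
proof (cases "int q dvd t")
  case True
  then have "rootq q t = 1" using rootq_eq_1_iff[OF q] by simp
  then show ?thesis using True by (simp add: rootq_power)
next
  case False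
  then have "rootq q t \<noteq> 1" using rootq_eq_1_iff[OF q] by simp
  moreover have "rootq q t ^ q = 1" using rootq_eq_1_iff[OF q, of "int q * t"] by (simp add: rootq_power[symmetric])
  ultimately show ?thesis using False by (simp add: rootq_power geometric_sum)
qed

text \<open>The generating series of \<open>rootq q (v * t)\<close> over all integers
  \<open>v\<close>, graded by \<open>\<bar>v\<bar>\<close>.\<close>

definition charser :: "nat \<Rightarrow> int \<Rightarrow> complex fps" where
  "charser q t = Abs_fps (\<lambda>m. if m = 0 then 1 else rootq q (int m * t) + rootq q (- (int m * t)))"

definition cosq :: "nat \<Rightarrow> int \<Rightarrow> complex" where
  "cosq q t = rootq q t + rootq q (- t)"

text \<open>The product of \<open>1 - \<zeta> X\<close> and \<open>1 - cnj \<zeta> X\<close> for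
  \<open>\<zeta> = rootq q t\<close>, hence the denominator of \<open>charser\<close>.\<close>

definition charden :: "nat \<Rightarrow> int \<Rightarrow> complex fps" where
  "charden q t = 1 - fps_const (cosq q t) * fps_X + fps_X ^ 2"

lemma cosq_mult: "cosq q s * cosq q t = cosq q (s + t) + cosq q (s - t)"
  by (simp add: cosq_def algebra_simps rootq_add[symmetric])

text \<open>\<open>charser\<close> is the sum of the geometric series in \<open>\<zeta> X\<close>
  and \<open>cnj \<zeta> X\<close>, less \<open>1\<close>. The coefficients are checked by the
  two-term recurrence for power sums.\<close>

lemma charser_mult_charden: "charser q t * charden q t = 1 - fps_X ^ 2"
proof (rule fps_ext)
  fix n
  have c: "rootq q t * rootq q (- t) = 1" by (simp add: rootq_add[symmetric])
  have e: "charser q t * charden q t = charser q t - fps_const (cosq q t) * (charser q t * fps_X) + charser q t * fps_X ^ 2"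
    by (simp add: charden_def algebra_simps)
  have rec: "rootq q (int m * t) + rootq q (- (int m * t)) = rootq q t ^ m + rootq q (- t) ^ m" for m
    using rootq_power[of q m t] rootq_power[of q m "- t"] by simp
  have cc: "(x + y) * (x ^ Suc m + y ^ Suc m) = (x ^ Suc (Suc m) + y ^ Suc (Suc m)) + (x * y) * (x ^ m + y ^ m)" for x y :: complex and m
    by (simp add: algebra_simps)
  have c2: "(x + y) * (x + y) = x ^ 2 + y ^ 2 + 2 * (x * y)" for x y :: complex
    by algebra
  \<comment> \<open>Indices up to \<open>2\<close> are separate because the constant coefficient is
    \<open>1\<close>, whereas the recurrence would start from \<open>2\<close>.\<close>
  consider "n = 0" | "n = 1" | "n = 2" | m where "n = Suc (Suc (Suc m))"
    by (metis One_nat_def numeral_2_eq_2 not0_implies_Suc)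
  then show "(charser q t * charden q t) $ n = (1 - fps_X ^ 2) $ n"
  proof cases
    case 4
    then show ?thesis unfolding e
      using cc[of "rootq q t" "rootq q (- t)" "Suc m"] by (simp add: charser_def fps_X_power_mult_right_nth cosq_def rec c del: of_nat_Suc)
  next
    case 3
    then show ?thesis unfolding e
      using c2[of "rootq q t" "rootq q (- t)"] by (simp add: charser_def fps_X_power_mult_right_nth cosq_def rec c del: of_nat_numeral)
  next
    case 1
    then show ?thesis unfolding e by (simp add: charser_def fps_X_power_mult_right_nth cosq_def)
  next
    case 2
    then show ?thesis unfolding e by (simp add: charser_def fps_X_power_mult_right_nth cosq_def)
  qed
qed

lemma charser_cong:
  assumes q: "q > 0" and "int q dvd (s - t) \<or> int q dvd (s + t)"
  shows "charser q s = charser q t"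
  using assms(2)
proof
  assume d: "int q dvd (s - t)"
  have "rootq q (int m * s) = rootq q (int m * t)" "rootq q (- (int m * s)) = rootq q (- (int m * t))" for m
    using dvd_mult[OF d, of "int m"] dvd_mult[OF d, of "- int m"] by (auto intro!: rootq_cong[OF q] simp: algebra_simps)
  then show ?thesis unfolding charser_def by (intro arg_cong[where f=Abs_fps] ext) simp
next
  assume d: "int q dvd (s + t)"
  have "rootq q (int m * s) = rootq q (- (int m * t))" "rootq q (- (int m * s)) = rootq q (int m * t)" for m
    using dvd_mult[OF d, of "int m"] dvd_mult[OF d, of "- int m"] by (auto intro!: rootq_cong[OF q] simp: algebra_simps)
  then show ?thesis unfolding charser_def by (intro arg_cong[where f=Abs_fps] ext) simp
qed

lemma cosq_cong:
  assumes q: "q > 0" and "int q dvd (s - t)"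
  shows "cosq q s = cosq q t"
  using rootq_cong[OF q, of s t] rootq_cong[OF q, of "- s" "- t"] assms(2)
  by (simp add: cosq_def dvd_diff_commute)

section \<open>Shells of the lattice and their generating series\<close>

definition shell :: "'n::finite set \<Rightarrow> nat \<Rightarrow> ('n \<Rightarrow> int) set" where
  "shell J k = {w. (\<forall>j. j \<notin> J \<longrightarrow> w j = 0) \<and> (\<Sum>j\<in>J. \<bar>w j\<bar>) = int k}"

lemma finite_shell: "finite (shell J k)"
proof (rule finite_subset)
  show "shell J k \<subseteq> PiE UNIV (\<lambda>_. {- int k..int k})"
  proof
    fix w assume w: "w \<in> shell J k"
    have "\<bar>w j\<bar> \<le> int k" for j
    proof (cases "j \<in> J")
      case True
      then have "\<bar>w j\<bar> \<le> (\<Sum>j\<in>J. \<bar>w j\<bar>)" by (intro member_le_sum) auto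
      then show ?thesis using w by (simp add: shell_def)
    qed (use w in \<open>simp add: shell_def\<close>)
    then show "w \<in> PiE UNIV (\<lambda>_. {- int k..int k})" by (auto simp: abs_le_iff minus_le_iff)
  qed
  show "finite (PiE UNIV (\<lambda>_. {- int k..int k}) :: ('a \<Rightarrow> int) set)" by (intro finite_PiE) auto
qed

lemma sum_symmetric_interval:
  fixes h :: "int \<Rightarrow> complex"
  shows "(\<Sum>v\<in>{- int k..int k}. h v) = (\<Sum>m\<le>k. if m = 0 then h 0 else h (int m) + h (- int m))"
proof (induction k)
  case (Suc k)
  have "{- int (Suc k)..int (Suc k)} = insert (int (Suc k)) (insert (- int (Suc k)) {- int k..int k})" by auto
  then show ?case using Suc by (simp add: algebra_simps)
qed simp

lemma sum_shell_insert:
  fixes g :: "('n::finite \<Rightarrow> int) \<Rightarrow> complex"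
  assumes "i \<notin> J"
  shows "(\<Sum>w\<in>shell (insert i J) k. g w) = (\<Sum>v\<in>{- int k..int k}. \<Sum>u\<in>shell J (k - nat \<bar>v\<bar>). g (u(i := v)))"
proof -
  have "(\<Sum>v\<in>{- int k..int k}. \<Sum>u\<in>shell J (k - nat \<bar>v\<bar>). g (u(i := v))) =
    (\<Sum>x\<in>Sigma {- int k..int k} (\<lambda>v. shell J (k - nat \<bar>v\<bar>)). g ((snd x)(i := fst x)))"
    by (subst sum.Sigma) (auto simp: finite_shell split_beta)
  also have "\<dots> = (\<Sum>w\<in>shell (insert i J) k. g w)"
  proof (rule sum.reindex_bij_witness[where i="\<lambda>w. (w i, w(i := 0))" and j="\<lambda>x. (snd x)(i := fst x)"])
    fix x assume x: "x \<in> Sigma {- int k..int k} (\<lambda>v. shell J (k - nat \<bar>v\<bar>))"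
    obtain v u where vu: "x = (v, u)" by (cases x)
    have v: "\<bar>v\<bar> \<le> int k" and u: "\<And>j. j \<notin> J \<Longrightarrow> u j = 0" "(\<Sum>j\<in>J. \<bar>u j\<bar>) = int (k - nat \<bar>v\<bar>)"
      using x by (auto simp: vu shell_def)
    have ui: "u i = 0" using u(1) assms by blast
    show "(((snd x)(i := fst x)) i, ((snd x)(i := fst x))(i := 0)) = x" using ui by (auto simp: vu)
    have "(\<Sum>j\<in>J. \<bar>(u(i := v)) j\<bar>) = (\<Sum>j\<in>J. \<bar>u j\<bar>)" using assms by (intro sum.cong) auto
    then show "(snd x)(i := fst x) \<in> shell (insert i J) k"
      using u v assms by (auto simp: vu shell_def)
  next
    fix w assume w: "w \<in> shell (insert i J) k"
    have s: "\<bar>w i\<bar> + (\<Sum>j\<in>J. \<bar>w j\<bar>) = int k" and z: "\<And>j. j \<notin> insert i J \<Longrightarrow> w j = 0"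
      using w assms by (auto simp: shell_def)
    have "(\<Sum>j\<in>J. \<bar>(w(i := 0)) j\<bar>) = (\<Sum>j\<in>J. \<bar>w j\<bar>)" using assms by (intro sum.cong) auto
    moreover have S0: "(\<Sum>j\<in>J. \<bar>w j\<bar>) \<ge> 0" by (rule sum_nonneg) auto
    moreover have "\<bar>w i\<bar> \<le> int k" "(\<Sum>j\<in>J. \<bar>w j\<bar>) = int (k - nat \<bar>w i\<bar>)" using s S0 by linarith+
    moreover have "- int k \<le> w i" "w i \<le> int k" using s S0 by linarith+
    ultimately show "(w i, w(i := 0)) \<in> Sigma {- int k..int k} (\<lambda>v. shell J (k - nat \<bar>v\<bar>))"
      using s z by (auto simp: shell_def)
  qed auto
  finally show ?thesis ..
qed

text \<open>The norm and the character both split over the coordinates; peeling off one coordinate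
  gives a Cauchy product.\<close>

lemma sum_shell_rootq:
  fixes p :: "'n::finite \<Rightarrow> int"
  shows "(\<Sum>w\<in>shell J k. rootq q (l * (\<Sum>j\<in>J. w j * p j))) = (\<Prod>j\<in>J. charser q (l * p j)) $ k"
proof (induction J arbitrary: k rule: finite_induct[OF finite])
  case 1
  have "shell {} k = (if k = 0 then {\<lambda>j. 0} else {} :: ('n \<Rightarrow> int) set)" by (auto simp: shell_def)
  then show ?case by simp
next
  case (2 i J)
  let ?F = "\<Prod>j\<in>J. charser q (l * p j)"
  have "(\<Sum>w\<in>shell (insert i J) k. rootq q (l * (\<Sum>j\<in>insert i J. w j * p j))) =
     (\<Sum>v\<in>{- int k..int k}. \<Sum>u\<in>shell J (k - nat \<bar>v\<bar>). rootq q (l * (\<Sum>j\<in>insert i J. (u(i := v)) j * p j)))"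
    by (rule sum_shell_insert[OF 2(2)])
  also have "\<dots> = (\<Sum>v\<in>{- int k..int k}. rootq q (v * (l * p i)) * ?F $ (k - nat \<bar>v\<bar>))"
  proof (intro sum.cong refl)
    fix v
    have "(\<Sum>j\<in>insert i J. (u(i := v)) j * p j) = v * p i + (\<Sum>j\<in>J. u j * p j)" for u
    proof -
      have "(\<Sum>j\<in>J. (u(i := v)) j * p j) = (\<Sum>j\<in>J. u j * p j)" using 2(2) by (intro sum.cong) auto
      then show ?thesis using 2 by simp
    qed
    then have "rootq q (l * (\<Sum>j\<in>insert i J. (u(i := v)) j * p j)) = rootq q (v * (l * p i)) * rootq q (l * (\<Sum>j\<in>J. u j * p j))" for u
      by (simp only: rootq_add[symmetric]) (simp add: algebra_simps)
    then show "(\<Sum>u\<in>shell J (k - nat \<bar>v\<bar>). rootq q (l * (\<Sum>j\<in>insert i J. (u(i := v)) j * p j))) =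
       rootq q (v * (l * p i)) * ?F $ (k - nat \<bar>v\<bar>)"
      using 2(3)[of "k - nat \<bar>v\<bar>"] by (simp only: sum_distrib_left[symmetric])
  qed
  also have "\<dots> = (\<Sum>m\<le>k. charser q (l * p i) $ m * ?F $ (k - m))"
    unfolding sum_symmetric_interval by (rule sum.cong[OF refl]) (simp add: charser_def algebra_simps)
  also have "\<dots> = (charser q (l * p i) * ?F) $ k"
    by (simp add: fps_mult_nth atLeast0AtMost)
  finally show ?case using 2 by simp
qed

text \<open>Orthogonality of characters: summing over \<open>l\<close> detects the weights in the
  lattice.\<close>

lemma card_congruence_shell:
  fixes p :: "'n::finite \<Rightarrow> int"
  assumes q: "q > 0"
  shows "of_nat q * of_nat (card (congruence_lattice q p \<inter> shell UNIV k)) =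
    (\<Sum>l<q. \<Prod>j\<in>UNIV. charser q (int l * p j)) $ k"
proof -
  have "(\<Sum>l<q. \<Prod>j\<in>UNIV. charser q (int l * p j)) $ k = (\<Sum>l<q. \<Sum>w\<in>shell UNIV k. rootq q (int l * (\<Sum>j\<in>UNIV. w j * p j)))"
    by (simp add: fps_sum_nth sum_shell_rootq)
  also have "\<dots> = (\<Sum>w\<in>shell UNIV k. \<Sum>l<q. rootq q (int l * (\<Sum>j\<in>UNIV. w j * p j)))"
    by (rule sum.swap)
  also have "\<dots> = (\<Sum>w\<in>shell UNIV k. if w \<in> congruence_lattice q p then of_nat q else 0)"
    by (simp add: sum_rootq[OF q] congruence_lattice_def)
  also have "\<dots> = of_nat q * of_nat (card (congruence_lattice q p \<inter> shell UNIV k))"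
    by (simp add: sum.If_cases finite_shell Int_commute)
  finally show ?thesis ..
qed

text \<open>The index range represents each nonzero residue up to sign exactly once, and signs are
  invisible to \<open>charser\<close>. A unit permutes these classes, whence
  \<open>halfprod_unit\<close>.\<close>

definition halfprod :: "nat \<Rightarrow> int \<Rightarrow> complex fps" where
  "halfprod q l = (\<Prod>t\<in>{1..int q div 2}. charser q (l * t))"

text \<open>The representative of \<open>x\<close> or \<open>- x\<close> modulo \<open>q\<close> in
  the interval from \<open>0\<close> to \<open>q / 2\<close>.\<close>

definition absres :: "nat \<Rightarrow> int \<Rightarrow> int" where
  "absres q x = min (x mod int q) (int q - x mod int q)"

lemma absres_cong: "q > 0 \<Longrightarrow> int q dvd (x - absres q x) \<or> int q dvd (x + absres q x)"
proof -
  have 1: "int q dvd x - x mod int q" by (simp add: dvd_minus_mod)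
  then have "int q dvd x + (int q - x mod int q)"
    by (metis add_diff_eq diff_add_eq dvd_add_triv_right_iff)
  then show ?thesis using 1 by (auto simp: absres_def min_def)
qed

lemma absres_range: "q > 0 \<Longrightarrow> 0 \<le> absres q x \<and> absres q x \<le> int q div 2"
proof -
  assume q: "q > 0"
  have "0 \<le> x mod int q" "x mod int q < int q" using q by auto
  then show ?thesis unfolding absres_def min_def by (auto split: if_splits)
qed

lemma half_range_unique:
  fixes s t :: int
  assumes "q > 0" "s \<in> {1..int q div 2}" "t \<in> {1..int q div 2}" "int q dvd (s - t) \<or> int q dvd (s + t)"
  shows "s = t"
  using assms(4)
proof
  assume "int q dvd (s - t)"
  moreover have "\<bar>s - t\<bar> < int q" using assms by auto
  ultimately show ?thesis using dvd_imp_le_int[of "s - t" "int q"] by auto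
next
  assume "int q dvd (s + t)"
  then have "int q \<le> s + t" using assms zdvd_imp_le by auto
  then show ?thesis using assms by auto
qed

lemma absres_bij:
  assumes q: "q > 0" and u: "coprime u (int q)"
  shows "bij_betw (\<lambda>t. absres q (u * t)) {1..int q div 2} {1..int q div 2}"
proof -
  have into: "absres q (u * t) \<in> {1..int q div 2}" if t: "t \<in> {1..int q div 2}" for t
  proof -
    have "absres q (u * t) \<noteq> 0"
    proof
      assume "absres q (u * t) = 0"
      then have "int q dvd u * t" using absres_cong[OF q, of "u * t"] by auto
      then have "int q dvd t" using u by (simp add: coprime_dvd_mult_right_iff coprime_commute)
      then show False using t zdvd_imp_le[of "int q" t] by auto
    qed
    then show ?thesis using absres_range[OF q, of "u * t"] by auto
  qed
  have "inj_on (\<lambda>t. absres q (u * t)) {1..int q div 2}"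
  proof (rule inj_onI)
    fix s t assume st: "s \<in> {1..int q div 2}" "t \<in> {1..int q div 2}" "absres q (u * s) = absres q (u * t)"
    have "int q dvd (u * s - u * t) \<or> int q dvd (u * s + u * t)"
      using absres_cong[OF q, of "u * s"] absres_cong[OF q, of "u * t"] unfolding st(3)
      by (smt (verit) dvd_add dvd_diff)
    then have "int q dvd u * (s - t) \<or> int q dvd u * (s + t)" by (simp add: algebra_simps)
    then have "int q dvd (s - t) \<or> int q dvd (s + t)"
      using u by (simp add: coprime_dvd_mult_right_iff coprime_commute)
    then show "s = t" using half_range_unique[OF q] st by blast
  qed
  moreover have "(\<lambda>t. absres q (u * t)) ` {1..int q div 2} = {1..int q div 2}"
    by (rule endo_inj_surj) (use into calculation in auto)
  ultimately show ?thesis by (simp add: bij_betw_def)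
qed

lemma halfprod_unit:
  assumes q: "q > 0" and u: "coprime u (int q)"
  shows "halfprod q (u * l) = halfprod q l"
proof -
  have "halfprod q (u * l) = (\<Prod>t\<in>{1..int q div 2}. charser q (l * absres q (u * t)))"
    unfolding halfprod_def
  proof (rule prod.cong[OF refl])
    fix t
    have "int q dvd l * (u * t - absres q (u * t)) \<or> int q dvd l * (u * t + absres q (u * t))"
      using absres_cong[OF q, of "u * t"] by (auto intro: dvd_mult)
    then show "charser q (u * l * t) = charser q (l * absres q (u * t))"
      by (intro charser_cong[OF q]) (simp add: algebra_simps)
  qed
  also have "\<dots> = halfprod q l"
    unfolding halfprod_def by (rule prod.reindex_bij_betw[OF absres_bij[OF assms]])
  finally show ?thesis .
qed

lemma halfprod_cong: "q > 0 \<Longrightarrow> int q dvd (l - l') \<Longrightarrow> halfprod q l = halfprod q l'"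
  unfolding halfprod_def
  by (rule prod.cong[OF refl], rule charser_cong) (auto simp: left_diff_distrib[symmetric])

text \<open>A Ramanujan sum weighted by \<open>halfprod\<close>. Both factors are periodic in \<open>l\<close>, and \<open>halfprod\<close> is invariant
  under units, so the value at \<open>t\<close> depends on \<open>t\<close> only up to units.\<close>
definition ramsum :: "nat \<Rightarrow> int \<Rightarrow> complex fps" where
  "ramsum q t = (\<Sum>l\<in>{0..<int q}. halfprod q l * fps_const (cosq q (l * t)))"

lemma unit_mult_bij:
  assumes q: "q > 0" and u: "coprime u (int q)"
  shows "bij_betw (\<lambda>l. (u * l) mod int q) {0..<int q} {0..<int q}"
proof -
  have "inj_on (\<lambda>l. (u * l) mod int q) {0..<int q}"
  proof (rule inj_onI)
    fix s t assume st: "s \<in> {0..<int q}" "t \<in> {0..<int q}" "(u * s) mod int q = (u * t) mod int q"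
    then have "int q dvd u * (s - t)" by (simp add: mod_eq_dvd_iff right_diff_distrib)
    then have "int q dvd (s - t)" using u by (simp add: coprime_dvd_mult_right_iff coprime_commute)
    moreover have "\<bar>s - t\<bar> < int q" using st by auto
    ultimately show "s = t" using dvd_imp_le_int[of "s - t" "int q"] by auto
  qed
  moreover have "(\<lambda>l. (u * l) mod int q) ` {0..<int q} = {0..<int q}"
    by (rule endo_inj_surj) (use q calculation in auto)
  ultimately show ?thesis by (simp add: bij_betw_def)
qed

lemma ramsum_unit:
  assumes q: "q > 0" and u: "coprime u (int q)"
  shows "ramsum q (u * t) = ramsum q t"
proof -
  have "ramsum q t = (\<Sum>l\<in>{0..<int q}. halfprod q ((u * l) mod int q) * fps_const (cosq q ((u * l) mod int q * t)))"
    unfolding ramsum_def by (rule sum.reindex_bij_betw[OF unit_mult_bij[OF assms], symmetric])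
  also have "\<dots> = ramsum q (u * t)" unfolding ramsum_def
  proof (rule sum.cong[OF refl])
    fix l
    have d: "int q dvd ((u * l) mod int q - u * l)" by (metis dvd_minus_mod dvd_diff_commute)
    have "halfprod q ((u * l) mod int q) = halfprod q l" using halfprod_cong[OF q d] halfprod_unit[OF assms] by simp
    moreover have "cosq q ((u * l) mod int q * t) = cosq q (l * (u * t))"
      using dvd_mult2[OF d, of t] by (intro cosq_cong[OF q]) (simp add: algebra_simps)
    ultimately show "halfprod q ((u * l) mod int q) * fps_const (cosq q ((u * l) mod int q * t)) =
      halfprod q l * fps_const (cosq q (l * (u * t)))" by simp
  qed
  finally show ?thesis ..
qed

lemma ramsum_cong: "q > 0 \<Longrightarrow> int q dvd (s - t) \<Longrightarrow> ramsum q s = ramsum q t"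
  unfolding ramsum_def
  by (rule sum.cong[OF refl], rule arg_cong[where f="\<lambda>c. _ * fps_const c"], rule cosq_cong)
    (auto simp: right_diff_distrib[symmetric])

lemma ramsum_coprime: "q > 0 \<Longrightarrow> coprime t (int q) \<Longrightarrow> ramsum q t = ramsum q 1"
  using ramsum_unit[of q t 1] by simp

text \<open>The addition formula \<open>cosq_mult\<close> linearises the product of the two cosines,
  so every coefficient becomes a \<open>ramsum\<close>.\<close>

lemma sum_charden:
  "(\<Sum>l\<in>{0..<int q}. halfprod q l * (charden q l * charden q (l * a))) =
     (1 + fps_X ^ 2) ^ 2 * (\<Sum>l\<in>{0..<int q}. halfprod q l)
     - fps_X * (1 + fps_X ^ 2) * (ramsum q 1 + ramsum q a)
     + fps_X ^ 2 * (ramsum q (1 + a) + ramsum q (1 - a))"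
proof -
  have "charden q l * charden q (l * a) = (1 + fps_X ^ 2) ^ 2 - fps_X * (1 + fps_X ^ 2) * (fps_const (cosq q (l * 1)) + fps_const (cosq q (l * a)))
      + fps_X ^ 2 * (fps_const (cosq q (l * (1 + a))) + fps_const (cosq q (l * (1 - a))))" for l
  proof -
    have "fps_const (cosq q l) * fps_const (cosq q (l * a)) = fps_const (cosq q (l * (1 + a))) + fps_const (cosq q (l * (1 - a)))"
      using cosq_mult[of q l "l * a"] by (simp add: algebra_simps)
    moreover have "charden q l * charden q (l * a) = (1 + fps_X ^ 2) ^ 2 - fps_X * (1 + fps_X ^ 2) * (fps_const (cosq q l) + fps_const (cosq q (l * a)))
      + fps_X ^ 2 * (fps_const (cosq q l) * fps_const (cosq q (l * a)))"
      unfolding charden_def by algebra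
    ultimately show ?thesis by simp
  qed
  then have "(\<Sum>l\<in>{0..<int q}. halfprod q l * (charden q l * charden q (l * a))) =
     (\<Sum>l\<in>{0..<int q}. (1 + fps_X ^ 2) ^ 2 * halfprod q l
        - fps_X * (1 + fps_X ^ 2) * (halfprod q l * fps_const (cosq q (l * 1)) + halfprod q l * fps_const (cosq q (l * a)))
        + fps_X ^ 2 * (halfprod q l * fps_const (cosq q (l * (1 + a))) + halfprod q l * fps_const (cosq q (l * (1 - a)))))"
    by (intro sum.cong refl) (simp only: distrib_left right_diff_distrib mult_ac)
  also have "\<dots> = (1 + fps_X ^ 2) ^ 2 * (\<Sum>l\<in>{0..<int q}. halfprod q l)
     - fps_X * (1 + fps_X ^ 2) * (ramsum q 1 + ramsum q a)
     + fps_X ^ 2 * (ramsum q (1 + a) + ramsum q (1 - a))"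
    unfolding ramsum_def by (simp only: sum.distrib sum_subtractf sum_distrib_left[symmetric])
  finally show ?thesis .
qed

text \<open>The left side lacks the factors of \<open>halfprod\<close> at \<open>1\<close> and
  \<open>a\<close>. By \<open>charser_mult_charden\<close>, a factor \<open>1 - X^2\<close> equals
  such a missing factor times its \<open>charden\<close>, so denominators are cleared without a
  division.\<close>

lemma generating_sum:
  fixes p :: "'n::finite \<Rightarrow> int"
  assumes q: "q > 0" and p: "inj p" "range p = {1..int q div 2} - {1, a}" and a: "a \<in> {2..int q div 2}"
  shows "(1 - fps_X ^ 2) ^ 2 * (\<Sum>l<q. \<Prod>j\<in>UNIV. charser q (int l * p j)) =
     (\<Sum>l\<in>{0..<int q}. halfprod q l * (charden q l * charden q (l * a)))"
proof -
  have one: "halfprod q l * (charden q l * charden q (l * a)) = (1 - fps_X ^ 2) ^ 2 * (\<Prod>j\<in>UNIV. charser q (l * p j))" for l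
  proof -
    have "(\<Prod>j\<in>UNIV. charser q (l * p j)) = (\<Prod>t\<in>{1..int q div 2} - {1, a}. charser q (l * t))"
      unfolding p(2)[symmetric] using p(1) by (simp add: prod.reindex)
    moreover have "halfprod q l = charser q (l * 1) * (charser q (l * a) * (\<Prod>t\<in>{1..int q div 2} - {1, a}. charser q (l * t)))"
    proof -
      have "halfprod q l = charser q (l * 1) * (\<Prod>t\<in>{1..int q div 2} - {1}. charser q (l * t))"
        unfolding halfprod_def using a by (intro prod.remove) auto
      also have "(\<Prod>t\<in>{1..int q div 2} - {1}. charser q (l * t)) = charser q (l * a) * (\<Prod>t\<in>{1..int q div 2} - {1} - {a}. charser q (l * t))"
        using a by (intro prod.remove) auto
      also have "{1..int q div 2} - {1} - {a} = {1..int q div 2} - {1, a}" by auto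
      finally show ?thesis .
    qed
    ultimately have "halfprod q l * (charden q l * charden q (l * a)) =
      (charser q l * charden q l) * (charser q (l * a) * charden q (l * a)) * (\<Prod>j\<in>UNIV. charser q (l * p j))"
      by (simp add: mult_ac)
    then show ?thesis unfolding charser_mult_charden by (simp add: power2_eq_square)
  qed
  have "(\<Sum>l\<in>{0..<int q}. \<Prod>j\<in>UNIV. charser q (l * p j)) = (\<Sum>l<q. \<Prod>j\<in>UNIV. charser q (int l * p j))"
    by (rule sum.reindex_bij_witness[where i=int and j=nat]) auto
  then show ?thesis unfolding one sum_distrib_left[symmetric] by simp
qed

lemma card_shell_eq:
  fixes p s :: "'n::finite \<Rightarrow> int"
  assumes q: "q > 0" and p: "inj p" "range p = {1..int q div 2} - {1, a}" "a \<in> {2..int q div 2}"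
    and s: "inj s" "range s = {1..int q div 2} - {1, b}" "b \<in> {2..int q div 2}"
    and u: "coprime u (int q)" "int q dvd (b - u * a)"
    and cop: "coprime (1 + a) (int q)" "coprime (1 - a) (int q)" "coprime (1 + b) (int q)" "coprime (1 - b) (int q)"
  shows "card (congruence_lattice q p \<inter> shell UNIV k) = card (congruence_lattice q s \<inter> shell UNIV k)"
proof -
  let ?N = "\<lambda>p. \<Sum>l<q. \<Prod>j\<in>UNIV. charser q (int l * p j)"
  have "ramsum q a = ramsum q b"
    using ramsum_cong[OF q u(2)] ramsum_unit[OF q u(1), of a] by simp
  then have "(1 - fps_X ^ 2) ^ 2 * ?N p = (1 - fps_X ^ 2) ^ 2 * ?N s"
    unfolding generating_sum[OF q p] generating_sum[OF q s] sum_charden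
    by (simp add: ramsum_coprime[OF q cop(1)] ramsum_coprime[OF q cop(2)] ramsum_coprime[OF q cop(3)] ramsum_coprime[OF q cop(4)])
  moreover have "(1 - fps_X ^ 2 :: complex fps) \<noteq> 0"
  proof
    assume a: "(1 - fps_X ^ 2 :: complex fps) = 0"
    have "(1 - fps_X ^ 2 :: complex fps) $ 0 = 1" by (simp add: fps_X_power_nth)
    then show False unfolding a by simp
  qed
  ultimately have "?N p = ?N s" by simp
  then have "of_nat q * (of_nat (card (congruence_lattice q p \<inter> shell UNIV k)) :: complex)
     = of_nat q * of_nat (card (congruence_lattice q s \<inter> shell UNIV k))"
    by (simp only: card_congruence_shell[OF q])
  then show ?thesis using q by simp
qed

unbundle no fps_syntax

section \<open>Isometries of the quotients\<close>

text \<open>Shells are finite, so equal cardinalities give bijections level by level, which glue to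
  a norm-preserving injection of lattices. The hypothesis is symmetric in \<open>p\<close> and
  \<open>s\<close>, which yields both inequalities.\<close>

lemma lens_isospectralI:
  fixes p s :: "'n::finite \<Rightarrow> int"
  assumes q: "q > 0"
    and card: "\<And>k. card (congruence_lattice q p \<inter> shell UNIV k) = card (congruence_lattice q s \<inter> shell UNIV k)"
  shows "lens_isospectral q p s"
proof -
  have le: "fun_dim (lens_eigenspace q p lam) \<le> fun_dim (lens_eigenspace q s lam)"
    if card: "\<And>k. card (congruence_lattice q p \<inter> shell UNIV k) = card (congruence_lattice q s \<inter> shell UNIV k)"
    for p s :: "'n \<Rightarrow> int" and lam
  proof -
    have "\<forall>k. \<exists>f. bij_betw f (congruence_lattice q p \<inter> shell UNIV k) (congruence_lattice q s \<inter> shell UNIV k)"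
      using card by (auto intro!: finite_same_card_bij simp: finite_shell)
    then obtain f where f: "\<forall>k. bij_betw (f k) (congruence_lattice q p \<inter> shell UNIV k) (congruence_lattice q s \<inter> shell UNIV k)"
      by (rule choice[THEN exE])
    define lev where "lev w = nat (\<Sum>j\<in>UNIV. \<bar>w j\<bar>)" for w :: "'n \<Rightarrow> int"
    have lev: "w \<in> shell UNIV k \<longleftrightarrow> lev w = k" for w k
    proof -
      have "(\<Sum>j\<in>UNIV. \<bar>w j\<bar>) \<ge> 0" by (rule sum_nonneg) auto
      then show ?thesis unfolding shell_def lev_def by auto
    qed
    have \<beta>: "f (lev w) w \<in> congruence_lattice q s \<and> lev (f (lev w) w) = lev w" if "w \<in> congruence_lattice q p" for w
      using bij_betwE[OF f[THEN spec, of "lev w"]] that lev by blast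
    show ?thesis
    proof (rule fun_dim_lens_eigenspace_le[OF q, where \<beta>="\<lambda>w. f (lev w) w"])
      fix w assume w: "w \<in> congruence_lattice q p"
      show "f (lev w) w \<in> congruence_lattice q s" using \<beta>[OF w] by blast
      have "(\<Sum>j\<in>UNIV. \<bar>v j\<bar>) = int (lev v)" for v
        unfolding lev_def by (simp add: sum_nonneg)
      then show "(\<Sum>j\<in>UNIV. \<bar>w j\<bar>) = (\<Sum>j\<in>UNIV. \<bar>f (lev w) w j\<bar>)" using \<beta>[OF w] by metis
    next
      show "inj_on (\<lambda>w. f (lev w) w) (congruence_lattice q p)"
      proof (rule inj_onI)
        fix v w assume vw: "v \<in> congruence_lattice q p" "w \<in> congruence_lattice q p" "f (lev v) v = f (lev w) w"
        have "lev v = lev w" using \<beta>[OF vw(1)] \<beta>[OF vw(2)] vw(3) by metis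
        then show "v = w"
          using bij_betw_imp_inj_on[OF f[THEN spec, of "lev w"]] vw lev unfolding inj_on_def by (metis IntI)
      qed
    qed
  qed
  show ?thesis unfolding lens_isospectral_def lens_spectrum_def
    by (rule ext, rule antisym) (simp_all add: le card)
qed

text \<open>A basis chosen inside \<open>Z\<close> determines \<open>U\<close>, and bilinearity
  makes it orthogonal. Then \<open>\<psi> z - U z\<close> is orthogonal to the image of that basis,
  hence zero.\<close>

lemma inner_preserving_extends:
  fixes \<psi> :: "'a::euclidean_space \<Rightarrow> 'a"
  assumes pres: "\<And>x y. x \<in> Z \<Longrightarrow> y \<in> Z \<Longrightarrow> \<psi> x \<bullet> \<psi> y = x \<bullet> y" and span: "span Z = UNIV"
  shows "\<exists>U. orthogonal_transformation U \<and> (\<forall>z\<in>Z. \<psi> z = U z)"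
proof -
  obtain B where B: "B \<subseteq> Z" "independent B" "Z \<subseteq> span B" using maximal_independent_subset by blast
  have spB: "span B = UNIV" using B(3) span by (metis span_mono span_span top.extremum_uniqueI)
  obtain U where U: "linear U" "\<forall>x\<in>B. U x = \<psi> x" using linear_independent_extend[OF B(2)] by blast
  have bil: "bilinear (\<lambda>x y. U x \<bullet> U y)" "bilinear (\<lambda>x y :: 'a. x \<bullet> y)"
    unfolding bilinear_def
    by (auto intro!: linearI simp: linear_add[OF U(1)] linear_scale[OF U(1)] inner_add_left inner_add_right)
  have pU: "U x \<bullet> U y = x \<bullet> y" for x y
    by (rule bilinear_eq[OF bil, of UNIV B UNIV B]) (use spB U(2) pres subsetD[OF B(1)] in auto)
  have oU: "orthogonal_transformation U" using pU U(1) by (simp add: orthogonal_transformation_def)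
  have "\<psi> z = U z" if z: "z \<in> Z" for z
  proof -
    have "(\<psi> z - U z) \<bullet> U y = 0" for y
    proof -
      have "y \<in> span B" using spB by simp
      then show ?thesis
      proof (induction rule: span_induct)
        case base
        show ?case
        proof (rule subspaceI)
          show "0 \<in> {x. (\<psi> z - U z) \<bullet> U x = 0}" by (simp add: linear_0[OF U(1)])
        qed (simp_all add: linear_add[OF U(1)] linear_scale[OF U(1)] inner_add_right)
      next
        case (step b)
        have "\<psi> z \<bullet> U b = z \<bullet> b" using pres[OF z, of b] step U(2) B(1) by auto
        then show ?case using pU[of z b] by (simp add: inner_diff_left)
      qed
    qed
    moreover obtain y where "\<psi> z - U z = U y" using orthogonal_transformation_surj[OF oU] by (meson surjE)
    ultimately show ?thesis by (metis inner_eq_zero_iff right_minus_eq)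
  qed
  then show ?thesis using oU by blast
qed

text \<open>To reach \<open>v\<close>, move from \<open>x\<close> a little in direction
  \<open>v\<close> and normalise: the result stays in the cap, and together with \<open>x\<close> it
  spans \<open>v\<close>.\<close>

lemma sphere_ball_spans:
  fixes x :: "'a::euclidean_space"
  assumes x: "norm x = 1" and e: "e > 0"
  shows "span {z. norm z = 1 \<and> norm (z - x) < e} = UNIV"
proof -
  let ?Z = "{z. norm z = 1 \<and> norm (z - x) < e}"
  have xZ: "x \<in> ?Z" using x e by simp
  have "v \<in> span ?Z" for v
  proof -
    have x0: "x \<noteq> 0" using x by auto
    have t1: "((\<lambda>t. x + t *\<^sub>R v) \<longlongrightarrow> x) (at_right 0)"
      by (rule tendsto_eq_intros | simp)+
    have t2: "((\<lambda>t. sgn (x + t *\<^sub>R v)) \<longlongrightarrow> sgn x) (at_right 0)" by (rule tendsto_sgn[OF t1 x0])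
    have "sgn x = x" using x by (simp add: sgn_div_norm)
    then have ev1: "\<forall>\<^sub>F t in at_right 0. dist (sgn (x + t *\<^sub>R v)) x < e" using tendstoD[OF t2 e] by simp
    have ev2: "\<forall>\<^sub>F t in at_right 0. x + t *\<^sub>R v \<noteq> 0" using tendsto_imp_eventually_ne[OF t1 x0] .
    have ev3: "\<forall>\<^sub>F t in at_right (0::real). t > 0" by (simp add: eventually_at_right_less)
    obtain t where t: "dist (sgn (x + t *\<^sub>R v)) x < e" "x + t *\<^sub>R v \<noteq> 0" "t > 0"
      using eventually_happens'[OF trivial_limit_at_right_real eventually_conj[OF ev1 eventually_conj[OF ev2 ev3]]] by blast
    have "sgn (x + t *\<^sub>R v) \<in> ?Z" using t by (simp add: dist_norm norm_sgn)
    then have "norm (x + t *\<^sub>R v) *\<^sub>R sgn (x + t *\<^sub>R v) \<in> span ?Z" by (intro span_scale span_base)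
    then have "x + t *\<^sub>R v \<in> span ?Z" using t(2) by (simp add: sgn_div_norm)
    from span_diff[OF this span_base[OF xZ]] have "t *\<^sub>R v \<in> span ?Z" by simp
    from span_scale[OF this, of "1 / t"] show ?thesis using t(3) by simp
  qed
  then show ?thesis by auto
qed

text \<open>Finitely many proper subspaces form a null set and cannot cover an open set. This makes
  a deck transformation chosen point by point independent of the point.\<close>

lemma finite_cover_linear_eq:
  fixes U V :: "'a::euclidean_space \<Rightarrow> 'a"
  assumes "finite H" "\<And>h. h \<in> H \<Longrightarrow> linear h" "linear U" "linear V" "open N" "N \<noteq> {}"
    and cover: "\<And>z. z \<in> N \<Longrightarrow> \<exists>h\<in>H. U z = h (V z)"
  shows "\<exists>h\<in>H. \<forall>z. U z = h (V z)"
proof (rule ccontr)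
  assume no: "\<not> ?thesis"
  have "negligible {z. U z = h (V z)}" if "h \<in> H" for h
  proof -
    have sub: "subspace {z. U z = h (V z)}"
      using assms(2)[OF that] assms(3,4) by (auto simp: subspace_def linear_0 linear_add linear_scale)
    have "{z. U z = h (V z)} \<noteq> UNIV" using no that by auto
    then have "dim {z. U z = h (V z)} < DIM('a)"
      using sub dim_eq_full dim_subset_UNIV le_neq_implies_less by (metis span_eq_iff)
    then show ?thesis by (rule negligible_lowdim)
  qed
  then have "negligible (\<Union>h\<in>H. {z. U z = h (V z)})" using assms(1) by (intro negligible_Union) auto
  moreover have "N \<subseteq> (\<Union>h\<in>H. {z. U z = h (V z)})" using cover by auto
  ultimately have "negligible N" using negligible_subset by blast
  then show False using open_not_negligible[OF assms(5,6)] by blast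
qed

section \<open>The lens group as a finite group of rotations\<close>

lemma lens_gen_power: "lens_gen q p ^^ k = rot (\<lambda>j. real k * (2 * pi * real_of_int (p j) / real q))"
proof (induction k)
  case 0
  show ?case by (rule ext) (simp add: rot_zero)
next
  case (Suc k)
  show ?case
  proof (rule ext)
    fix z
    have "(\<lambda>j. 2 * pi * real_of_int (p j) / real q + real k * (2 * pi * real_of_int (p j) / real q)) =
      (\<lambda>j. real (Suc k) * (2 * pi * real_of_int (p j) / real q))" by (simp add: distrib_right add_divide_distrib)
    then show "(lens_gen q p ^^ Suc k) z = rot (\<lambda>j. real (Suc k) * (2 * pi * real_of_int (p j) / real q)) z"
      unfolding funpow.simps comp_apply Suc unfolding lens_gen_rot rot_rot by (simp only:)
  qed
qed

lemma lens_gen_order: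
  assumes "q > 0"
  shows "lens_gen q p ^^ (k mod q) = lens_gen q p ^^ k"
proof -
  have "cis (real (q * m) * (2 * pi * real_of_int t / real q)) = 1" for m t
  proof -
    have "real (q * m) * (2 * pi * real_of_int t / real q) = 2 * pi * of_int (int m * t)" using assms by simp
    then show ?thesis using cis_multiple_2pi[of "of_int (int m * t)"] by simp
  qed
  moreover have "real k * x = real (k mod q) * x + real (q * (k div q)) * x" for x :: real
    by (metis distrib_right mod_mult_div_eq of_nat_add)
  ultimately have "cis (real k * (2 * pi * real_of_int (p j) / real q)) = cis (real (k mod q) * (2 * pi * real_of_int (p j) / real q))" for j
    by (simp only: cis_mult[symmetric] mult_1_right)
  then show ?thesis unfolding lens_gen_power by (intro ext rot_cong) simp
qed

lemma lens_group_eq: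
  assumes "q > 0"
  shows "lens_group q p = (\<lambda>k. lens_gen q p ^^ k) ` {..<q}"
proof
  show "lens_group q p \<subseteq> (\<lambda>k. lens_gen q p ^^ k) ` {..<q}"
  proof
    fix h assume "h \<in> lens_group q p"
    then obtain k where "h = lens_gen q p ^^ k" unfolding lens_group_def by blast
    then have "h = lens_gen q p ^^ (k mod q)" using lens_gen_order[OF assms, where p=p and k=k] by metis
    then show "h \<in> (\<lambda>k. lens_gen q p ^^ k) ` {..<q}" using assms by simp
  qed
qed (auto simp: lens_group_def)

lemma finite_lens_group: "q > 0 \<Longrightarrow> finite (lens_group q p)"
  by (simp add: lens_group_eq)

lemma lens_group_rot: "h \<in> lens_group q p \<Longrightarrow> \<exists>\<theta>. h = rot \<theta>"
  unfolding lens_group_def using lens_gen_power by auto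

lemma id_lens_group: "id \<in> lens_group q p"
  unfolding lens_group_def by (rule CollectI, rule exI[of _ 0]) simp

lemma lens_group_comp:
  assumes "h \<in> lens_group q p" "h' \<in> lens_group q p"
  shows "h \<circ> h' \<in> lens_group q p"
proof -
  obtain k l where "h = lens_gen q p ^^ k" "h' = lens_gen q p ^^ l" using assms by (auto simp: lens_group_def)
  then have "h \<circ> h' = lens_gen q p ^^ (k + l)" by (simp add: funpow_add)
  then show ?thesis unfolding lens_group_def by blast
qed

lemma lens_group_inverse:
  assumes "q > 0" "h \<in> lens_group q p"
  shows "\<exists>h'\<in>lens_group q p. h \<circ> h' = id \<and> h' \<circ> h = id"
proof -
  obtain k where k: "h = lens_gen q p ^^ k" "k < q" using assms by (auto simp: lens_group_eq)
  have 0: "lens_gen q p ^^ q = id" using lens_gen_order[OF assms(1), where p=p and k=q] by simp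
  have "h \<circ> lens_gen q p ^^ (q - k) = id" "lens_gen q p ^^ (q - k) \<circ> h = id"
    using k 0 by (simp_all flip: funpow_add)
  then show ?thesis unfolding lens_group_def by blast
qed

lemma lens_group_linear: "h \<in> lens_group q p \<Longrightarrow> linear h"
  using lens_group_rot linear_rot by blast

lemma lens_group_inner: "h \<in> lens_group q p \<Longrightarrow> h x \<bullet> h y = x \<bullet> y"
  using lens_group_rot orthogonal_rot unfolding orthogonal_transformation_def by blast

lemma lens_group_norm: "h \<in> lens_group q p \<Longrightarrow> norm (h x) = norm x"
  using lens_group_inner[of h q p x x] by (simp add: norm_eq)

text \<open>The cosine of the distance between the orbits of \<open>x\<close> and \<open>y\<close>.\<close>
definition cmax :: "nat \<Rightarrow> ('n::finite \<Rightarrow> int) \<Rightarrow> (real^'n) \<times> (real^'n) \<Rightarrow> (real^'n) \<times> (real^'n) \<Rightarrow> real" where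
  "cmax q p x y = Max ((\<lambda>h. x \<bullet> h y) ` lens_group q p)"

section \<open>Orbits and the distances between them\<close>

definition orb :: "nat \<Rightarrow> ('n::finite \<Rightarrow> int) \<Rightarrow> (real^'n) \<times> (real^'n) \<Rightarrow> ((real^'n) \<times> (real^'n)) set" where
  "orb q p x = (\<lambda>h. h x) ` lens_group q p"

lemma orb_self: "x \<in> orb q p x"
  unfolding orb_def using id_lens_group by (metis id_apply image_eqI)

lemma orb_eq:
  assumes q: "q > 0" and h: "h \<in> lens_group q p"
  shows "orb q p (h x) = orb q p x"
proof -
  obtain h' where h': "h' \<in> lens_group q p" "h' \<circ> h = id" using lens_group_inverse[OF assms] by blast
  have "k (h x) \<in> orb q p x" if "k \<in> lens_group q p" for k
    using lens_group_comp[OF that h] unfolding orb_def by (metis comp_apply image_eqI)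
  moreover have "k x \<in> orb q p (h x)" if "k \<in> lens_group q p" for k
  proof -
    have "k x = (k \<circ> h') (h x)" using h'(2) by (metis comp_apply id_apply)
    then show ?thesis using lens_group_comp[OF that h'(1)] unfolding orb_def by blast
  qed
  ultimately show ?thesis by (auto simp: orb_def)
qed

lemma cmax_ge: "q > 0 \<Longrightarrow> h \<in> lens_group q p \<Longrightarrow> x \<bullet> h y \<le> cmax q p x y"
  unfolding cmax_def by (intro Max_ge) (auto simp: finite_lens_group)

lemma cmax_attained: "q > 0 \<Longrightarrow> \<exists>h\<in>lens_group q p. cmax q p x y = x \<bullet> h y"
proof -
  assume q: "q > 0"
  have "Max ((\<lambda>h. x \<bullet> h y) ` lens_group q p) \<in> (\<lambda>h. x \<bullet> h y) ` lens_group q p"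
    by (rule Max_in) (use finite_lens_group[OF q, of p] id_lens_group[of q p] in auto)
  then show ?thesis unfolding cmax_def by blast
qed

lemma cmax_orbit:
  assumes q: "q > 0" and x: "x' \<in> orb q p x" and y: "y' \<in> orb q p y"
  shows "cmax q p x' y' = cmax q p x y"
proof -
  have le: "cmax q p (a x) (b y) \<le> cmax q p x y" if ab: "a \<in> lens_group q p" "b \<in> lens_group q p" for a b x y
  proof -
    obtain h where h: "h \<in> lens_group q p" "cmax q p (a x) (b y) = a x \<bullet> h (b y)" using cmax_attained[OF q] by blast
    obtain a' where a': "a' \<in> lens_group q p" "a' \<circ> a = id" using lens_group_inverse[OF q ab(1)] by blast
    have "a x \<bullet> h (b y) = a' (a x) \<bullet> a' (h (b y))" by (simp add: lens_group_inner[OF a'(1)])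
    also have "\<dots> = x \<bullet> (a' \<circ> (h \<circ> b)) y" using a'(2) by (metis comp_apply id_apply)
    also have "\<dots> \<le> cmax q p x y" by (intro cmax_ge q lens_group_comp a' h ab)
    finally show ?thesis using h by simp
  qed
  obtain a b where ab: "a \<in> lens_group q p" "b \<in> lens_group q p" "x' = a x" "y' = b y" using x y by (auto simp: orb_def)
  obtain a' where a': "a' \<in> lens_group q p" "a' \<circ> a = id" using lens_group_inverse[OF q ab(1)] by blast
  obtain b' where b': "b' \<in> lens_group q p" "b' \<circ> b = id" using lens_group_inverse[OF q ab(2)] by blast
  have "a' (a x) = x" "b' (b y) = y" using fun_cong[OF a'(2), of x] fun_cong[OF b'(2), of y] by simp_all
  then show ?thesis using le[OF ab(1,2), of x y] le[OF a'(1) b'(1), of "a x" "b y"] ab(3,4) by simp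
qed

lemma cmax_bounds:
  assumes "q > 0" "norm x = 1" "norm y = 1"
  shows "-1 \<le> cmax q p x y" "cmax q p x y \<le> 1"
proof -
  obtain h where h: "h \<in> lens_group q p" "cmax q p x y = x \<bullet> h y" using cmax_attained[OF assms(1)] by blast
  have "\<bar>x \<bullet> h y\<bar> \<le> 1" using Cauchy_Schwarz_ineq2[of x "h y"] assms(2,3) lens_group_norm[OF h(1)] by simp
  then show "-1 \<le> cmax q p x y" "cmax q p x y \<le> 1" using h by auto
qed

lemma orbit_dist_cmax:
  assumes q: "q > 0" and x: "norm x = 1" and y: "norm y = 1"
  shows "orbit_dist (orb q p x) (orb q p y) = arccos (cmax q p x y)"
  unfolding orbit_dist_def
proof (rule cInf_eq_minimum)
  obtain h where h: "h \<in> lens_group q p" "cmax q p x y = x \<bullet> h y" using cmax_attained[OF q] by blast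
  have "h y \<in> orb q p y" using h(1) by (simp add: orb_def)
  then show "arccos (cmax q p x y) \<in> {arccos (x' \<bullet> y') |x' y'. x' \<in> orb q p x \<and> y' \<in> orb q p y}"
    unfolding h(2) using orb_self[of x q p] by blast
next
  fix d assume "d \<in> {arccos (x' \<bullet> y') |x' y'. x' \<in> orb q p x \<and> y' \<in> orb q p y}"
  then obtain x' y' where d: "d = arccos (x' \<bullet> y')" "x' \<in> orb q p x" "y' \<in> orb q p y" by blast
  obtain h h' where "h \<in> lens_group q p" "x' = h x" "h' \<in> lens_group q p" "y' = h' y" using d(2,3) by (auto simp: orb_def)
  then have n: "norm x' = 1" "norm y' = 1" using x y by (simp_all add: lens_group_norm)
  have "x' \<bullet> y' \<le> cmax q p x' y'" using cmax_ge[OF q id_lens_group] by simp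
  also have "\<dots> = cmax q p x y" by (rule cmax_orbit[OF q d(2,3)])
  finally have "x' \<bullet> y' \<le> cmax q p x y" .
  moreover have "-1 \<le> x' \<bullet> y'" using Cauchy_Schwarz_ineq2[of x' y'] n by simp
  ultimately show "arccos (cmax q p x y) \<le> d" unfolding d(1) using cmax_bounds[OF q x y, of p] by (intro arccos_le_arccos) auto
qed

text \<open>\<open>\<phi>\<close> is an arbitrary choice of representatives, with no continuity;
  only distances between orbits are controlled. The choice depends on the orbit alone, which gives
  the last clause.\<close>

lemma lens_isometric_lift:
  fixes p s :: "'n::finite \<Rightarrow> int"
  assumes q: "q > 0" and iso: "lens_isometric q p s"
  shows "\<exists>\<phi>. (\<forall>x. norm x = 1 \<longrightarrow> norm (\<phi> x) = 1) \<and>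
     (\<forall>x y. norm x = 1 \<longrightarrow> norm y = 1 \<longrightarrow> cmax q s (\<phi> x) (\<phi> y) = cmax q p x y) \<and>
     (\<forall>y'. norm y' = 1 \<longrightarrow> (\<exists>y. norm y = 1 \<and> y' \<in> orb q s (\<phi> y))) \<and>
     (\<forall>h\<in>lens_group q p. \<forall>x. \<phi> (h x) = \<phi> x)"
proof -
  obtain \<Phi> where \<Phi>: "bij_betw \<Phi> (lens_orbits q p) (lens_orbits q s)"
    "\<And>A B. A \<in> lens_orbits q p \<Longrightarrow> B \<in> lens_orbits q p \<Longrightarrow> orbit_dist (\<Phi> A) (\<Phi> B) = orbit_dist A B"
    using iso unfolding lens_isometric_def by blast
  have orbs: "lens_orbits q r = {orb q r x |x. norm x = 1}" for r :: "'n \<Rightarrow> int"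
    unfolding lens_orbits_def orb_def by simp
  define \<phi> where "\<phi> x = (SOME y. norm y = 1 \<and> \<Phi> (orb q p x) = orb q s y)" for x
  have \<phi>: "norm (\<phi> x) = 1" "\<Phi> (orb q p x) = orb q s (\<phi> x)" if "norm x = 1" for x
  proof -
    have "\<exists>y. norm y = 1 \<and> \<Phi> (orb q p x) = orb q s y"
      using bij_betwE[OF \<Phi>(1)] that unfolding orbs by blast
    from someI_ex[OF this] show "norm (\<phi> x) = 1" "\<Phi> (orb q p x) = orb q s (\<phi> x)" unfolding \<phi>_def by auto
  qed
  have "cmax q s (\<phi> x) (\<phi> y) = cmax q p x y" if xy: "norm x = 1" "norm y = 1" for x y
  proof -
    have "orb q p x \<in> lens_orbits q p" "orb q p y \<in> lens_orbits q p" unfolding orbs using xy by blast+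
    from \<Phi>(2)[OF this] have "arccos (cmax q s (\<phi> x) (\<phi> y)) = arccos (cmax q p x y)"
      by (simp add: \<phi>[OF xy(1)] \<phi>[OF xy(2)] orbit_dist_cmax[OF q] xy)
    then have "cos (arccos (cmax q s (\<phi> x) (\<phi> y))) = cos (arccos (cmax q p x y))" by simp
    then show ?thesis
      using cmax_bounds[OF q xy, of p] cmax_bounds[OF q \<phi>(1)[OF xy(1)] \<phi>(1)[OF xy(2)], of s] by simp
  qed
  moreover have "\<exists>y. norm y = 1 \<and> y' \<in> orb q s (\<phi> y)" if y': "norm y' = 1" for y'
  proof -
    have "orb q s y' \<in> \<Phi> ` lens_orbits q p" using \<Phi>(1) y' unfolding bij_betw_def orbs by blast
    then obtain y where y: "norm y = 1" "orb q s y' = \<Phi> (orb q p y)" unfolding orbs by blast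
    then have "y' \<in> orb q s (\<phi> y)" using \<phi>(2)[OF y(1)] orb_self by metis
    then show ?thesis using y(1) by blast
  qed
  moreover have "\<phi> (h x) = \<phi> x" if "h \<in> lens_group q p" for h x
    unfolding \<phi>_def orb_eq[OF q that] ..
  ultimately show ?thesis using \<phi>(1) by (intro exI[of _ \<phi>]) blast
qed

section \<open>Regular points and local orthogonal lifts\<close>

lemma inner_le_iff_norm_diff:
  assumes "norm a = 1" "norm b = 1" "norm c = 1"
  shows "a \<bullet> b \<le> a \<bullet> c \<longleftrightarrow> norm (a - c) \<le> norm (a - b)"
proof -
  have "(norm (a - b))\<^sup>2 = 2 - 2 * (a \<bullet> b)" "(norm (a - c))\<^sup>2 = 2 - 2 * (a \<bullet> c)"
    using assms unfolding power2_norm_eq_inner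
    by (simp_all add: inner_diff_left inner_diff_right inner_commute norm_eq_1)
  moreover have "norm (a - c) \<le> norm (a - b) \<longleftrightarrow> (norm (a - c))\<^sup>2 \<le> (norm (a - b))\<^sup>2"
    by (simp add: power2_le_iff_abs_le abs_le_square_iff)
  ultimately show ?thesis by simp
qed

text \<open>The finitely many elements that move \<open>x\<close> move it by at least some
  \<open>d > 0\<close>, so near \<open>x\<close> they cannot bring two points closer
  together.\<close>

lemma near_inner_le:
  fixes p :: "'n::finite \<Rightarrow> int"
  assumes q: "q > 0"
  shows "\<exists>e>0. \<forall>a b. norm a = 1 \<longrightarrow> norm b = 1 \<longrightarrow> norm (a - x) < e \<longrightarrow> norm (b - x) < e \<longrightarrow>
    (\<forall>h\<in>lens_group q p. h x \<noteq> x \<longrightarrow> a \<bullet> h b \<le> a \<bullet> b)"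
proof -
  define H where "H = {h \<in> lens_group q p. h x \<noteq> x}"
  have fin: "finite H" unfolding H_def by (rule finite_subset[OF _ finite_lens_group[OF q]]) auto
  define d where "d = Min (insert 1 ((\<lambda>h. norm (h x - x)) ` H))"
  have d: "d > 0" unfolding d_def using fin by (subst Min_gr_iff) (auto simp: H_def)
  have dle: "d \<le> norm (h x - x)" if "h \<in> H" for h unfolding d_def using fin that by (intro Min_le) auto
  \<comment> \<open>With radius \<open>d / 5\<close>, \<open>norm (a - h b)\<close> exceeds
    \<open>3 d / 5\<close> while \<open>norm (a - b)\<close> stays below
    \<open>2 d / 5\<close>.\<close>
  have "a \<bullet> h b \<le> a \<bullet> b" if ab: "norm a = 1" "norm b = 1" "norm (a - x) < d / 5" "norm (b - x) < d / 5"
    and h: "h \<in> lens_group q p" "h x \<noteq> x" for a b h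
  proof -
    have hb: "norm (h b) = 1" using lens_group_norm[OF h(1)] ab(2) by simp
    have "h b - h x = h (b - x)" using linear_diff[OF lens_group_linear[OF h(1)]] by simp
    then have 1: "norm (h b - h x) < d / 5" using lens_group_norm[OF h(1), of "b - x"] ab(4) by simp
    have "norm (h x - x) \<le> norm (h b - h x) + norm (a - h b) + norm (a - x)"
      using norm_triangle_ineq[of "(h x - h b) + (h b - a)" "a - x"] norm_triangle_ineq[of "h x - h b" "h b - a"]
      by (simp add: norm_minus_commute)
    moreover have "norm (a - b) \<le> norm (a - x) + norm (b - x)"
      using norm_triangle_ineq4[of "a - x" "b - x"] by simp
    moreover have "d \<le> norm (h x - x)" using dle h by (simp add: H_def)
    ultimately have "norm (a - b) \<le> norm (a - h b)" using 1 ab(3,4) d by linarith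
    then show ?thesis using inner_le_iff_norm_diff[OF ab(1) hb ab(2)] by simp
  qed
  then show ?thesis using d by (intro exI[of _ "d / 5"]) auto
qed

definition regular_pt :: "nat \<Rightarrow> ('n::finite \<Rightarrow> int) \<Rightarrow> (real^'n) \<times> (real^'n) \<Rightarrow> bool" where
  "regular_pt q p x \<longleftrightarrow> (\<forall>h\<in>lens_group q p. h x = x \<longrightarrow> h = id)"

lemma cmax_near_regular:
  fixes p :: "'n::finite \<Rightarrow> int"
  assumes q: "q > 0" and reg: "regular_pt q p x"
  shows "\<exists>e>0. \<forall>a b. norm a = 1 \<longrightarrow> norm b = 1 \<longrightarrow> norm (a - x) < e \<longrightarrow> norm (b - x) < e \<longrightarrow> cmax q p a b = a \<bullet> b"
proof -
  obtain e where e: "e > 0" "\<And>a b h. norm a = 1 \<Longrightarrow> norm b = 1 \<Longrightarrow> norm (a - x) < e \<Longrightarrow> norm (b - x) < e \<Longrightarrow>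
    h \<in> lens_group q p \<Longrightarrow> h x \<noteq> x \<Longrightarrow> a \<bullet> h b \<le> a \<bullet> b" using near_inner_le[OF q, of x p] by blast
  have "cmax q p a b = a \<bullet> b" if ab: "norm a = 1" "norm b = 1" "norm (a - x) < e" "norm (b - x) < e" for a b
  proof (rule antisym)
    obtain h where h: "h \<in> lens_group q p" "cmax q p a b = a \<bullet> h b" using cmax_attained[OF q] by blast
    show "cmax q p a b \<le> a \<bullet> b"
    proof (cases "h x = x")
      case True
      then have "h = id" using reg h(1) by (simp add: regular_pt_def)
      then show ?thesis using h(2) by simp
    next
      case False
      then show ?thesis using e(2)[OF ab h(1)] h(2) by simp
    qed
    show "a \<bullet> b \<le> cmax q p a b" using cmax_ge[OF q id_lens_group] by simp
  qed
  then show ?thesis using e(1) by blast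
qed

lemma cos_norm_diff:
  assumes "norm a = 1" "norm b = 1"
  shows "(norm (a - b))\<^sup>2 = 2 - 2 * (a \<bullet> b)"
  using assms unfolding power2_norm_eq_inner
  by (simp add: inner_diff_left inner_diff_right inner_commute norm_eq_1)

lemma unit_inner_minus1:
  assumes "norm v = 1" "norm w = 1" "v \<bullet> w \<le> -1"
  shows "w = - v"
proof -
  have "(norm (v + w))\<^sup>2 = 2 + 2 * (v \<bullet> w)"
    using assms(1,2) unfolding power2_norm_eq_inner
    by (simp add: inner_add_left inner_add_right inner_commute norm_eq_1)
  then have "(norm (v + w))\<^sup>2 \<le> 0" using assms(3) by simp
  then have "v + w = 0" by simp
  then show ?thesis by (simp add: add_eq_0_iff)
qed

text \<open>A point is regular iff short geodesics through its image in the quotient can be reflected: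
  for every nearby \<open>y\<close> there is \<open>y\<^sup>*\<close> with \<open>d(x,y\<^sup>*) = d(x,y)\<close> and \<open>d(y,y\<^sup>*) = 2 d(x,y)\<close>.\<close>
lemma isometry_preserves_regular:
  fixes p s :: "'n::finite \<Rightarrow> int"
  assumes q: "q > 0"
    and \<phi>1: "\<And>x. norm x = 1 \<Longrightarrow> norm (\<phi> x) = 1"
    and \<phi>2: "\<And>x y. norm x = 1 \<Longrightarrow> norm y = 1 \<Longrightarrow> cmax q s (\<phi> x) (\<phi> y) = cmax q p x y"
    and \<phi>3: "\<And>y'. norm y' = 1 \<Longrightarrow> \<exists>y. norm y = 1 \<and> y' \<in> orb q s (\<phi> y)"
    and x: "norm x = 1" and reg: "regular_pt q p x"
  shows "regular_pt q s (\<phi> x)"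
  unfolding regular_pt_def
proof (intro ballI impI, rule ccontr)
  fix h' assume h': "h' \<in> lens_group q s" "h' (\<phi> x) = \<phi> x" "h' \<noteq> id"
  define x' where "x' = \<phi> x"
  have x': "norm x' = 1" "x' \<bullet> x' = 1" "h' x' = x'" using \<phi>1[OF x] h'(2) by (simp_all add: x'_def norm_eq_1)
  note lin = lens_group_linear[OF h'(1)]
  obtain v0 where v0: "h' v0 \<noteq> v0" using h'(3) by (auto simp: fun_eq_iff)
  \<comment> \<open>As \<open>h'\<close> fixes \<open>x'\<close>, it also moves the part of
    \<open>v0\<close> orthogonal to \<open>x'\<close>. This yields a tangent direction that the
    stabiliser moves.\<close>
  define v1 where "v1 = v0 - (v0 \<bullet> x') *\<^sub>R x'"
  have v1: "h' v1 \<noteq> v1" "v1 \<bullet> x' = 0"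
    using v0 x' by (simp_all add: v1_def linear_diff[OF lin] linear_scale[OF lin] inner_diff_left)
  have v1nz: "v1 \<noteq> 0" using v1(1) linear_0[OF lin] by auto
  define v where "v = sgn v1"
  have v: "h' v \<noteq> v" "v \<bullet> x' = 0" "norm v = 1"
    using v1 v1nz by (simp_all add: v_def sgn_div_norm linear_scale[OF lin])
  have hv: "norm (h' v) = 1" "h' v \<bullet> x' = 0"
    using v lens_group_norm[OF h'(1), of v] lens_group_inner[OF h'(1), of v x'] x'(3) by simp_all
  obtain e1 where e1: "e1 > 0" "\<And>a b h. norm a = 1 \<Longrightarrow> norm b = 1 \<Longrightarrow> norm (a - x') < e1 \<Longrightarrow> norm (b - x') < e1 \<Longrightarrow>
    h \<in> lens_group q s \<Longrightarrow> h x' \<noteq> x' \<Longrightarrow> a \<bullet> h b \<le> a \<bullet> b" using near_inner_le[OF q, of x' s] by blast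
  obtain e2 where e2: "e2 > 0" "\<And>a b. norm a = 1 \<Longrightarrow> norm b = 1 \<Longrightarrow> norm (a - x) < e2 \<Longrightarrow> norm (b - x) < e2 \<Longrightarrow> cmax q p a b = a \<bullet> b"
    using cmax_near_regular[OF q reg] by blast
  define e where "e = min (min e1 e2) 1"
  have e: "e > 0" "e \<le> e1" "e \<le> e2" "e \<le> 1" using e1 e2 by (auto simp: e_def)
  \<comment> \<open>Unit vectors with inner product \<open>C\<close> then have squared distance
    \<open>2 - 2 C = e^2 / 2\<close>, less than \<open>e^2\<close>.\<close>
  define C where "C = 1 - e\<^sup>2 / 4"
  have C: "0 < C" "C < 1" "2 - 2 * C < e\<^sup>2"
    using e power_le_one[of e 2] by (auto simp: C_def)
  define S where "S = sqrt (1 - C\<^sup>2)"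
  have CC: "C\<^sup>2 < 1" using C power_strict_mono[of C 1 2] by simp
  have S: "S > 0" "S\<^sup>2 = 1 - C\<^sup>2" using CC by (simp_all add: S_def)
  have near: "norm (a - b) < e" if "norm a = 1" "norm b = 1" "a \<bullet> b = C" for a b :: "(real^'n) \<times> (real^'n)"
  proof -
    have "(norm (a - b))\<^sup>2 < e\<^sup>2" using cos_norm_diff[OF that(1,2)] that(3) C(3) by simp
    then show ?thesis using e(1) by (simp add: power2_less_imp_less)
  qed
  define y' where "y' = C *\<^sub>R x' + S *\<^sub>R v"
  have xy': "x' \<bullet> y' = C" using x'(2) v(2) by (simp add: y'_def inner_add_right inner_commute)
  have y': "norm y' = 1"
  proof -
    have "y' \<bullet> y' = C\<^sup>2 + S\<^sup>2"
      using x'(2) v(2,3) by (simp add: y'_def inner_add_left inner_add_right inner_commute norm_eq_1 power2_eq_square)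
    then show ?thesis using S(2) by (simp add: norm_eq_1)
  qed
  have cx'y': "cmax q s x' y' = C"
  proof (rule antisym)
    obtain h where h: "h \<in> lens_group q s" "cmax q s x' y' = x' \<bullet> h y'" using cmax_attained[OF q] by blast
    show "cmax q s x' y' \<le> C"
    proof (cases "h x' = x'")
      case True
      then show ?thesis using h(2) lens_group_inner[OF h(1), of x' y'] xy' by simp
    next
      case False
      have "norm (y' - x') < e1" using near[OF y' x'(1)] xy' e by (simp add: inner_commute)
      then show ?thesis using e1(2)[OF x'(1) y' _ _ h(1) False] e1(1) h(2) xy' by simp
    qed
    show "C \<le> cmax q s x' y'" using cmax_ge[OF q id_lens_group, of x' y' s] xy' by simp
  qed
  obtain y where y: "norm y = 1" "y' \<in> orb q s (\<phi> y)" using \<phi>3[OF y'] by blast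
  have cxy: "cmax q p x y = C"
    using \<phi>2[OF x y(1)] cmax_orbit[OF q orb_self[of x' q s] y(2)] cx'y' by (simp add: x'_def)
  obtain h where h: "h \<in> lens_group q p" "C = x \<bullet> h y" using cmax_attained[OF q, of p x y] cxy by auto
  define y0 where "y0 = h y"
  have y0: "norm y0 = 1" "x \<bullet> y0 = C" "y0 \<in> orb q p y"
    using h y(1) lens_group_norm[OF h(1)] by (auto simp: y0_def orb_def)
  \<comment> \<open>The reflection of \<open>y0\<close> in the line through \<open>x\<close>. Its
    inner product with \<open>y0\<close> is \<open>2 C^2 - 1\<close>, the cosine of the doubled
    angle.\<close>
  define ys where "ys = (2 * C) *\<^sub>R x - y0"
  have xx: "x \<bullet> x = 1" "y0 \<bullet> y0 = 1" using x y0 by (simp_all add: norm_eq_1)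
  have xys: "x \<bullet> ys = C" "y0 \<bullet> ys = 2 * C\<^sup>2 - 1"
    using xx y0(2) by (simp_all add: ys_def inner_diff_right inner_commute power2_eq_square)
  have ys: "norm ys = 1"
  proof -
    have "ys \<bullet> ys = 2 * C * (x \<bullet> ys) - y0 \<bullet> ys" by (simp add: ys_def inner_diff_left)
    then show ?thesis using xys by (simp add: norm_eq_1 power2_eq_square)
  qed
  have c1: "cmax q p x ys = C"
    using e2(2)[OF x ys] near[OF ys x] xys e e2(1) by (simp add: inner_commute)
  have c2: "cmax q p y0 ys = 2 * C\<^sup>2 - 1"
    using e2(2)[OF y0(1) ys] near[OF ys x] near[OF y0(1) x] xys y0(2) e by (simp add: inner_commute)
  obtain k where k: "k \<in> lens_group q s" "cmax q s x' (\<phi> ys) = x' \<bullet> k (\<phi> ys)" using cmax_attained[OF q] by blast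
  define z where "z = k (\<phi> ys)"
  have z: "norm z = 1" "x' \<bullet> z = C" "z \<in> orb q s (\<phi> ys)"
    using k \<phi>2[OF x ys] c1 lens_group_norm[OF k(1)] \<phi>1[OF ys] by (auto simp: z_def x'_def orb_def)
  have cyz: "cmax q s y' z = 2 * C\<^sup>2 - 1"
    using cmax_orbit[OF q y(2) z(3)] \<phi>2[OF y(1) ys] cmax_orbit[OF q y0(3) orb_self[of ys q p]] c2 by simp
  have b1: "y' \<bullet> z \<le> 2 * C\<^sup>2 - 1" using cmax_ge[OF q id_lens_group, of y' z s] cyz by simp
  \<comment> \<open>The stabiliser provides a second representative of the same orbit, equally far
    from \<open>x'\<close>. Since \<open>z\<close> is far from both, its direction \<open>w\<close>
    must be opposite to \<open>v\<close> and to \<open>h' v\<close>, which differ.\<close>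
  have hy': "h' y' \<in> orb q s (\<phi> y)" using y(2) lens_group_comp[OF h'(1)] unfolding orb_def by (auto simp: image_iff) (metis comp_apply)
  have b2: "h' y' \<bullet> z \<le> 2 * C\<^sup>2 - 1"
    using cmax_ge[OF q id_lens_group, of "h' y'" z s] cmax_orbit[OF q hy' z(3)] cmax_orbit[OF q y(2) z(3)] cyz by simp
  define w where "w = (1 / S) *\<^sub>R (z - C *\<^sub>R x')"
  have zw: "z = C *\<^sub>R x' + S *\<^sub>R w" using S(1) by (simp add: w_def)
  have wx: "w \<bullet> x' = 0" using z(2) x'(2) by (simp add: w_def inner_diff_left inner_diff_right inner_commute)
  have zz: "z \<bullet> z = 1" using z(1) by (simp add: norm_eq_1)
  have "z \<bullet> z = C\<^sup>2 + S\<^sup>2 * (w \<bullet> w)" using x'(2) wx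
    by (subst (1 2) zw) (simp add: inner_add_left inner_add_right inner_commute power2_eq_square)
  then have "S\<^sup>2 * (w \<bullet> w) = S\<^sup>2" using zz S(2) by linarith
  then have w1: "norm w = 1" using S(1) by (simp add: norm_eq_1)
  have S2: "2 * C\<^sup>2 - 1 = C\<^sup>2 - S\<^sup>2" using S(2) by simp
  have key: "u \<bullet> w \<le> -1" if "u \<bullet> x' = 0" "(C *\<^sub>R x' + S *\<^sub>R u) \<bullet> z \<le> 2 * C\<^sup>2 - 1" for u
  proof -
    have "(C *\<^sub>R x' + S *\<^sub>R u) \<bullet> z = C\<^sup>2 + S\<^sup>2 * (u \<bullet> w)"
      unfolding zw using x'(2) wx that(1) by (simp add: inner_add_left inner_add_right inner_commute power2_eq_square)
    then have "S\<^sup>2 * (u \<bullet> w) \<le> S\<^sup>2 * (-1)" using that(2) S2 by simp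
    then show ?thesis using S(1) mult_le_cancel_left_pos[of "S\<^sup>2" "u \<bullet> w" "-1"] by simp
  qed
  have "h' y' = C *\<^sub>R x' + S *\<^sub>R h' v" by (simp add: y'_def linear_add[OF lin] linear_scale[OF lin] x'(3))
  then have "v \<bullet> w \<le> -1" "h' v \<bullet> w \<le> -1" using key[OF v(2)] key[OF hv(2)] b1 b2 by (simp_all add: y'_def)
  then have "w = - v" "w = - h' v" using unit_inner_minus1 v(3) hv(1) w1 by blast+
  then show False using v(1) by simp
qed

text \<open>\<open>x\<close> and its image are both regular, so near each of them
  \<open>cmax\<close> is the plain inner product. Choosing in every image orbit a representative
  nearest to \<open>x'\<close> gives a map on a small cap that preserves inner products, and such a
  map extends to an orthogonal one.\<close>

lemma isometry_local_lift:
  fixes p s :: "'n::finite \<Rightarrow> int"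
  assumes q: "q > 0"
    and \<phi>1: "\<And>x. norm x = 1 \<Longrightarrow> norm (\<phi> x) = 1"
    and \<phi>2: "\<And>x y. norm x = 1 \<Longrightarrow> norm y = 1 \<Longrightarrow> cmax q s (\<phi> x) (\<phi> y) = cmax q p x y"
    and \<phi>3: "\<And>y'. norm y' = 1 \<Longrightarrow> \<exists>y. norm y = 1 \<and> y' \<in> orb q s (\<phi> y)"
    and x: "norm x = 1" and reg: "regular_pt q p x"
  shows "\<exists>e>0. \<exists>U. orthogonal_transformation U \<and> (\<forall>z. norm z = 1 \<longrightarrow> norm (z - x) < e \<longrightarrow> U z \<in> orb q s (\<phi> z))"
proof -
  define x' where "x' = \<phi> x"
  have x': "norm x' = 1" using \<phi>1[OF x] by (simp add: x'_def)
  have reg': "regular_pt q s x'" unfolding x'_def by (rule isometry_preserves_regular[OF assms])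
  obtain e1 where e1: "e1 > 0" "\<And>a b. norm a = 1 \<Longrightarrow> norm b = 1 \<Longrightarrow> norm (a - x) < e1 \<Longrightarrow> norm (b - x) < e1 \<Longrightarrow> cmax q p a b = a \<bullet> b"
    using cmax_near_regular[OF q reg] by blast
  obtain e2 where e2: "e2 > 0" "\<And>a b. norm a = 1 \<Longrightarrow> norm b = 1 \<Longrightarrow> norm (a - x') < e2 \<Longrightarrow> norm (b - x') < e2 \<Longrightarrow> cmax q s a b = a \<bullet> b"
    using cmax_near_regular[OF q reg'] by blast
  define e where "e = min e1 e2"
  have e: "e > 0" "e \<le> e1" "e \<le> e2" using e1 e2 by (auto simp: e_def)
  define Z where "Z = {z. norm z = 1 \<and> norm (z - x) < e}"
  have "\<forall>z\<in>Z. \<exists>u\<in>orb q s (\<phi> z). norm u = 1 \<and> norm (u - x') < e"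
  proof
    fix z assume z: "z \<in> Z"
    then have z1: "norm z = 1" "norm (z - x) < e" by (auto simp: Z_def)
    obtain k where k: "k \<in> lens_group q s" "cmax q s x' (\<phi> z) = x' \<bullet> k (\<phi> z)" using cmax_attained[OF q] by blast
    have u: "norm (k (\<phi> z)) = 1" using lens_group_norm[OF k(1)] \<phi>1[OF z1(1)] by simp
    have "x' \<bullet> k (\<phi> z) = x \<bullet> z"
      using k(2) \<phi>2[OF x z1(1)] e1(2)[OF x z1(1)] z1(2) e e1(1) by (simp add: x'_def)
    then have "(norm (k (\<phi> z) - x'))\<^sup>2 = (norm (z - x))\<^sup>2"
      using cos_norm_diff[OF u x'] cos_norm_diff[OF z1(1) x] by (simp add: inner_commute)
    then have "norm (k (\<phi> z) - x') < e" using z1(2) by simp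
    then show "\<exists>u\<in>orb q s (\<phi> z). norm u = 1 \<and> norm (u - x') < e" using u k(1) unfolding orb_def by blast
  qed
  then obtain \<psi> where \<psi>: "\<forall>z\<in>Z. \<psi> z \<in> orb q s (\<phi> z) \<and> norm (\<psi> z) = 1 \<and> norm (\<psi> z - x') < e"
    by (metis (no_types, lifting))
  have pres: "\<psi> a \<bullet> \<psi> b = a \<bullet> b" if ab: "a \<in> Z" "b \<in> Z" for a b
  proof -
    have n: "norm a = 1" "norm (a - x) < e1" "norm b = 1" "norm (b - x) < e1" using ab e by (auto simp: Z_def)
    note pa = bspec[OF \<psi> ab(1)] and pb = bspec[OF \<psi> ab(2)]
    have "\<psi> a \<bullet> \<psi> b = cmax q s (\<psi> a) (\<psi> b)" using e2(2)[of "\<psi> a" "\<psi> b"] pa pb e by simp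
    also have "\<dots> = cmax q s (\<phi> a) (\<phi> b)" using cmax_orbit[OF q] pa pb by blast
    also have "\<dots> = a \<bullet> b" using \<phi>2 e1(2) n by simp
    finally show ?thesis .
  qed
  have "span Z = UNIV" unfolding Z_def by (rule sphere_ball_spans[OF x e(1)])
  from inner_preserving_extends[of Z \<psi>, OF pres this]
  obtain U where U: "orthogonal_transformation U" "\<forall>z\<in>Z. \<psi> z = U z" by blast
  have "U z \<in> orb q s (\<phi> z)" if "norm z = 1" "norm (z - x) < e" for z
  proof -
    have "z \<in> Z" using that by (simp add: Z_def)
    then show ?thesis using bspec[OF \<psi>] bspec[OF U(2)] by metis
  qed
  then show ?thesis using e(1) U(1) by blast
qed

text \<open>The points with no coordinate \<open>z\<^sub>j\<close> in \<open>(-\<infinity>, 0]\<close>. Nontrivial rotations move every point with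
  all coordinates nonzero.\<close>
definition slit :: "((real^'n::finite) \<times> (real^'n)) set" where
  "slit = {z. \<forall>j. fst z $ j > 0 \<or> snd z $ j \<noteq> 0}"

lemma open_slit: "open slit"
proof -
  have eq: "slit = (\<Inter>j. {z :: (real^'n) \<times> (real^'n). 0 < fst z $ j} \<union> - {z. snd z $ j = 0})"
    by (auto simp: slit_def)
  show ?thesis unfolding eq
    by (intro open_INT ballI open_Un open_Collect_less open_Compl closed_Collect_eq) (auto intro!: continuous_intros)
qed

lemma connected_slit: "connected (slit :: ((real^'n::finite) \<times> (real^'n)) set)"
proof (rule starlike_imp_connected)
  let ?o = "((\<chi> j. 1), 0) :: (real^'n) \<times> (real^'n)"
  have "closed_segment ?o z \<subseteq> slit" if z: "z \<in> slit" for z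
  proof
    fix w assume "w \<in> closed_segment ?o z"
    then obtain u where u: "0 \<le> u" "u \<le> 1" "w = (1 - u) *\<^sub>R ?o + u *\<^sub>R z" by (auto simp: in_segment)
    have "fst w $ j > 0 \<or> snd w $ j \<noteq> 0" for j
    proof -
      have c: "fst w $ j = (1 - u) + u * fst z $ j" "snd w $ j = u * snd z $ j" by (simp_all add: u(3))
      show ?thesis
      proof (cases "u = 0")
        case True then show ?thesis using c by simp
      next
        case False
        then have "fst z $ j > 0 \<Longrightarrow> fst w $ j > 0" using c u by (simp add: add_nonneg_pos)
        then show ?thesis using z c False by (auto simp: slit_def)
      qed
    qed
    then show "w \<in> slit" by (simp add: slit_def)
  qed
  moreover have "?o \<in> slit" by (simp add: slit_def)
  ultimately show "starlike (slit :: ((real^'n) \<times> (real^'n)) set)" unfolding starlike_def by blast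
qed

lemma slit_nonzero: "z \<in> slit \<Longrightarrow> z \<noteq> 0"
  by (auto simp: slit_def)

lemma zero_slit: "0 \<notin> slit"
  using slit_nonzero by blast

lemma rot_fixes_nonvanishing:
  assumes "\<And>j. fst x $ j \<noteq> 0 \<or> snd x $ j \<noteq> 0" "rot \<theta> x = x"
  shows "rot \<theta> = id"
proof -
  have "cis (\<theta> j) = 1" for j
  proof -
    have e: "cos (\<theta> j) * fst x $ j + sin (\<theta> j) * snd x $ j = fst x $ j"
      "- sin (\<theta> j) * fst x $ j + cos (\<theta> j) * snd x $ j = snd x $ j"
      using rot_comps[of \<theta> x j] assms(2) by simp_all
    have "cis (- \<theta> j) * Complex (fst x $ j) (snd x $ j) = Complex (fst x $ j) (snd x $ j)"
      using e by (simp add: complex_eq_iff)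
    moreover have "Complex (fst x $ j) (snd x $ j) \<noteq> 0" using assms(1)[of j] by (simp add: complex_eq_iff)
    ultimately have "cis (- \<theta> j) = 1" by simp
    then show ?thesis by (simp add: complex_eq_iff)
  qed
  then have "rot \<theta> z = rot (\<lambda>j. 0) z" for z by (intro rot_cong) simp
  then show ?thesis by (auto simp: rot_zero)
qed

lemma slit_regular:
  assumes "z \<in> slit"
  shows "regular_pt q p (sgn z)"
  unfolding regular_pt_def
proof (intro ballI impI)
  fix h assume h: "h \<in> lens_group q p" "h (sgn z) = sgn z"
  obtain \<theta> where t: "h = rot \<theta>" using lens_group_rot[OF h(1)] by blast
  have "fst (sgn z) $ j \<noteq> 0 \<or> snd (sgn z) $ j \<noteq> 0" for j
    using assms slit_nonzero[OF assms] by (auto simp: slit_def sgn_div_norm dest!: spec[of _ j])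
  then show "h = id" using rot_fixes_nonvanishing h(2) unfolding t by blast
qed

text \<open>A local lift \<open>U\<close> is continued over the slit domain by connectedness. Where
  both \<open>z\<close> and its image under the generator lie in that domain, \<open>U\<close> and
  \<open>U\<close> after the generator lift the same map, so they differ by one element of the
  second group.\<close>

lemma isometric_imp_conjugate:
  fixes p s :: "'n::finite \<Rightarrow> int"
  assumes q: "q > 0" and iso: "lens_isometric q p s"
  shows "\<exists>U. orthogonal_transformation U \<and> (\<exists>h\<in>lens_group q s. \<forall>z. U (lens_gen q p z) = h (U z))"
proof -
  obtain \<phi> where \<phi>: "\<forall>x. norm x = 1 \<longrightarrow> norm (\<phi> x) = 1"
     "\<forall>x y. norm x = 1 \<longrightarrow> norm y = 1 \<longrightarrow> cmax q s (\<phi> x) (\<phi> y) = cmax q p x y"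
     "\<forall>y'. norm y' = 1 \<longrightarrow> (\<exists>y. norm y = 1 \<and> y' \<in> orb q s (\<phi> y))"
     "\<forall>h\<in>lens_group q p. \<forall>x. \<phi> (h x) = \<phi> x"
    using lens_isometric_lift[OF assms] by (elim exE conjE)
  \<comment> \<open>Normalising by \<open>sgn\<close> lets open sets of the ambient space stand for
    open sets of the sphere.\<close>
  define P where "P U z \<longleftrightarrow> U (sgn z) \<in> orb q s (\<phi> (sgn z))" for U z
  have sgn1: "norm (sgn z) = 1" if "z \<noteq> 0" for z :: "(real^'n) \<times> (real^'n)" using that by (simp add: norm_sgn)
  have local: "\<exists>N U. open N \<and> y \<in> N \<and> N \<subseteq> slit \<and> orthogonal_transformation U \<and> (\<forall>z\<in>N. P U z)" if y: "y \<in> slit" for y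
  proof -
    note y0 = slit_nonzero[OF y]
    have "\<exists>e>0. \<exists>U. orthogonal_transformation U \<and> (\<forall>z. norm z = 1 \<longrightarrow> norm (z - sgn y) < e \<longrightarrow> U z \<in> orb q s (\<phi> z))"
      by (rule isometry_local_lift[OF q _ _ _ sgn1[OF y0] slit_regular[OF y]]) (use \<phi> in blast)+
    then obtain e U where eU: "e > 0" "orthogonal_transformation U" "\<And>z. norm z = 1 \<Longrightarrow> norm (z - sgn y) < e \<Longrightarrow> U z \<in> orb q s (\<phi> z)"
      by blast
    define N where "N = slit \<inter> {z. norm (sgn z - sgn y) < e}"
    have "continuous_on slit (\<lambda>z :: (real^'n) \<times> (real^'n). norm (sgn z - sgn y))"
      unfolding sgn_div_norm using slit_nonzero by (intro continuous_intros) auto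
    then have "open (slit \<inter> (\<lambda>z. norm (sgn z - sgn y)) -` {..<e})"
      by (rule continuous_open_preimage[OF _ open_slit open_lessThan])
    moreover have "slit \<inter> (\<lambda>z. norm (sgn z - sgn y)) -` {..<e} = N" by (auto simp: N_def)
    ultimately have "open N" by simp
    moreover have "y \<in> N" using y eU(1) by (simp add: N_def)
    moreover have "\<forall>z\<in>N. P U z"
    proof
      fix z assume "z \<in> N"
      then show "P U z" unfolding P_def using eU(3)[OF sgn1[OF slit_nonzero]] by (simp add: N_def)
    qed
    ultimately show ?thesis using eU(2) by (intro exI[of _ N] exI[of _ U]) (auto simp: N_def)
  qed
  have orb_swap: "\<exists>h\<in>lens_group q s. a = h b" if ab: "a \<in> orb q s c" "b \<in> orb q s c" for a b c
  proof -
    obtain h k where hk: "h \<in> lens_group q s" "a = h c" "k \<in> lens_group q s" "b = k c" using ab by (auto simp: orb_def)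
    obtain k' where k': "k' \<in> lens_group q s" "k' \<circ> k = id" using lens_group_inverse[OF q hk(3)] by blast
    have "(h \<circ> k') b = a" using hk fun_cong[OF k'(2), of c] by simp
    then show ?thesis using lens_group_comp[OF hk(1) k'(1)] by metis
  qed
  have unsgn: "f z = g z" if "linear f" "linear g" "f (sgn z) = g (sgn z)" "z \<noteq> 0" for f g :: "(real^'n) \<times> (real^'n) \<Rightarrow> (real^'n) \<times> (real^'n)" and z
    using that by (simp add: sgn_div_norm linear_scale)
  have unique: "\<exists>h\<in>lens_group q s. \<forall>z. U z = h (V z)"
    if UV: "linear U" "linear V" and N: "open N" "N \<noteq> {}" "\<And>z. z \<in> N \<Longrightarrow> z \<noteq> 0"
      and O: "\<And>z. z \<in> N \<Longrightarrow> U (sgn z) \<in> orb q s (c z)" "\<And>z. z \<in> N \<Longrightarrow> V (sgn z) \<in> orb q s (c z)"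
    for U V :: "(real^'n) \<times> (real^'n) \<Rightarrow> (real^'n) \<times> (real^'n)" and N c
  proof (rule finite_cover_linear_eq[OF finite_lens_group[OF q] lens_group_linear UV N(1,2)])
    fix z assume z: "z \<in> N"
    obtain h where h: "h \<in> lens_group q s" "U (sgn z) = h (V (sgn z))" using orb_swap[OF O[OF z]] by blast
    have "linear (\<lambda>z. h (V z))" using linear_compose[OF UV(2) lens_group_linear[OF h(1)]] by (simp add: o_def)
    then have "U z = h (V z)" using unsgn[where f=U and g="\<lambda>z. h (V z)", OF UV(1) _ h(2) N(3)[OF z]] by blast
    then show "\<exists>h\<in>lens_group q s. U z = h (V z)" using h(1) by blast
  qed
  obtain y0 :: "(real^'n) \<times> (real^'n)" where y0: "y0 \<in> slit" using that[of "((\<chi> j. 1), 0)"] by (simp add: slit_def)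
  obtain N0 U where U: "open N0" "y0 \<in> N0" "N0 \<subseteq> slit" "orthogonal_transformation U" "\<forall>z\<in>N0. P U z"
    using local[OF y0] by blast
  have linU: "linear U" using U(4) by (simp add: orthogonal_transformation_def)
  \<comment> \<open>\<open>A\<close> is the open region where \<open>U\<close> lifts. A point
    outside it has a neighbourhood disjoint from it: if a local lift overlapped with
    \<open>A\<close>, it would agree with \<open>U\<close> up to a group element, and
    \<open>U\<close> would lift there too.\<close>
  define A where "A = \<Union>{N. open N \<and> N \<subseteq> slit \<and> (\<forall>z\<in>N. P U z)}"
  define B where "B = \<Union>{N. open N \<and> N \<subseteq> slit \<and> N \<inter> A = {}}"
  have oA: "open A" "open B" unfolding A_def B_def by (auto intro: open_Union)
  have AB: "slit \<subseteq> A \<union> B"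
  proof
    fix y :: "(real^'n) \<times> (real^'n)" assume y: "y \<in> slit"
    obtain N V where V: "open N" "y \<in> N" "N \<subseteq> slit" "orthogonal_transformation V" "\<forall>z\<in>N. P V z"
      using local[OF y] by blast
    have linV: "linear V" using V(4) by (simp add: orthogonal_transformation_def)
    show "y \<in> A \<union> B"
    proof (cases "N \<inter> A = {}")
      case True
      then show ?thesis using V by (auto simp: B_def)
    next
      case False
      then obtain M w where M: "w \<in> N" "w \<in> M" "open M" "M \<subseteq> slit" "\<forall>z\<in>M. P U z" by (auto simp: A_def)
      have "\<exists>h\<in>lens_group q s. \<forall>z. U z = h (V z)"
        by (rule unique[OF linU linV, of "N \<inter> M" "\<lambda>z. \<phi> (sgn z)"])
          (use V M zero_slit in \<open>auto simp: P_def\<close>)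
      then obtain h where h: "h \<in> lens_group q s" "\<And>z. U z = h (V z)" by blast
      have "P U z" if "z \<in> N" for z
      proof -
        have "V (sgn z) \<in> orb q s (\<phi> (sgn z))" using V(5) that by (auto simp: P_def)
        then obtain k where "k \<in> lens_group q s" "V (sgn z) = k (\<phi> (sgn z))" by (auto simp: orb_def)
        then have "U (sgn z) = (h \<circ> k) (\<phi> (sgn z))" "h \<circ> k \<in> lens_group q s" using h lens_group_comp by auto
        then show ?thesis unfolding P_def orb_def by blast
      qed
      then show ?thesis using V by (auto simp: A_def)
    qed
  qed
  have "A \<inter> B \<inter> slit = {}" by (auto simp: B_def)
  then have "A \<inter> slit = {} \<or> B \<inter> slit = {}"
    using connectedD[OF connected_slit oA _ AB] by blast
  moreover have "y0 \<in> A" using U by (auto simp: A_def)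
  ultimately have "slit \<subseteq> A" using AB y0 by blast
  then have PU: "P U z" if "z \<in> slit" for z using that by (auto simp: A_def)
  have g: "lens_gen q p \<in> lens_group q p" unfolding lens_group_def by (rule CollectI, rule exI[of _ 1]) simp
  have ling: "linear (lens_gen q p)" by (rule lens_group_linear[OF g])
  have sg: "sgn (lens_gen q p z) = lens_gen q p (sgn z)" for z
    by (simp add: sgn_div_norm lens_group_norm[OF g] linear_scale[OF ling])
  define N where "N = slit \<inter> lens_gen q p -` slit"
  have "open (lens_gen q p -` slit)"
    by (rule open_vimage[OF open_slit]) (use ling linear_continuous_on linear_conv_bounded_linear in blast)
  then have oN: "open N" unfolding N_def using open_slit by blast
  define \<theta> where "\<theta> j = 2 * pi * real_of_int (p j) / real q" for j
  \<comment> \<open>A witness that the generator does not carry the slit domain off itself. A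
    coordinate \<open>1\<close> gets a nonzero imaginary part when the sine is nonzero; otherwise
    the rotation is by a sign and \<open>i\<close> keeps a nonzero imaginary part.\<close>
  define m :: "(real^'n) \<times> (real^'n)" where "m = ((\<chi> j. if sin (\<theta> j) = 0 then 0 else 1), (\<chi> j. if sin (\<theta> j) = 0 then 1 else 0))"
  have "m \<in> slit" by (simp add: slit_def m_def)
  moreover have "lens_gen q p m \<in> slit"
  proof -
    have "fst (rot \<theta> m) $ j > 0 \<or> snd (rot \<theta> m) $ j \<noteq> 0" for j
      using sin_zero_abs_cos_one[of "\<theta> j"] by (auto simp: rot_comps m_def)
    then show ?thesis unfolding lens_gen_rot \<theta>_def[abs_def, symmetric] by (simp add: slit_def \<theta>_def[abs_def])
  qed
  ultimately have neN: "N \<noteq> {}" by (auto simp: N_def)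
  have "\<exists>h\<in>lens_group q s. \<forall>z. U (lens_gen q p z) = h (U z)"
  proof (rule unique[OF _ linU oN neN, of "\<lambda>z. U (lens_gen q p z)" "\<lambda>z. \<phi> (sgn z)"])
    show "linear (\<lambda>z. U (lens_gen q p z))" using linear_compose[OF ling linU] by (simp add: o_def)
    fix z assume z: "z \<in> N"
    then have zz: "z \<in> slit" "lens_gen q p z \<in> slit" by (auto simp: N_def)
    show "z \<noteq> 0" using slit_nonzero[OF zz(1)] .
    show "U (sgn z) \<in> orb q s (\<phi> (sgn z))" using PU[OF zz(1)] by (simp add: P_def)
    show "U (lens_gen q p (sgn z)) \<in> orb q s (\<phi> (sgn z))"
      using PU[OF zz(2)] \<phi>(4) g unfolding P_def sg by metis
  qed
  then show ?thesis using U(4) by blast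
qed

text \<open>A rotation plus its inverse acts on each coordinate plane as the scalar twice the
  cosine. \<open>U\<close> carries \<open>bx i\<close> to an eigenvector on the other side, and any
  coordinate \<open>j\<close> where that vector is nonzero gives equal cosines, hence angles equal
  up to sign and full turns.\<close>

lemma conjugate_imp_congruent:
  fixes p s :: "'n::finite \<Rightarrow> int"
  assumes q: "q > 0" and U: "orthogonal_transformation U" and h: "h \<in> lens_group q s"
    and conj: "\<And>z. U (lens_gen q p z) = h (U z)"
  shows "\<exists>k::int. \<forall>i. \<exists>j. int q dvd (p i - k * s j) \<or> int q dvd (p i + k * s j)"
proof -
  obtain k where k: "h = lens_gen q s ^^ k" using h by (auto simp: lens_group_def)
  define \<theta> where "\<theta> j = 2 * pi * real_of_int (p j) / real q" for j
  define \<eta> where "\<eta> j = real k * (2 * pi * real_of_int (s j) / real q)" for j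
  have c1: "U (rot \<theta> z) = rot \<eta> (U z)" for z
    using conj[of z] unfolding k lens_gen_power unfolding lens_gen_rot \<theta>_def[abs_def] \<eta>_def[abs_def] .
  have c2: "U (rot (\<lambda>j. - \<theta> j) z) = rot (\<lambda>j. - \<eta> j) (U z)" for z
  proof -
    have "U z = rot \<eta> (U (rot (\<lambda>j. - \<theta> j) z))" using c1[of "rot (\<lambda>j. - \<theta> j) z"] by (simp add: rot_rot rot_zero)
    then have "rot (\<lambda>j. - \<eta> j) (U z) = rot (\<lambda>j. - \<eta> j) (rot \<eta> (U (rot (\<lambda>j. - \<theta> j) z)))" by simp
    then show ?thesis by (simp add: rot_rot rot_zero)
  qed
  have lin: "linear U" using U by (simp add: orthogonal_transformation_def)
  have "\<exists>j. int q dvd (p i - int k * s j) \<or> int q dvd (p i + int k * s j)" for i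
  proof -
    define v where "v = bx i"
    have v: "rot \<theta> v + rot (\<lambda>j. - \<theta> j) v = (2 * cos (\<theta> i)) *\<^sub>R v"
      by (rule prod_vec_eqI) (auto simp: v_def rot_comps bx_bw_comps)
    define u where "u = U v"
    have "rot \<eta> u + rot (\<lambda>j. - \<eta> j) u = U (rot \<theta> v + rot (\<lambda>j. - \<theta> j) v)"
      by (simp add: u_def c1 c2 linear_add[OF lin])
    also have "\<dots> = (2 * cos (\<theta> i)) *\<^sub>R u" unfolding v u_def by (rule linear_scale[OF lin])
    finally have e: "rot \<eta> u + rot (\<lambda>j. - \<eta> j) u = (2 * cos (\<theta> i)) *\<^sub>R u" .
    have "norm u = norm v" unfolding u_def using orthogonal_transformation_norm[OF U] .
    moreover have "norm v = 1" by (simp add: v_def bx_def norm_Pair)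
    ultimately have "u \<noteq> 0" by auto
    then obtain j where j: "fst u $ j \<noteq> 0 \<or> snd u $ j \<noteq> 0"
      using prod_vec_eqI[of u 0] by auto
    have "2 * cos (\<eta> j) * fst u $ j = 2 * cos (\<theta> i) * fst u $ j" "2 * cos (\<eta> j) * snd u $ j = 2 * cos (\<theta> i) * snd u $ j"
      using arg_cong[OF e, of "\<lambda>z. fst z $ j"] arg_cong[OF e, of "\<lambda>z. snd z $ j"] by (simp_all add: rot_comps)
    then have "cos (\<theta> i) = cos (\<eta> j)" using j by auto
    then obtain n where n: "n \<in> \<int>" "\<theta> i = \<eta> j + 2 * n * pi \<or> \<theta> i = - \<eta> j + 2 * n * pi" unfolding cos_eq by blast
    obtain n' where n': "n = of_int n'" using n(1) by (elim Ints_cases)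
    have "2 * pi * real_of_int (p i) = real q * \<theta> i" "2 * pi * real_of_int (int k * s j) = real q * \<eta> j"
      using q by (simp_all add: \<theta>_def \<eta>_def)
    note pq = this
    have "2 * pi * real_of_int (p i) = 2 * pi * real_of_int (int k * s j + int q * n') \<or>
       2 * pi * real_of_int (p i) = 2 * pi * real_of_int (- (int k * s j) + int q * n')"
      using n(2)
    proof
      assume t: "\<theta> i = \<eta> j + 2 * n * pi"
      have "2 * pi * real_of_int (p i) = 2 * pi * real_of_int (int k * s j) + real q * (2 * of_int n' * pi)"
        unfolding pq t n' by (simp only: distrib_left)
      then show ?thesis by (simp add: algebra_simps)
    next
      assume t: "\<theta> i = - \<eta> j + 2 * n * pi"
      have "2 * pi * real_of_int (p i) = - (2 * pi * real_of_int (int k * s j)) + real q * (2 * of_int n' * pi)"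
        unfolding pq t n' by (simp only: distrib_left mult_minus_right)
      then show ?thesis by (simp add: algebra_simps)
    qed
    then have "real_of_int (p i) = real_of_int (int k * s j + int q * n') \<or>
       real_of_int (p i) = real_of_int (- (int k * s j) + int q * n')"
      by simp
    then have "p i = int k * s j + int q * n' \<or> p i = - (int k * s j) + int q * n'" by (simp only: of_int_eq_iff)
    then have "int q dvd (p i - int k * s j) \<or> int q dvd (p i + int k * s j)" by auto
    then show ?thesis by blast
  qed
  then show ?thesis by blast
qed

section \<open>The four families\<close>

lemma dvd_pm_cancel:
  fixes c x y :: int
  assumes "c dvd (x - y) \<or> c dvd (x + y)" "c dvd y"
  shows "c dvd x"
  using assms(1)
proof
  assume "c dvd (x - y)"
  then have "c dvd (x - y) + y" using assms(2) by (rule dvd_add)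
  then show ?thesis by simp
next
  assume "c dvd (x + y)"
  then have "c dvd (x + y) - y" using assms(2) by (rule dvd_diff)
  then show ?thesis by simp
qed

lemma coprime_dvd_pm:
  fixes x y k q :: int
  assumes "coprime x q" "q dvd (x - k * y) \<or> q dvd (x + k * y)"
  shows "coprime k q"
proof (rule coprimeI)
  fix c assume c: "c dvd k" "c dvd q"
  have "c dvd (x - k * y) \<or> c dvd (x + k * y)" using assms(2) c(2) dvd_trans by blast
  then have "c dvd x" by (rule dvd_pm_cancel) (use c(1) in simp)
  from coprime_common_divisor[OF assms(1) this c(2)] show "is_unit c" .
qed

lemma not_congruent_weights:
  assumes q: "q > 0" and ab: "a \<in> {2..int q div 2}" "b \<in> {2..int q div 2}" "a \<noteq> b"
    and a: "\<not> coprime a (int q)" and t: "t \<in> {1..int q div 2} - {1, a}" "coprime t (int q)"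
  shows "\<not> (\<exists>k. \<forall>x\<in>{1..int q div 2} - {1, a}. \<exists>y\<in>{1..int q div 2} - {1, b}. int q dvd (x - k * y) \<or> int q dvd (x + k * y))"
proof
  assume "\<exists>k. \<forall>x\<in>{1..int q div 2} - {1, a}. \<exists>y\<in>{1..int q div 2} - {1, b}. int q dvd (x - k * y) \<or> int q dvd (x + k * y)"
  then obtain k where k: "\<And>x. x \<in> {1..int q div 2} - {1, a} \<Longrightarrow> \<exists>y\<in>{1..int q div 2} - {1, b}. int q dvd (x - k * y) \<or> int q dvd (x + k * y)"
    by blast
  have q4: "int q \<ge> 4" using ab by auto
  \<comment> \<open>The unit weight \<open>t\<close> forces \<open>k\<close> to be a unit.\<close>
  have ck: "coprime k (int q)"
    using k[OF t(1)] coprime_dvd_pm[OF t(2)] by blast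
  define \<kappa> where "\<kappa> = absres q k"
  have \<kappa>: "int q dvd (k - \<kappa>) \<or> int q dvd (k + \<kappa>)" "0 \<le> \<kappa>" "\<kappa> \<le> int q div 2"
    using absres_cong[OF q] absres_range[OF q] by (auto simp: \<kappa>_def)
  have c\<kappa>: "coprime \<kappa> (int q)"
    using coprime_dvd_pm[OF ck, of \<kappa> 1] \<kappa>(1) by simp
  have \<kappa>0: "\<kappa> \<noteq> 0" using c\<kappa> q4 by auto
  have "\<kappa> \<noteq> a" using c\<kappa> a by blast
  \<comment> \<open>Otherwise \<open>\<kappa>\<close>, a unit and hence not \<open>a\<close>, is
    itself a weight of the first space; its partner \<open>y\<close> would be \<open>1\<close> up to
    sign, which is omitted.\<close>
  have \<kappa>1: "\<kappa> = 1"
  proof (rule ccontr)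
    assume "\<kappa> \<noteq> 1"
    then have "\<kappa> \<in> {1..int q div 2} - {1, a}" using \<kappa> \<kappa>0 \<open>\<kappa> \<noteq> a\<close> by auto
    then obtain y where y: "y \<in> {1..int q div 2} - {1, b}" "int q dvd (\<kappa> - k * y) \<or> int q dvd (\<kappa> + k * y)" using k by blast
    have "int q dvd (k - k * y) \<or> int q dvd (k + k * y)"
      using y(2) \<kappa>(1) by (smt (verit) dvd_add dvd_diff)
    then have "int q dvd k * (1 - y) \<or> int q dvd k * (1 + y)" by (simp add: algebra_simps)
    then have "int q dvd (1 - y) \<or> int q dvd (1 + y)"
      using ck by (simp add: coprime_dvd_mult_right_iff coprime_commute)
    then have "1 = y" using half_range_unique[OF q, of 1 y] y(1) q4 by auto
    then show False using y(1) by simp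
  qed
  \<comment> \<open>\<open>b\<close> is a weight of the first space only, and with \<open>k\<close>
    equal to \<open>1\<close> up to sign its partner would have to be \<open>b\<close>.\<close>
  have "b \<in> {1..int q div 2} - {1, a}" using ab by auto
  then obtain y where y: "y \<in> {1..int q div 2} - {1, b}" "int q dvd (b - k * y) \<or> int q dvd (b + k * y)" using k by blast
  have "int q dvd (k - 1) * y \<or> int q dvd (k + 1) * y" using \<kappa>(1) \<kappa>1 by auto
  then have "int q dvd (b - y) \<or> int q dvd (b + y)"
    using y(2) by (auto simp: algebra_simps) (smt (verit) dvd_add dvd_diff)+
  then have "b = y" using half_range_unique[OF q, of b y] y(1) ab by auto
  then show False using y(1) by simp
qed

text \<open>The neighbours of \<open>a\<close> are units. If \<open>a\<close> is the top of the
  range, \<open>a \<noteq> b\<close> excludes \<open>a = 2\<close>, so \<open>a - 1\<close> is not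
  the omitted \<open>1\<close>.\<close>

lemma unit_in_weights:
  fixes a b :: int
  assumes ab: "a \<in> {2..int q div 2}" "b \<in> {2..int q div 2}" "a \<noteq> b"
    and cop: "coprime (1 + a) (int q)" "coprime (1 - a) (int q)"
  shows "\<exists>t\<in>{1..int q div 2} - {1, a}. coprime t (int q)"
proof (cases "a < int q div 2")
  case True
  then show ?thesis using ab cop(1) by (intro bexI[of _ "1 + a"]) auto
next
  case False
  have "coprime (a - 1) (int q)" using cop(2) by (metis coprime_minus_left_iff minus_diff_eq)
  then show ?thesis using ab False by (intro bexI[of _ "a - 1"]) auto
qed

lemma lens_dataI:
  assumes "q \<ge> 2" "t \<in> range p" "coprime t (int q)"
  shows "lens_data q p"
proof -
  have "Gcd (insert (int q) (range p)) dvd t" "Gcd (insert (int q) (range p)) dvd int q"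
    using assms(2) Gcd_dvd[of t "insert (int q) (range p)"] Gcd_dvd[of "int q" "insert (int q) (range p)"] by blast+
  then have "is_unit (Gcd (insert (int q) (range p)))" using assms(3) coprime_common_divisor by blast
  then show ?thesis using assms(1) by (simp add: lens_data_def)
qed

lemma iso_not_isom_reduced:
  fixes a b u :: int
  assumes n: "CARD('n::finite) = q div 2 - 2"
    and ab: "a \<in> {2..int q div 2}" "b \<in> {2..int q div 2}" "a \<noteq> b"
    and u: "coprime u (int q)" "int q dvd (b - u * a)"
    and cop: "coprime (1 + a) (int q)" "coprime (1 - a) (int q)" "coprime (1 + b) (int q)" "coprime (1 - b) (int q)"
    and a: "\<not> coprime a (int q)"
  shows "\<exists>p s :: 'n \<Rightarrow> int. iso_not_isom q p s"
proof -
  have q: "q > 0" "q \<ge> 2" using ab by auto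
  have enum: "\<exists>p :: 'n \<Rightarrow> int. inj p \<and> range p = {1..int q div 2} - {1, c}" if c: "c \<in> {2..int q div 2}" for c
  proof -
    have "card ({1..int q div 2} - {1, c}) = card {1..int q div 2} - card {1, c}" using c by (intro card_Diff_subset) auto
    also have "\<dots> = q div 2 - 2" using c by (simp add: nat_div_distrib)
    finally have "\<exists>p. bij_betw p (UNIV :: 'n set) ({1..int q div 2} - {1, c})"
      using n by (intro finite_same_card_bij) auto
    then show ?thesis by (auto simp: bij_betw_def)
  qed
  obtain p :: "'n \<Rightarrow> int" where p: "inj p" "range p = {1..int q div 2} - {1, a}" using enum[OF ab(1)] by blast
  obtain s :: "'n \<Rightarrow> int" where s: "inj s" "range s = {1..int q div 2} - {1, b}" using enum[OF ab(2)] by blast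
  obtain t where t: "t \<in> {1..int q div 2} - {1, a}" "coprime t (int q)" using unit_in_weights[OF ab cop(1,2)] by blast
  obtain t' where t': "t' \<in> {1..int q div 2} - {1, b}" "coprime t' (int q)"
    using unit_in_weights[OF ab(2,1) ab(3)[symmetric] cop(3,4)] by blast
  have "lens_data q p" "lens_data q s" using lens_dataI[OF q(2)] t t' p(2) s(2) by blast+
  moreover have "lens_isospectral q p s"
    by (rule lens_isospectralI[OF q(1)]) (rule card_shell_eq[OF q(1) p ab(1) s ab(2) u cop])
  moreover have "\<not> lens_isometric q p s"
  proof
    assume "lens_isometric q p s"
    then obtain U h where U: "orthogonal_transformation U" "h \<in> lens_group q s" "\<And>z. U (lens_gen q p z) = h (U z)"
      using isometric_imp_conjugate[OF q(1)] by blast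
    obtain k where "\<And>i. \<exists>j. int q dvd (p i - k * s j) \<or> int q dvd (p i + k * s j)"
      using conjugate_imp_congruent[OF q(1) U] by blast
    then have "\<forall>x\<in>range p. \<exists>y\<in>range s. int q dvd (x - k * y) \<or> int q dvd (x + k * y)" by blast
    then show False using not_congruent_weights[OF q(1) ab a t] unfolding p(2) s(2) by blast
  qed
  ultimately show ?thesis unfolding iso_not_isom_def by blast
qed

lemma coprime_dvd_diff:
  fixes x y q :: int
  assumes "coprime x q" "q dvd (x - y)"
  shows "coprime y q"
  using coprime_dvd_pm[OF assms(1), of y 1] assms(2) by simp

text \<open>Allows arbitrary representatives in place of numbers in the half range. Passing to
  \<open>absres\<close> may change signs: this exchanges \<open>1 + a\<close> with
  \<open>1 - a\<close>, and replaces \<open>u\<close> by \<open>- u\<close> if needed.\<close>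

lemma iso_not_isom_exists:
  fixes a b u :: int
  assumes n: "CARD('n::finite) = q div 2 - 2" and q: "q > 0"
    and ab: "\<not> int q dvd (a - b)" "\<not> int q dvd (a + b)"
    and u: "coprime u (int q)" "int q dvd (b - u * a)"
    and cop: "coprime (1 + a) (int q)" "coprime (1 - a) (int q)" "coprime (1 + b) (int q)" "coprime (1 - b) (int q)"
    and a: "\<not> coprime a (int q)"
  shows "\<exists>p s :: 'n \<Rightarrow> int. iso_not_isom q p s"
proof -
  have sgn_cop: "coprime (1 + absres q c) (int q) \<and> coprime (1 - absres q c) (int q)"
    if "coprime (1 + c) (int q)" "coprime (1 - c) (int q)" for c
    using absres_cong[OF q, of c]
  proof
    assume d: "int q dvd (c - absres q c)"
    have "int q dvd (1 + c - (1 + absres q c))" "int q dvd (1 - c - (1 - absres q c))"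
      using d by (simp_all add: dvd_diff_commute)
    then show ?thesis using coprime_dvd_diff that by blast
  next
    assume d: "int q dvd (c + absres q c)"
    have "int q dvd (1 + c - (1 - absres q c))" "int q dvd (1 - c - (1 + absres q c))"
      using d dvd_minus_iff[of "int q" "c + absres q c"] by (simp_all add: algebra_simps)
    then show ?thesis using coprime_dvd_diff that by blast
  qed
  have not_unit: "\<not> coprime (absres q c) (int q)" if c: "\<not> coprime c (int q)" for c
    using absres_cong[OF q, of c]
  proof
    assume "int q dvd (c - absres q c)"
    then show ?thesis using c coprime_dvd_diff[of "absres q c" "int q" c] by (auto simp: dvd_diff_commute)
  next
    assume "int q dvd (c + absres q c)"
    then have "int q dvd - (c + absres q c)" by (simp only: dvd_minus_iff)
    moreover have "- (c + absres q c) = - absres q c - c" by simp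
    ultimately have "int q dvd (- absres q c - c)" by (simp only:)
    then show ?thesis using c coprime_dvd_diff[of "- absres q c" "int q" c] by auto
  qed
  have b: "\<not> coprime b (int q)"
  proof
    assume cb: "coprime b (int q)"
    have "coprime (u * a) (int q)" by (rule coprime_dvd_diff[OF cb u(2)])
    then show False using a by simp
  qed
  have not0: "absres q c \<noteq> 0" if c: "\<not> int q dvd c" for c
    using absres_cong[OF q, of c] c by auto
  have dvd_iff: "int q dvd a \<longleftrightarrow> int q dvd b"
  proof
    assume "int q dvd a"
    then show "int q dvd b" using dvd_pm_cancel[of "int q" b "u * a"] u(2) dvd_mult by blast
  next
    assume "int q dvd b"
    then have "int q dvd b - (b - u * a)" using u(2) by (rule dvd_diff)
    then have "int q dvd u * a" by simp
    then show "int q dvd a" using u(1) by (simp add: coprime_dvd_mult_right_iff coprime_commute)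
  qed
  then have nd: "\<not> int q dvd a" "\<not> int q dvd b" using ab(1) by (auto intro: dvd_diff)
  have in_range: "absres q c \<in> {2..int q div 2}" if "\<not> int q dvd c" "\<not> coprime c (int q)" for c
  proof -
    have "absres q c \<noteq> 1" using not_unit[OF that(2)] by auto
    then show ?thesis using not0[OF that(1)] absres_range[OF q, of c] by auto
  qed
  have ne: "absres q a \<noteq> absres q b"
  proof
    assume "absres q a = absres q b"
    then have "int q dvd (a - b) \<or> int q dvd (a + b)"
      using absres_cong[OF q, of a] absres_cong[OF q, of b] by (smt (verit) dvd_add dvd_diff)
    then show False using ab by blast
  qed
  have "\<exists>v. coprime v (int q) \<and> int q dvd (absres q b - v * absres q a)"
  proof -
    define A where "A = absres q a"
    define B where "B = absres q b"
    have "int q dvd (u * (a - A)) \<or> int q dvd (u * (a + A))"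
      using absres_cong[OF q, of a] by (auto simp: A_def)
    then have "int q dvd (b - u * A) \<or> int q dvd (b + u * A)"
      using u(2) by (auto simp: algebra_simps) (smt (verit) dvd_add dvd_diff)+
    then have "int q dvd (B - u * A) \<or> int q dvd (B + u * A)"
      using absres_cong[OF q, of b] unfolding B_def by (smt (verit) dvd_add dvd_diff)
    then have "int q dvd (B - u * A) \<or> int q dvd (B - (- u) * A)" by simp
    moreover have "coprime (- u) (int q)" using u(1) by simp
    ultimately show ?thesis using u(1) unfolding A_def B_def by blast
  qed
  then obtain v where "coprime v (int q)" "int q dvd (absres q b - v * absres q a)" by blast
  from iso_not_isom_reduced[OF n in_range[OF nd(1) a] in_range[OF nd(2) b] ne this] sgn_cop cop not_unit[OF a]
  show ?thesis by blast
qed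

text \<open>The pair \<open>p\<close>, \<open>2 p\<close> with unit \<open>2\<close> works once
  \<open>q\<close> divides neither \<open>p\<close> nor \<open>3 p\<close>, which
  \<open>5 p \<le> q\<close> guarantees. For \<open>q = 9\<close> the sum \<open>3 + 6\<close> would
  be zero modulo \<open>q\<close>, so the two choices would coincide up to sign.\<close>

lemma iso_not_isom_prime_power:
  fixes p m q :: nat
  assumes "prime p" "odd p" "(p \<ge> 5 \<and> m \<ge> 2) \<or> (p \<ge> 3 \<and> m \<ge> 3)" "q = p ^ m"
    "CARD('n::finite) = q div 2 - 2"
  shows "\<exists>a b :: 'n \<Rightarrow> int. iso_not_isom q a b"
proof -
  have p: "p > 0" using assms(1) prime_gt_0_nat by blast
  have q5: "5 * p \<le> q"
  proof (cases "p \<ge> 5 \<and> m \<ge> 2")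
    case True
    have "5 * p \<le> p * p" using True by simp
    also have "\<dots> \<le> q" using power_increasing[of 2 m p] True p unfolding assms(4) by (simp add: power2_eq_square)
    finally show ?thesis .
  next
    case False
    then have p3: "p \<ge> 3" "m \<ge> 3" using assms(3) by auto
    have "9 \<le> p * p" using mult_le_mono[OF p3(1) p3(1)] by simp
    then have "9 * p \<le> p * p * p" by simp
    also have "\<dots> \<le> q" using power_increasing[of 3 m p] p3 p unfolding assms(4) by (simp add: power3_eq_cube)
    finally show ?thesis by simp
  qed
  have cop: "coprime (1 + c * int p) (int q)" for c
  proof -
    have "coprime (1 + c * int p) (int p)"
      using coprime_dvd_diff[of 1 "int p" "1 + c * int p"] by simp
    then show ?thesis by (simp add: assms(4))
  qed
  have nd: "\<not> int q dvd int k" if "0 < k" "k < 5 * p" for k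
    using that q5 by (auto dest: zdvd_imp_le simp: int_dvd_int_iff dest!: dvd_imp_le)
  show ?thesis
  proof (rule iso_not_isom_exists[OF assms(5), of "int p" "2 * int p" 2])
    show "q > 0" using q5 p by simp
    show "\<not> int q dvd (int p - 2 * int p)" using nd[of p] p by simp
    show "\<not> int q dvd (int p + 2 * int p)" using nd[of "3 * p"] p by simp
    show "coprime 2 (int q)" using assms(2,4) by simp
    show "\<not> coprime (int p) (int q)"
    proof
      assume c: "coprime (int p) (int q)"
      have "m > 0" using assms(3) by auto
      then have "int p dvd int q" by (simp add: assms(4))
      then have "is_unit (int p)" using c coprime_common_divisor dvd_refl by blast
      then show False using assms(1) prime_gt_1_nat[of p] by simp
    qed
  qed (use cop[of 1] cop[of "-1"] cop[of 2] cop[of "-2"] in simp_all)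
qed

text \<open>\<open>r\<close> may be \<open>2\<close>. For the pair \<open>2 e\<close>,
  \<open>3 e\<close> the numbers to be units are \<open>1\<close> modulo \<open>r\<close> and
  \<open>3\<close>, \<open>-1\<close>, \<open>4\<close>, \<open>-2\<close> modulo \<open>P\<close>;
  difference and sum are \<open>-1\<close> and \<open>5\<close> modulo \<open>P\<close>. At
  \<open>P = 5\<close> the pair would coincide up to sign.\<close>

lemma iso_not_isom_two_primes:
  fixes r P q :: nat
  assumes "prime r" "prime P" "r \<noteq> P" "P \<ge> 7" "q = r * P" "CARD('n::finite) = q div 2 - 2"
  shows "\<exists>a b :: 'n \<Rightarrow> int. iso_not_isom q a b"
proof -
  have iq: "int q = int r * int P" by (simp add: assms(5))
  have pr: "prime (int r)" "prime (int P)" using assms by simp_all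
  have rP: "coprime (int r) (int P)" using assms primes_coprime[of r P] by simp
  obtain c where c: "[int r * c = 1] (mod int P)" using cong_solve_coprime_int[OF rP] by blast
  \<comment> \<open>the idempotent that is \<open>0\<close> modulo \<open>r\<close> and \<open>1\<close> modulo \<open>P\<close>; below \<open>2 u \<equiv> 3\<close> modulo \<open>P\<close>\<close>
  define e where "e = int r * c"
  have er: "int r dvd e" by (simp add: e_def)
  have eP: "int P dvd (e - 1)" using c by (simp add: e_def cong_iff_dvd_diff)
  have copq: "coprime x (int q)" if "coprime x (int r)" "coprime x (int P)" for x
    using that unfolding iq by simp
  have dq: "int q dvd x \<longleftrightarrow> int r dvd x \<and> int P dvd x" for x
    unfolding iq using rP divides_mult[of "int r" x "int P"] by (meson dvd_mult_left dvd_mult_right dvd_trans)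
  have small: "\<not> int P dvd k" if "k \<noteq> 0" "\<bar>k\<bar> < 7" for k
    using that assms(4) dvd_imp_le_int[of k "int P"] by auto
  have coP: "coprime x (int P)" if "int P dvd (x - k)" "k \<noteq> 0" "\<bar>k\<bar> < 7" for x k
  proof -
    have "\<not> int P dvd x" 
    proof
      assume "int P dvd x"
      then have "int P dvd x - (x - k)" using that(1) by (rule dvd_diff)
      then show False using small[OF that(2,3)] by simp
    qed
    then show ?thesis using prime_imp_coprime[OF pr(2)] coprime_commute by blast
  qed
  have cor: "coprime x (int r)" if "int r dvd (x - 1)" for x
    by (rule coprime_dvd_diff[of 1]) (use that in \<open>simp_all add: dvd_diff_commute\<close>)
  have cop: "coprime (1 + k * e) (int q)" if "1 + k \<noteq> 0" "\<bar>1 + k\<bar> < 7" for k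
  proof (rule copq[OF cor coP[OF _ that]])
    show "int r dvd (1 + k * e - 1)" using er by simp
    have "int P dvd k * (e - 1)" using eP by simp
    then show "int P dvd (1 + k * e - (1 + k))" by (simp add: algebra_simps)
  qed
  have oddP: "odd P" using assms(2,4) prime_odd_nat[of P] by simp
  then obtain t where t: "int P + 3 = 2 * t" by (metis dvdE even_add odd_numeral even_of_nat)
  \<comment> \<open>\<open>t\<close> represents \<open>3 / 2\<close> modulo \<open>P\<close>;
    \<open>u\<close> is \<open>t\<close> modulo \<open>P\<close> and \<open>1\<close> modulo
    \<open>r\<close>, hence a unit at both primes.\<close>
  define u where "u = 1 + e * (t - 1)"
  have uP: "int P dvd (u - t)"
  proof -
    have "u - t = (e - 1) * (t - 1)" by (simp add: u_def algebra_simps)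
    then show ?thesis using eP by simp
  qed
  show ?thesis
  proof (rule iso_not_isom_exists[OF assms(6), of "2 * e" "3 * e" u])
    show "q > 0" using assms prime_gt_0_nat by simp
    have "\<not> int P dvd k * e" if "k \<noteq> 0" "\<bar>k\<bar> < 7" for k
    proof
      assume "int P dvd k * e"
      moreover have "int P dvd k * (e - 1)" using eP by simp
      ultimately have "int P dvd (k * e - k * (e - 1))" by (rule dvd_diff)
      then show False using small[OF that] by (simp add: algebra_simps)
    qed
    from this[of "-1"] this[of 5]
    show "\<not> int q dvd (2 * e - 3 * e)" "\<not> int q dvd (2 * e + 3 * e)" unfolding dq by simp_all
    show "coprime u (int q)"
    proof (rule copq)
      show "coprime u (int r)" by (rule cor) (simp add: u_def er)
      have "\<not> int P dvd u"
      proof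
        assume "int P dvd u"
        then have "int P dvd u - (u - t)" using uP by (rule dvd_diff)
        then have "int P dvd t" by simp
        then have "int P dvd int P + 3" using t by simp
        then have "int P dvd 3" by simp
        then show False using small[of 3] by simp
      qed
      then show "coprime u (int P)" using prime_imp_coprime[OF pr(2)] coprime_commute by blast
    qed
    show "int q dvd (3 * e - u * (2 * e))" unfolding dq
    proof
      show "int r dvd (3 * e - u * (2 * e))" using er by simp
      have "3 * e - u * (2 * e) = e * (3 - 2 * t) - 2 * e * (u - t)" by (simp add: algebra_simps)
      moreover have "3 - 2 * t = - int P" using t by simp
      ultimately show "int P dvd (3 * e - u * (2 * e))" using uP by simp
    qed
    show "\<not> coprime (2 * e) (int q)"
    proof
      assume c: "coprime (2 * e) (int q)"
      have "int r dvd 2 * e" "int r dvd int q" using er by (simp_all add: iq)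
      then have "is_unit (int r)" using c coprime_common_divisor by blast
      then show False using pr(1) not_prime_unit by blast
    qed
  qed (use cop[of 2] cop[of "-2"] cop[of 3] cop[of "-3"] in simp_all)
qed

text \<open>Every odd number is a unit, in particular \<open>1 \<plusminus> 2\<close>,
  \<open>1 \<plusminus> 6\<close> and the factor \<open>3\<close>. The bound
  \<open>q \<ge> 16\<close> keeps \<open>q\<close> from dividing the difference \<open>-4\<close>
  and the sum \<open>8\<close>.\<close>

lemma iso_not_isom_two_power:
  fixes m q :: nat
  assumes "m \<ge> 4" "q = 2 ^ m" "CARD('n::finite) = q div 2 - 2"
  shows "\<exists>a b :: 'n \<Rightarrow> int. iso_not_isom q a b"
proof -
  have q16: "q \<ge> 16" using power_increasing[of 4 m "2::nat"] assms by simp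
  have odd: "coprime x (int q)" if "odd x" for x using that by (simp add: assms(2))
  show ?thesis
  proof (rule iso_not_isom_exists[OF assms(3), of 2 6 3])
    show "q > 0" using q16 by simp
    show "\<not> int q dvd (2 - 6)" "\<not> int q dvd (2 + 6)" using q16 by (auto dest: zdvd_imp_le)
    show "\<not> coprime 2 (int q)" using assms by simp
  qed (use odd in simp_all)
qed

theorem theorem3p1p6:
  shows
   "(\<forall>(p::nat) (m::nat) q. prime p \<and> odd p \<and> m \<ge> 1 \<and> ((p \<ge> 5 \<and> m \<ge> 2) \<or> (p \<ge> 3 \<and> m \<ge> 3)) \<and> q = p ^ m
       \<and> CARD('n::finite) = (q - 1) div 2 - 2
       \<longrightarrow> (\<exists>a b :: 'n \<Rightarrow> int. iso_not_isom q a b))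
  \<and> (\<forall>(p1::nat) (p2::nat) q. prime p1 \<and> prime p2 \<and> odd p1 \<and> odd p2 \<and> p1 \<noteq> p2 \<and> q = p1 * p2 \<and> q \<ge> 33
       \<and> CARD('n2::finite) = (q - 1) div 2 - 2
       \<longrightarrow> (\<exists>a b :: 'n2 \<Rightarrow> int. iso_not_isom q a b))
  \<and> (\<forall>(m::nat) q. m \<ge> 6 \<and> q = 2 ^ m \<and> CARD('n3::finite) = q div 2 - 2
       \<longrightarrow> (\<exists>a b :: 'n3 \<Rightarrow> int. iso_not_isom q a b))
  \<and> (\<forall>(p::nat) q. prime p \<and> odd p \<and> p \<ge> 7 \<and> q = 2 * p \<and> CARD('n4::finite) = q div 2 - 2
       \<longrightarrow> (\<exists>a b :: 'n4 \<Rightarrow> int. iso_not_isom q a b))"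
proof (intro conjI allI impI; elim conjE)
  have half: "(q - 1) div 2 = q div 2" if "odd q" for q :: nat using that by (elim oddE) simp
  {
    fix p m q :: nat
    assume "prime p" "odd p" "5 \<le> p \<and> 2 \<le> m \<or> 3 \<le> p \<and> 3 \<le> m" "q = p ^ m" "CARD('n) = (q - 1) div 2 - 2"
    moreover from this have "odd q" by simp
    ultimately show "\<exists>a b :: 'n \<Rightarrow> int. iso_not_isom q a b"
      using half[of q] by (intro iso_not_isom_prime_power[of p m]) simp_all
  next
    fix p1 p2 q :: nat
    assume a: "prime p1" "prime p2" "odd p1" "odd p2" "p1 \<noteq> p2" "q = p1 * p2" "33 \<le> q" "CARD('n2) = (q - 1) div 2 - 2"
    have "odd q" using a by simp
    then have n: "CARD('n2) = q div 2 - 2" using a(8) half by simp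
    have "p1 \<ge> 7 \<or> p2 \<ge> 7"
    proof (rule ccontr)
      assume "\<not> ?thesis"
      then have "p1 \<le> 6" "p2 \<le> 6" by auto
      moreover have "p1 \<noteq> 6" "p2 \<noteq> 6" using a(3,4) by auto
      ultimately have "p1 \<le> 5" "p2 \<le> 5" by linarith+
      then have "q \<le> 5 * 5" unfolding a(6) by (intro mult_le_mono)
      then show False using a(7) by simp
    qed
    then show "\<exists>a b :: 'n2 \<Rightarrow> int. iso_not_isom q a b"
    proof
      assume "p1 \<ge> 7"
      then show ?thesis using a n by (intro iso_not_isom_two_primes[of p2 p1]) (simp_all add: mult.commute)
    next
      assume "p2 \<ge> 7"
      then show ?thesis using a n by (intro iso_not_isom_two_primes[of p1 p2]) simp_all
    qed
  next
    fix m q :: nat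
    assume "6 \<le> m" "q = 2 ^ m" "CARD('n3) = q div 2 - 2"
    then show "\<exists>a b :: 'n3 \<Rightarrow> int. iso_not_isom q a b" by (intro iso_not_isom_two_power[of m]) simp_all
  next
    fix p q :: nat
    assume "prime p" "odd p" "7 \<le> p" "q = 2 * p" "CARD('n4) = q div 2 - 2"
    then show "\<exists>a b :: 'n4 \<Rightarrow> int. iso_not_isom q a b" by (intro iso_not_isom_two_primes[of 2 p]) auto
  }
qed

end
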